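(* Let $Q$ be a quiver that has a finite pre-forkless part, and let $M$ be the number of quivers in the pre-forkless part of $Q$. Let $Q'$ be any (possibly disconnected) full subquiver of $Q$, and let $m$ be the number of vertices of $Q'$. Then $Q'$ also has a finite pre-forkless part, and the number of quivers in the pre-forkless part of $Q'$ is at most $\max\{M,10m-20\}$.
   Context: A quiver is a finite directed multigraph with vertex set $Q_0$ and arrow set $Q_1$, with no loops and no 2-cycles. For vertices $i,j$ write $q_{ij}$ for the number of arrows $i\to j$ if there are such arrows, and minus the number of arrows $j\to i$ otherwise (similarly $p_{ij}$, $f_{ij}$ for quivers $P$, $F$). Mutation at $v$: $\mu_v(Q)$ has $q'_{ab}=-q_{ab}$ if $v\in\{a,b\}$ and $q'_{ab}=q_{ab}+\max(q_{av},0)\max(q_{vb},0)-\max(q_{bv},0)\max(q_{va},0)$ otherwise; $\mu_{[i_1,\dots,i_n]}$ means mutate at $i_1$, then $i_2$, etc. The labelled mutation class $[Q]$ is the set of quivers on $Q_0$ obtainable from $Q$ by mutations; the labelled mutation graph has vertex set $[Q]$ and an edge labelled $\mu_v$ between $P$ and $\mu_v(P)$. A full subquiver is induced on a vertex subset; $Q\setminus V$ is the full subquiver on $Q_0\setminus V$. Abundant: at least two arrows between every pair of distinct vertices; acyclic: no directed cycle. $Q^+(v)=\{j:q_{vj}>0\}$, $Q^-(v)=\{j:q_{jv}>0\}$. A fork is an abundant, non-acyclic quiver $F$ with a vertex $r$ (point of return) such that for all $i\in F^-(r)$, $j\in F^+(r)$: $f_{ji}>f_{ir}$ and $f_{ji}>f_{rj}$,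 and the full subquivers on $F^-(r)$ and on $F^+(r)$ are acyclic. A pre-fork with vertices $\{r,k,k'\}$ is a quiver $P$ with $k\neq k'$ such that $P\setminus\{k\}$ and $P\setminus\{k'\}$ are forks with common point of return $r$, and for every vertex $i\notin\{k,k'\}$ either ($k\to i$ and $k'\to i$) or ($i\to k$ and $i\to k'$), with any number (possibly zero) of arrows between $k$ and $k'$. Branches: for a fork $F$ with point of return $r$, its branch is the connected component containing $F$ of the labelled mutation graph with the edge between $F$ and $\mu_r(F)$ removed. For a pre-fork $P$ with vertices $\{r,k,k'\}$: if $p_{kk'}=0$ or $|p_{kk'}|\ge 2$ remove the edge between $P$ and $\mu_r(P)$; if $|p_{kk'}|=1$, let $\tilde P=\mu_{[k,k',k,k',k]}(P)$ and remove the edges between $P$ and $\mu_r(P)$ and between $\tilde P$ and $\mu_r(\tilde P)$; the branch of $P$ is the connected component containing $P$ of the resulting graph. The pre-forkless part of $Q$ is the set of quivers in $[Q]$ that lie in no branch of any fork or pre-fork in $[Q]$; $Q$ has a finite pre-forkless part if this set is finite.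
   Formalization: The bound max{M,10m-20} is stated only when m ≥ 3 or M ≥ 2, since it fails otherwise (the cyclic triangle with 3 arrows per side has M = 1, its two-vertex subquivers have 2 quivers); finiteness is stated for every m. *)

theory Defs
  imports Main
begin

text \<open>
  A quiver without loops and 2-cycles is encoded by its vertex set and its signed arrow count
  \<^term>\<open>q i j\<close>: the number of arrows from \<^term>\<open>i\<close> to \<^term>\<open>j\<close> if there are such arrows,
  and minus the number of arrows from \<^term>\<open>j\<close> to \<^term>\<open>i\<close> otherwise.
  The count is 0 off the vertex set, so that equality of records is equality of labelled quivers.
\<close>

record 'a quiver =
  verts :: "'a set"
  arr :: "'a \<Rightarrow> 'a \<Rightarrow> int"

definition is_quiver :: "'a quiver \<Rightarrow> bool" where
  "is_quiver Q \<longleftrightarrow>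
     finite (verts Q) \<and>
     (\<forall>i j. arr Q j i = - arr Q i j) \<and>
     (\<forall>i j. arr Q i j \<noteq> 0 \<longrightarrow> i \<in> verts Q \<and> j \<in> verts Q)"

definition mutate :: "'a \<Rightarrow> 'a quiver \<Rightarrow> 'a quiver" where
  "mutate v Q =
     \<lparr>verts = verts Q,
      arr = (\<lambda>a b. if v = a \<or> v = b then - arr Q a b
                    else arr Q a b + max (arr Q a v) 0 * max (arr Q v b) 0
                                   - max (arr Q b v) 0 * max (arr Q v a) 0)\<rparr>"

text \<open>The first vertex of the list is mutated first.\<close>

definition mutate_seq :: "'a list \<Rightarrow> 'a quiver \<Rightarrow> 'a quiver" where
  "mutate_seq vs Q = fold mutate vs Q"

definition mutation_class :: "'a quiver \<Rightarrow> 'a quiver set" where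
  "mutation_class Q = {mutate_seq vs Q | vs. set vs \<subseteq> verts Q}"

definition induced :: "'a quiver \<Rightarrow> 'a set \<Rightarrow> 'a quiver" where
  "induced Q W =
     \<lparr>verts = verts Q \<inter> W,
      arr = (\<lambda>i j. if i \<in> verts Q \<inter> W \<and> j \<in> verts Q \<inter> W then arr Q i j else 0)\<rparr>"

definition full_subquiver :: "'a quiver \<Rightarrow> 'a quiver \<Rightarrow> bool" where
  "full_subquiver Q' Q \<longleftrightarrow> (\<exists>W \<subseteq> verts Q. Q' = induced Q W)"

definition delete_verts :: "'a quiver \<Rightarrow> 'a set \<Rightarrow> 'a quiver" where
  "delete_verts Q V = induced Q (verts Q - V)"

definition abundant :: "'a quiver \<Rightarrow> bool" where
  "abundant Q \<longleftrightarrow> (\<forall>i \<in> verts Q. \<forall>j \<in> verts Q. i \<noteq> j \<longrightarrow> \<bar>arr Q i j\<bar> \<ge> 2)"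

definition acyclic_quiver :: "'a quiver \<Rightarrow> bool" where
  "acyclic_quiver Q \<longleftrightarrow> acyclic {(i, j). i \<in> verts Q \<and> j \<in> verts Q \<and> arr Q i j > 0}"

definition out_nbrs :: "'a quiver \<Rightarrow> 'a \<Rightarrow> 'a set" where
  "out_nbrs Q v = {j \<in> verts Q. arr Q v j > 0}"

definition in_nbrs :: "'a quiver \<Rightarrow> 'a \<Rightarrow> 'a set" where
  "in_nbrs Q v = {j \<in> verts Q. arr Q j v > 0}"

definition fork :: "'a quiver \<Rightarrow> 'a \<Rightarrow> bool" where
  "fork F r \<longleftrightarrow>
     is_quiver F \<and> abundant F \<and> \<not> acyclic_quiver F \<and> r \<in> verts F \<and>
     (\<forall>i \<in> in_nbrs F r. \<forall>j \<in> out_nbrs F r. arr F j i > arr F i r \<and> arr F j i > arr F r j) \<and>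
     acyclic_quiver (induced F (in_nbrs F r)) \<and>
     acyclic_quiver (induced F (out_nbrs F r))"

definition prefork :: "'a quiver \<Rightarrow> 'a \<Rightarrow> 'a \<Rightarrow> 'a \<Rightarrow> bool" where
  "prefork P r k k' \<longleftrightarrow>
     is_quiver P \<and> k \<in> verts P \<and> k' \<in> verts P \<and> k \<noteq> k' \<and>
     fork (delete_verts P {k}) r \<and> fork (delete_verts P {k'}) r \<and>
     (\<forall>i \<in> verts P - {k, k'}.
        (arr P k i > 0 \<and> arr P k' i > 0) \<or> (arr P i k > 0 \<and> arr P i k' > 0))"

text \<open>
  An edge of the labelled mutation graph consists of its unordered pair of endpoints (a singleton
  for a loop) and its label; parallel edges with different labels are different edges.
\<close>

definition mutation_edge :: "'a quiver \<Rightarrow> 'a \<Rightarrow> 'a quiver set \<times> 'a" where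
  "mutation_edge P v = ({P, mutate v P}, v)"

definition mutation_edges :: "'a quiver \<Rightarrow> ('a quiver set \<times> 'a) set" where
  "mutation_edges Q = {mutation_edge P v | P v. P \<in> mutation_class Q \<and> v \<in> verts Q}"

definition component :: "('a quiver set \<times> 'a) set \<Rightarrow> 'a quiver \<Rightarrow> 'a quiver set" where
  "component E P = {R. (P, R) \<in> {(A, B). \<exists>v. ({A, B}, v) \<in> E}\<^sup>*}"

definition fork_branch :: "'a quiver \<Rightarrow> 'a \<Rightarrow> 'a quiver set" where
  "fork_branch F r = component (mutation_edges F - {mutation_edge F r}) F"

definition prefork_branch :: "'a quiver \<Rightarrow> 'a \<Rightarrow> 'a \<Rightarrow> 'a \<Rightarrow> 'a quiver set" where
  "prefork_branch P r k k' =
     (if \<bar>arr P k k'\<bar> = 1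
      then component (mutation_edges P -
             {mutation_edge P r, mutation_edge (mutate_seq [k, k', k, k', k] P) r}) P
      else component (mutation_edges P - {mutation_edge P r}) P)"

definition preforkless_part :: "'a quiver \<Rightarrow> 'a quiver set" where
  "preforkless_part Q =
     {R \<in> mutation_class Q.
        (\<forall>F \<in> mutation_class Q. \<forall>r. fork F r \<longrightarrow> R \<notin> fork_branch F r) \<and>
        (\<forall>P \<in> mutation_class Q. \<forall>r k k'. prefork P r k k' \<longrightarrow> R \<notin> prefork_branch P r k k')}"

definition has_finite_preforkless_part :: "'a quiver \<Rightarrow> bool" where
  "has_finite_preforkless_part Q \<longleftrightarrow> finite (preforkless_part Q)"

end

theory Submission
  imports Defs
begin

text \<open>
  Call a quiver mutable at a vertex v if mutating at v yields a fork with point of return v (or, if v is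
  a source or sink, an abundant acyclic quiver). A fork is mutable at every vertex but its point of
  return, so its branch is a tree of forks. In a pre-fork the vertices k and k' stand in the same
  position relative to all others, and mutations at k and k' alone run through a cycle of 4 quivers
  (no arrow between k and k') or 10 quivers (one arrow; this is the pentagon relation, which
  interchanges k and k' after five mutations). Mutating any member of this orbit at a third vertex
  gives a fork or a pre-fork, the entry edges excepted. So branches consist of forks and of orbits of
  pre-forks, and conversely every such quiver lies in a branch.

  Let R' be in the mutation class of Q', lifted to R in the class of Q. If R lies in a branch, then
  restricting the fork or pre-fork orbit shows that R' lies in a branch, unless the class of Q'
  contains an abundant acyclic quiver, or one that is such up to at most one arrow between two
  consecutive vertices k and k'. In the absence of such quivers, restriction maps the pre-forkless
  part of Q onto a superset of that of Q'. In their presence, everything outside of the branches is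
  obtained from rotations by source and sink mutations: m quivers in the first case, and m - 2
  orbits of at most 10 quivers in the second. A quiver with at most 2 vertices has a class of
  at most 2 quivers.
\<close>

section \<open>Forks\<close>

text \<open>The obstacle is a pre-fork with at most one arrow between \<open>k\<close> and
  \<open>k'\<close>: mutating at \<open>k\<close> or \<open>k'\<close> destroys the pre-fork shape
  without leaving the branch, and with one arrow the pre-fork reappears after five steps with
  \<open>k\<close> and \<open>k'\<close> interchanged and a second edge at \<open>r\<close> that
  leads out of the branch. Hence the proof works with groups of quivers that may have several
  entries, and an exit leads to a new group only if all entries of that group lead back to the old
  one. Under this condition no uniqueness of paths has to be shown: the union of the groups reached
  from a start is closed under every mutation except the entries of the start. The fork inequalities
  survive mutation because a product of two numbers that are at least 2 is at least twice the larger
  one, which leaves room for one opposite arrow between \<open>k\<close> and \<open>k'\<close>. The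
  10 is five stages times the two orders of \<open>k\<close> and \<open>k'\<close>. The m - 2 counts
  the cyclic positions of this pair relative to the other m - 2 vertices, which are linearly
  ordered.\<close>

definition skew :: "('a \<Rightarrow> 'a \<Rightarrow> int) \<Rightarrow> bool" where
  "skew f \<longleftrightarrow> (\<forall>i j. f j i = - f i j)"

definition mut :: "'a \<Rightarrow> ('a \<Rightarrow> 'a \<Rightarrow> int) \<Rightarrow> 'a \<Rightarrow> 'a \<Rightarrow> int" where
  "mut v f = (\<lambda>a b. if v = a \<or> v = b then - f a b
     else f a b + max (f a v) 0 * max (f v b) 0 - max (f b v) 0 * max (f v a) 0)"

lemma skewD: "skew f \<Longrightarrow> f j i = - f i j"
  unfolding skew_def by blast

lemma skew_diag [simp]: "skew f \<Longrightarrow> f i i = 0"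
  using skewD[of f i i] by simp

lemma skew_mut [simp]:
  assumes "skew f" shows "skew (mut v f)"
  unfolding skew_def
proof (intro allI)
  fix i j
  show "mut v f j i = - mut v f i j"
    using skewD[OF assms, of i j] by (simp add: mut_def)
qed

lemma mut_at [simp]:
  assumes "skew f" shows "mut v f v b = f b v" "mut v f a v = f v a"
  using skewD[OF assms, of v b] skewD[OF assms, of v a] by (simp_all add: mut_def)

lemma max_skew: "skew f \<Longrightarrow> max (- f a b) 0 = max (f b a) 0"
  using skewD[of f a b] by simp

lemma mut_mut [simp]:
  assumes "skew f" shows "mut v (mut v f) = f"
proof (intro ext)
  fix a b
  show "mut v (mut v f) a b = f a b"
    using assms by (cases "v = a \<or> v = b") (auto simp: mut_def max_skew algebra_simps)
qed

lemma mut_through: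
  assumes "skew f" "v \<noteq> a" "v \<noteq> b" "f a v \<ge> 0" "f v b \<ge> 0"
  shows "mut v f a b = f a b + f a v * f v b"
  using assms skewD[OF assms(1), of b v] by (simp add: mut_def max_def)

lemma mut_in:
  assumes "skew f" "v \<noteq> a" "v \<noteq> b" "f a v \<ge> 0" "f b v \<ge> 0"
  shows "mut v f a b = f a b"
  using assms skewD[OF assms(1), of a v] skewD[OF assms(1), of b v] by (simp add: mut_def max_def)

lemma mut_out:
  assumes "skew f" "v \<noteq> a" "v \<noteq> b" "f v a \<ge> 0" "f v b \<ge> 0"
  shows "mut v f a b = f a b"
  using assms skewD[OF assms(1), of a v] skewD[OF assms(1), of b v] by (simp add: mut_def max_def)

text \<open>Transitivity stands for acyclicity: the two agree for skew counts with at least two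
  arrows between distinct vertices (\<open>acyclic_iff_abundant_order\<close>), and transitivity
  avoids reasoning about cycles.\<close>

definition abundant_order :: "'a set \<Rightarrow> ('a \<Rightarrow> 'a \<Rightarrow> int) \<Rightarrow> bool" where
  "abundant_order S f \<longleftrightarrow>
     (\<forall>a\<in>S. \<forall>b\<in>S. a \<noteq> b \<longrightarrow> \<bar>f a b\<bar> \<ge> 2) \<and>
     (\<forall>a\<in>S. \<forall>b\<in>S. \<forall>c\<in>S. f a b > 0 \<longrightarrow> f b c > 0 \<longrightarrow> f a c > 0)"

text \<open>The inequality is the point-of-return condition of \<open>mut v f\<close>, expressed in
  \<open>f\<close>: a path from \<open>u\<close> through \<open>v\<close> to \<open>w\<close> turns
  into one from \<open>w\<close> through \<open>v\<close> to \<open>u\<close>, against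
  \<open>f u w + f u v * f v w\<close> arrows from \<open>u\<close> to \<open>w\<close>. Sources and
  sinks satisfy it vacuously.\<close>

definition mutable :: "'a set \<Rightarrow> ('a \<Rightarrow> 'a \<Rightarrow> int) \<Rightarrow> 'a \<Rightarrow> bool" where
  "mutable V f v \<longleftrightarrow>
     v \<in> V \<and> (\<forall>u\<in>V. u \<noteq> v \<longrightarrow> \<bar>f u v\<bar> \<ge> 2) \<and>
     (\<forall>u\<in>V. \<forall>w\<in>V. f u v > 0 \<longrightarrow> f v w > 0 \<longrightarrow>
        f u w + f u v * f v w > f u v \<and> f u w + f u v * f v w > f v w) \<and>
     abundant_order {u\<in>V. f u v > 0} f \<and> abundant_order {w\<in>V. f v w > 0} f"

lemma mutableD:
  assumes "mutable V f v"
  shows "v \<in> V" "u \<in> V \<Longrightarrow> u \<noteq> v \<Longrightarrow> \<bar>f u v\<bar> \<ge> 2"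
    and "u \<in> V \<Longrightarrow> w \<in> V \<Longrightarrow> f u v > 0 \<Longrightarrow> f v w > 0 \<Longrightarrow>
      f u w + f u v * f v w > f u v \<and> f u w + f u v * f v w > f v w"
    and "abundant_order {u\<in>V. f u v > 0} f" "abundant_order {w\<in>V. f v w > 0} f"
  using assms unfolding mutable_def by blast+

text \<open>The vertex set is a parameter so that one \<open>f\<close> serves for all full
  subquivers. Nonempty neighbourhoods on both sides of \<open>r\<close> replace non-acyclicity, and
  abundance between the two sides follows from the inequalities; \<open>fork_iff\<close> gives the
  agreement with forks.\<close>

definition fork_on :: "'a set \<Rightarrow> ('a \<Rightarrow> 'a \<Rightarrow> int) \<Rightarrow> 'a \<Rightarrow> bool" where
  "fork_on V f r \<longleftrightarrow>
     r \<in> V \<and> (\<forall>u\<in>V. u \<noteq> r \<longrightarrow> \<bar>f u r\<bar> \<ge> 2) \<and>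
     (\<exists>i\<in>V. f i r > 0) \<and> (\<exists>j\<in>V. f r j > 0) \<and>
     (\<forall>i\<in>V. \<forall>j\<in>V. f i r > 0 \<longrightarrow> f r j > 0 \<longrightarrow> f j i > f i r \<and> f j i > f r j) \<and>
     abundant_order {i\<in>V. f i r > 0} f \<and> abundant_order {j\<in>V. f r j > 0} f"

lemma abundant_order_subset: "abundant_order S f \<Longrightarrow> T \<subseteq> S \<Longrightarrow> abundant_order T f"
  unfolding abundant_order_def by (meson subsetD)

lemma abundant_order_cong:
  "(\<And>a b. a \<in> S \<Longrightarrow> b \<in> S \<Longrightarrow> f a b = g a b) \<Longrightarrow> abundant_order S f = abundant_order S g"
  unfolding abundant_order_def by (simp cong: ball_cong)

lemma product_gt:
  fixes c x y :: int
  assumes "0 \<le> c" "2 \<le> x" "2 \<le> y"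
  shows "c + x * y > x" "c + x * y > y"
proof -
  have "x * 2 \<le> x * y" "2 * y \<le> x * y"
    using assms by (auto intro: mult_left_mono mult_right_mono)
  then show "c + x * y > x" "c + x * y > y" using assms by linarith+
qed

lemma abundant_orderD:
  assumes "abundant_order S f" "a \<in> S" "b \<in> S"
  shows "a \<noteq> b \<Longrightarrow> \<bar>f a b\<bar> \<ge> 2"
    and "c \<in> S \<Longrightarrow> f a b > 0 \<Longrightarrow> f b c > 0 \<Longrightarrow> f a c > 0"
    and "skew f \<Longrightarrow> f a b > 0 \<Longrightarrow> f a b \<ge> 2"
proof -
  show *: "\<bar>f a b\<bar> \<ge> 2" if "a \<noteq> b"
    using assms that unfolding abundant_order_def by blast
  show "f a c > 0" if "c \<in> S" "f a b > 0" "f b c > 0"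
    using assms that unfolding abundant_order_def by blast
  show "f a b \<ge> 2" if "skew f" "f a b > 0"
    using * that by (cases "a = b") auto
qed

lemma abundant_orderI:
  assumes "\<And>a b. a \<in> S \<Longrightarrow> b \<in> S \<Longrightarrow> a \<noteq> b \<Longrightarrow> \<bar>f a b\<bar> \<ge> 2"
    and "\<And>a b c. a \<in> S \<Longrightarrow> b \<in> S \<Longrightarrow> c \<in> S \<Longrightarrow> f a b > 0 \<Longrightarrow> f b c > 0 \<Longrightarrow> f a c > 0"
  shows "abundant_order S f"
  unfolding abundant_order_def using assms by blast

text \<open>Ordinal sum: no arrow returns from \<open>B\<close> to \<open>A\<close>, so two
  consecutive arrows stay on one side or cross from \<open>A\<close> to \<open>B\<close> once. Most
  orders below are assembled in this way.\<close>

lemma abundant_order_Un: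
  assumes sk: "skew f" and A: "abundant_order A f" and B: "abundant_order B f"
    and AB: "\<And>a b. a \<in> A \<Longrightarrow> b \<in> B \<Longrightarrow> f a b \<ge> 2"
  shows "abundant_order (A \<union> B) f"
proof (rule abundant_orderI)
  fix a b assume "a \<in> A \<union> B" "b \<in> A \<union> B" "a \<noteq> b"
  then show "2 \<le> \<bar>f a b\<bar>"
    using abundant_orderD(1)[OF A, of a b] abundant_orderD(1)[OF B, of a b]
      AB[of a b] AB[of b a] skewD[OF sk, of a b] by auto
next
  fix a b c assume h: "a \<in> A \<union> B" "b \<in> A \<union> B" "c \<in> A \<union> B" "0 < f a b" "0 < f b c"
  have "\<not> (b \<in> A \<and> a \<in> B)" "\<not> (c \<in> A \<and> b \<in> B)"
    using AB[of b a] AB[of c b] h skewD[OF sk, of a b] skewD[OF sk, of b c] by auto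
  then have "a \<in> A \<and> c \<in> B \<or> a \<in> A \<and> b \<in> A \<and> c \<in> A \<or> a \<in> B \<and> b \<in> B \<and> c \<in> B"
    using h by auto
  then show "f a c > 0"
    using h AB[of a c] abundant_orderD(2)[OF A, of a b c] abundant_orderD(2)[OF B, of a b c] by auto
qed

lemma abundant_order_singleton [simp]: "abundant_order {a} f"
  by (simp add: abundant_order_def)

text \<open>By transitivity the direct count \<open>f u w\<close> is positive, and it is increased
  by a product of factors that are at least 2.\<close>

lemma mutable_if_abundant_order:
  assumes sk: "skew f" and ord: "abundant_order V f" and v: "v \<in> V"
  shows "mutable V f v"
proof -
  have "f u w + f u v * f v w > f u v \<and> f u w + f u v * f v w > f v w"
    if "u \<in> V" "w \<in> V" "f u v > 0" "f v w > 0" for u w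
  proof -
    have "f u w > 0" using abundant_orderD(2)[OF ord that(1) v that(2-4)] .
    moreover have "f u v \<ge> 2" "f v w \<ge> 2"
      using abundant_orderD(3)[OF ord _ _ sk] v that by auto
    ultimately show ?thesis using product_gt[of "f u w" "f u v" "f v w"] by simp
  qed
  moreover have "abundant_order {u\<in>V. f u v > 0} f" "abundant_order {u\<in>V. f v u > 0} f"
    using abundant_order_subset[OF ord] by auto
  ultimately show ?thesis using abundant_orderD(1)[OF ord _ v] v unfolding mutable_def by blast
qed

lemma mut_cases:
  assumes sk: "skew f" and m: "mutable V f v" and a: "a \<in> V" and b: "b \<in> V"
  shows "f a v > 0 \<Longrightarrow> f b v > 0 \<Longrightarrow> mut v f a b = f a b"
    and "f v a > 0 \<Longrightarrow> f v b > 0 \<Longrightarrow> mut v f a b = f a b"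
    and "f a v > 0 \<Longrightarrow> f v b > 0 \<Longrightarrow> mut v f a b > f a v \<and> mut v f a b > f v b"
proof -
  show "mut v f a b = f a b" if "f a v > 0" "f b v > 0"
    using sk that by (intro mut_in) auto
  show "mut v f a b = f a b" if "f v a > 0" "f v b > 0"
    using sk that by (intro mut_out) auto
  show "mut v f a b > f a v \<and> mut v f a b > f v b" if "f a v > 0" "f v b > 0"
  proof -
    have "v \<noteq> a" "v \<noteq> b" using that sk by auto
    then show ?thesis using mut_through[of f v a b] m sk that a b unfolding mutable_def by auto
  qed
qed

lemma fork_on_mut:
  assumes sk: "skew f" and m: "mutable V f v"
    and ne: "\<exists>u\<in>V. f u v > 0" "\<exists>w\<in>V. f v w > 0"
  shows "fork_on V (mut v f) v"
proof -
  have ab: "\<bar>f b a\<bar> = \<bar>f a b\<bar>" for a b using skewD[OF sk, of a b] by simp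
  have "abundant_order {i\<in>V. f i v > 0} (mut v f) = abundant_order {i\<in>V. f i v > 0} f"
    by (rule abundant_order_cong) (auto intro!: mut_cases(1)[OF sk m])
  moreover have "abundant_order {i\<in>V. f v i > 0} (mut v f) = abundant_order {i\<in>V. f v i > 0} f"
    by (rule abundant_order_cong) (auto intro!: mut_cases(2)[OF sk m])
  moreover have "mut v f j i > f v i \<and> mut v f j i > f j v"
    if "i \<in> V" "j \<in> V" "f v i > 0" "f j v > 0" for i j
    using mut_cases(3)[OF sk m that(2,1)] that by auto
  ultimately show ?thesis
    using m ne unfolding mutable_def fork_on_def mut_at[OF sk] by (auto simp: ab[of v])
qed

text \<open>All other vertices are out-neighbours of the source \<open>v\<close> and therefore
  ordered; the mutation merely moves \<open>v\<close> from the first to the last position.\<close>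

lemma abundant_order_mut_source:
  assumes sk: "skew f" and m: "mutable V f v" and src: "\<And>u. u \<in> V \<Longrightarrow> \<not> f u v > 0"
  shows "abundant_order V f" and "abundant_order V (mut v f)"
proof -
  have ab: "\<bar>f b a\<bar> = \<bar>f a b\<bar>" for a b using skewD[OF sk, of a b] by simp
  have nz: "f v v = 0" using sk by simp
  have pos: "f v u \<ge> 2" if "u \<in> V" "u \<noteq> v" for u
  proof -
    have "\<bar>f u v\<bar> \<ge> 2" using m that unfolding mutable_def by blast
    then show ?thesis using src[OF that(1)] skewD[OF sk, of u v] by auto
  qed
  have ord: "abundant_order (V - {v}) f"
  proof (rule abundant_order_subset)
    show "abundant_order {w\<in>V. f v w > 0} f" using m unfolding mutable_def by auto
    show "V - {v} \<subseteq> {w\<in>V. f v w > 0}" using pos by fastforce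
  qed
  show "abundant_order V f"
  proof (rule abundant_orderI)
    fix a b assume h: "a \<in> V" "b \<in> V" "a \<noteq> b"
    then show "2 \<le> \<bar>f a b\<bar>"
      using abundant_orderD(1)[OF ord, of a b] pos[of a] pos[of b] ab[of a v] by fastforce
  next
    fix a b c assume h: "a \<in> V" "b \<in> V" "c \<in> V" "0 < f a b" "0 < f b c"
    have "b \<noteq> v" "c \<noteq> v" using src h by auto
    then show "f a c > 0" using pos[of c] abundant_orderD(2)[OF ord, of a b c] h
      by (cases "a = v") auto
  qed
  have same: "mut v f a b = f a b" if "a \<in> V - {v}" "b \<in> V - {v}" for a b
    using mut_out[OF sk, of v a b] pos[of a] pos[of b] that by auto
  show "abundant_order V (mut v f)"
  proof (rule abundant_orderI)
    fix a b assume h: "a \<in> V" "b \<in> V" "a \<noteq> b"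
    consider "a = v" | "b = v" | "a \<noteq> v" "b \<noteq> v" by blast
    then show "2 \<le> \<bar>mut v f a b\<bar>"
      using abundant_orderD(1)[OF ord, of a b] pos[of a] pos[of b] same[of a b] ab[of a v] ab[of b v] h
      by cases (auto simp: sk)
  next
    fix a b c assume h: "a \<in> V" "b \<in> V" "c \<in> V" "0 < mut v f a b" "0 < mut v f b c"
    have "a \<noteq> v" "b \<noteq> v" using h src[of b] src[of c] by (auto simp: sk)
    then show "mut v f a c > 0"
      using pos[of a] abundant_orderD(2)[OF ord, of a b c] same h
      by (cases "c = v") (auto simp: sk)
  qed
qed

section \<open>Opposite quivers, which exchange sources with sinks and commute with mutation\<close>

definition rev_arr :: "('a \<Rightarrow> 'a \<Rightarrow> int) \<Rightarrow> 'a \<Rightarrow> 'a \<Rightarrow> int" where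
  "rev_arr f = (\<lambda>i j. - f i j)"

lemma rev_arr_rev_arr [simp]: "rev_arr (rev_arr f) = f"
  by (simp add: rev_arr_def)

lemma skew_rev_arr [simp]: "skew (rev_arr f) = skew f"
  unfolding skew_def rev_arr_def by (metis minus_equation_iff)

lemma rev_arr_apply: "skew f \<Longrightarrow> rev_arr f i j = f j i"
  using skewD[of f i j] by (simp add: rev_arr_def)

lemma mut_rev_arr: "skew f \<Longrightarrow> mut v (rev_arr f) = rev_arr (mut v f)"
  by (intro ext) (simp add: mut_def rev_arr_def max_skew)

lemma abundant_order_rev_arr:
  assumes "skew f" shows "abundant_order S (rev_arr f) = abundant_order S f"
proof -
  have *: "abundant_order S (rev_arr g)" if g: "skew g" "abundant_order S g" for g :: "'a \<Rightarrow> 'a \<Rightarrow> int"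
  proof (rule abundant_orderI)
    show "2 \<le> \<bar>rev_arr g a b\<bar>" if "a \<in> S" "b \<in> S" "a \<noteq> b" for a b
      unfolding rev_arr_apply[OF g(1)] using abundant_orderD(1)[OF g(2)] that by simp
    show "rev_arr g a c > 0"
      if "a \<in> S" "b \<in> S" "c \<in> S" "rev_arr g a b > 0" "rev_arr g b c > 0" for a b c
      using that abundant_orderD(2)[OF g(2), of c b a] unfolding rev_arr_apply[OF g(1)] by blast
  qed
  show ?thesis using *[of f] *[of "rev_arr f"] assms by auto
qed

lemma mutable_rev_arr [simp]:
  assumes "skew f" shows "mutable V (rev_arr f) v = mutable V f v"
proof -
  have "\<bar>f b a\<bar> = \<bar>f a b\<bar>" for a b using skewD[OF assms, of a b] by simp
  then show ?thesis
    unfolding mutable_def abundant_order_rev_arr[OF assms] rev_arr_apply[OF assms]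
    by (auto simp: mult.commute)
qed

lemma fork_on_rev_arr [simp]:
  assumes "skew f" shows "fork_on V (rev_arr f) v = fork_on V f v"
proof -
  have "\<bar>f b a\<bar> = \<bar>f a b\<bar>" for a b using skewD[OF assms, of a b] by simp
  then show ?thesis
    unfolding fork_on_def abundant_order_rev_arr[OF assms] rev_arr_apply[OF assms] by auto
qed

text \<open>Let \<open>I\<close> and \<open>J\<close> be the in- and out-neighbours of
  \<open>r\<close>. Arrows run from \<open>r\<close> to \<open>J\<close> and from \<open>J\<close>
  to \<open>I\<close>, so for \<open>v\<close> in \<open>J\<close> the in-neighbours lie in
  \<open>insert r J\<close> and the out-neighbours in \<open>J \<union> I\<close>, both of which are
  ordered. The only paths through \<open>v\<close> not inside one of these orders go from
  \<open>r\<close> to \<open>I\<close>; there the fork inequalities take over.\<close>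

lemma fork_on_mutable_aux:
  assumes sk: "skew f" and F: "fork_on V f r" and v: "v \<in> V" and rv: "f r v > 0"
  shows "mutable V f v \<and> (\<exists>u\<in>V. f u v > 0) \<and> (\<exists>w\<in>V. f v w > 0)"
proof -
  have s: "f j i = - f i j" for i j using skewD[OF sk] .
  have asym: "\<not> f b a > 0" if "f a b > 0" for a b using that s[of b a] by simp
  have nz: "f i i = 0" for i using sk by simp
  define I where "I = {i\<in>V. f i r > 0}"
  define J where "J = {j\<in>V. f r j > 0}"
  have r: "r \<in> V" and near: "\<And>u. u \<in> V \<Longrightarrow> u \<noteq> r \<Longrightarrow> \<bar>f u r\<bar> \<ge> 2"
    and I: "abundant_order I f" and J: "abundant_order J f"
    and big: "\<And>i j. i \<in> I \<Longrightarrow> j \<in> J \<Longrightarrow> f j i > f i r \<and> f j i > f r j"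
    and "I \<noteq> {}"
    using F unfolding fork_on_def I_def J_def by auto
  have vJ: "v \<in> J" using v rv J_def by auto
  have nearI: "2 \<le> f i r" if "i \<in> I" for i
  proof -
    have "i \<noteq> r" using that nz[of r] unfolding I_def by auto
    then show ?thesis using near[of i] that unfolding I_def by auto
  qed
  have nearJ: "2 \<le> f r j" if "j \<in> J" for j
  proof -
    have "j \<noteq> r" using that nz[of r] unfolding J_def by auto
    then show ?thesis using near[of j] that s[of j r] unfolding J_def by auto
  qed
  have part: "u = r \<or> u \<in> I \<or> u \<in> J" if "u \<in> V" for u
    using near[OF that] that s[of u r] unfolding I_def J_def by force
  have JI: "f j i \<ge> 3" if "j \<in> J" "i \<in> I" for i j
    using big[OF that(2,1)] nearI[OF that(2)] by linarith
  have inv: "u = r \<or> u \<in> J" if "u \<in> V" "f u v > 0" for u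
    using part[OF that(1)] JI[OF vJ, of u] asym[OF that(2)] by auto
  have outv: "u \<in> I \<or> u \<in> J" if "u \<in> V" "f v u > 0" for u
    using part[OF that(1)] rv that asym[OF rv] by auto
  have near_v: "\<bar>f u v\<bar> \<ge> 2" if "u \<in> V" "u \<noteq> v" for u
    using part[OF that(1)]
  proof (elim disjE)
    assume "u = r" then show ?thesis using nearJ[OF vJ] by simp
  next
    assume "u \<in> I" then show ?thesis using JI[OF vJ, of u] s[of u v] by simp
  next
    assume "u \<in> J" then show ?thesis using abundant_orderD(1)[OF J _ vJ] that by simp
  qed
  have ord: "abundant_order (insert r J) f"
    using abundant_order_Un[OF sk _ J, of "{r}"] nearJ by simp
  have ord': "abundant_order (J \<union> I) f"
    using JI by (intro abundant_order_Un[OF sk J I]) force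
  have cross: "f u w + f u v * f v w > f u v \<and> f u w + f u v * f v w > f v w"
    if "u \<in> V" "w \<in> V" "f u v > 0" "f v w > 0" for u w
  proof -
    have "u \<noteq> v" "w \<noteq> v" using that nz[of v] by auto
    then have uv: "f u v \<ge> 2" and vw: "f v w \<ge> 2"
      using near_v[of u] near_v[of w] that s[of w v] by auto
    show ?thesis
    proof (cases "u = r \<and> w \<in> I")
      case True
      then have b: "f v w > f w r" "f v w > f r v" using big vJ by auto
      \<comment> \<open>The arrows from \<open>w\<close> to \<open>r\<close> count negatively, but
        \<open>f v w\<close> exceeds their number and the product contains \<open>f v w\<close> at
        least twice.\<close>
      have "f r v * f v w \<ge> 2 * f v w" using uv vw True by (intro mult_right_mono) auto
      then show ?thesis using True b s[of r w] by auto
    next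
      case False
      have "f u w > 0"
        using inv[OF that(1,3)] outv[OF that(2,4)] False vJ that
          abundant_orderD(2)[OF ord, of u v w] abundant_orderD(2)[OF ord', of u v w] by blast
      then show ?thesis using product_gt[of "f u w" "f u v" "f v w"] uv vw by auto
    qed
  qed
  have "abundant_order {u\<in>V. f u v > 0} f"
    using inv by (intro abundant_order_subset[OF ord]) blast
  moreover have "abundant_order {u\<in>V. f v u > 0} f"
    using outv by (intro abundant_order_subset[OF ord']) blast
  ultimately have "mutable V f v" using near_v cross v unfolding mutable_def by blast
  moreover have "\<exists>w\<in>V. f v w > 0" using \<open>I \<noteq> {}\<close> JI[OF vJ] unfolding I_def by force
  ultimately show ?thesis using r rv by blast
qed

lemma fork_on_mutable:
  assumes sk: "skew f" and F: "fork_on V f r" and v: "v \<in> V" "v \<noteq> r"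
  shows "mutable V f v" "\<exists>u\<in>V. f u v > 0" "\<exists>w\<in>V. f v w > 0"
proof -
  have "mutable V f v \<and> (\<exists>u\<in>V. f u v > 0) \<and> (\<exists>w\<in>V. f v w > 0)"
  proof (cases "f r v > 0")
    case True then show ?thesis using fork_on_mutable_aux[OF sk F v(1)] by blast
  next
    case False
    have "\<bar>f v r\<bar> \<ge> 2" using F v unfolding fork_on_def by auto
    then have "rev_arr f r v > 0" using False skewD[OF sk, of r v] by (auto simp: rev_arr_apply[OF sk])
    then show ?thesis using fork_on_mutable_aux[of "rev_arr f" V r v] sk F v
      by (auto simp: rev_arr_apply)
  qed
  then show "mutable V f v" "\<exists>u\<in>V. f u v > 0" "\<exists>w\<in>V. f v w > 0" by auto
qed

definition fork_or_order :: "'a set \<Rightarrow> ('a \<Rightarrow> 'a \<Rightarrow> int) \<Rightarrow> bool" where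
  "fork_or_order V f \<longleftrightarrow> abundant_order V f \<or> (\<exists>r. fork_on V f r)"

lemma mut_mutable:
  assumes sk: "skew f" and m: "mutable V f v"
  shows "fork_on V (mut v f) v \<or> abundant_order V (mut v f)"
proof -
  have "abundant_order V (mut v f)" if "\<And>w. w \<in> V \<Longrightarrow> \<not> f v w > 0"
  proof -
    have "abundant_order V (mut v (rev_arr f))"
      using abundant_order_mut_source(2)[of "rev_arr f" V v] sk m that by (auto simp: rev_arr_apply)
    then show ?thesis using sk by (simp add: mut_rev_arr abundant_order_rev_arr)
  qed
  then show ?thesis
    using fork_on_mut[OF sk m] abundant_order_mut_source(2)[OF sk m] by blast
qed

text \<open>The tree structure of branches rests on this: after a mutation every vertex other than
  the one just used can again produce a fork or an order.\<close>

lemma mutable_mut: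
  assumes sk: "skew f" and m: "mutable V f v" and u: "u \<in> V" "u \<noteq> v"
  shows "mutable V (mut v f) u"
  using mut_mutable[OF sk m] fork_on_mutable(1)[of "mut v f"] mutable_if_abundant_order[of "mut v f"] sk u
  by auto

section \<open>Pre-forks and blocks of two vertices\<close>

definition twins :: "'a set \<Rightarrow> ('a \<Rightarrow> 'a \<Rightarrow> int) \<Rightarrow> 'a \<Rightarrow> 'a \<Rightarrow> bool" where
  "twins V f k k' \<longleftrightarrow> (\<forall>i\<in>V - {k, k'}. f k i > 0 \<and> f k' i > 0 \<or> f i k > 0 \<and> f i k' > 0)"

definition prefork_on :: "'a set \<Rightarrow> ('a \<Rightarrow> 'a \<Rightarrow> int) \<Rightarrow> 'a \<Rightarrow> 'a \<Rightarrow> 'a \<Rightarrow> bool" where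
  "prefork_on V f r k k' \<longleftrightarrow>
     k \<in> V \<and> k' \<in> V \<and> k \<noteq> k' \<and> fork_on (V - {k}) f r \<and> fork_on (V - {k'}) f r \<and> twins V f k k'"

lemma twins_commute: "twins V f k k' = twins V f k' k"
  unfolding twins_def by (auto simp: insert_commute)

lemma prefork_on_commute: "prefork_on V f r k k' = prefork_on V f r k' k"
  unfolding prefork_on_def twins_commute[of V f k' k] by auto

lemma twins_rev_arr [simp]: "skew f \<Longrightarrow> twins V (rev_arr f) k k' = twins V f k k'"
  unfolding twins_def by (auto simp: rev_arr_apply)

lemma prefork_on_rev_arr [simp]: "skew f \<Longrightarrow> prefork_on V (rev_arr f) r k k' = prefork_on V f r k k'"
  unfolding prefork_on_def by simp

lemma fork_or_order_rev_arr [simp]: "skew f \<Longrightarrow> fork_or_order V (rev_arr f) = fork_or_order V f"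
  unfolding fork_or_order_def by (metis abundant_order_rev_arr fork_on_rev_arr)

text \<open>Paths through \<open>v\<close> that avoid \<open>k\<close> or avoid \<open>k'\<close>
  are covered by the two deletions, so only the path from \<open>k\<close> to \<open>k'\<close>
  remains. Its product is at least twice each factor, hence exceeds each by at least 2, and a single
  arrow from \<open>k'\<close> to \<open>k\<close> cannot spoil that.\<close>

lemma fork_on_mut_between:
  assumes sk: "skew g" and V: "k \<in> V" "k' \<in> V"
    and m: "mutable (V - {k}) g v" "mutable (V - {k'}) g v"
    and small: "\<bar>g k k'\<bar> \<le> 1" and k: "g k v > 0" "g v k' > 0"
  shows "fork_on V (mut v g) v"
proof (rule fork_on_mut[OF sk])
  have "\<not> g v k > 0" "\<not> g k' v > 0" using k skewD[OF sk, of v k] skewD[OF sk, of k' v] by auto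
  then have "{u\<in>V. g u v > 0} = {u\<in>V-{k'}. g u v > 0}" "{u\<in>V. g v u > 0} = {u\<in>V-{k}. g v u > 0}"
    by auto
  then have ord: "abundant_order {u\<in>V. g u v > 0} g" "abundant_order {u\<in>V. g v u > 0} g"
    using mutableD(4)[OF m(2)] mutableD(5)[OF m(1)] by simp_all
  have v: "v \<in> V" "v \<noteq> k" "v \<noteq> k'" using mutableD(1)[OF m(1)] mutableD(1)[OF m(2)] by auto
  have "k \<noteq> k'" using k skewD[OF sk, of v k] by auto
  then have near: "\<bar>g u v\<bar> \<ge> 2" if "u \<in> V" "u \<noteq> v" for u
    using mutableD(2)[OF m(1), of u] mutableD(2)[OF m(2), of u] that by auto
  have "g u w + g u v * g v w > g u v \<and> g u w + g u v * g v w > g v w"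
    if h: "u \<in> V" "w \<in> V" "g u v > 0" "g v w > 0" for u w
  proof (cases "u = k \<and> w = k'")
    case True
    have 1: "g k v \<ge> 2" "g v k' \<ge> 2"
      using near[of k] near[of k'] V v k skewD[OF sk, of k' v] by auto
    then have "2 * g v k' \<le> g k v * g v k'" "g k v * 2 \<le> g k v * g v k'"
      by (auto intro: mult_right_mono mult_left_mono)
    then have "g k k' + g k v * g v k' > g k v \<and> g k k' + g k v * g v k' > g v k'"
      using small 1 by linarith
    then show ?thesis using True by simp
  next
    case False
    have "u \<noteq> k'" "w \<noteq> k" using h \<open>\<not> g v k > 0\<close> \<open>\<not> g k' v > 0\<close> by auto
    then have "u \<in> V - {k} \<and> w \<in> V - {k} \<or> u \<in> V - {k'} \<and> w \<in> V - {k'}" using h False by auto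
    then show ?thesis using mutableD(3)[OF m(1)] mutableD(3)[OF m(2)] h by blast
  qed
  then show "mutable V g v" using ord v near unfolding mutable_def by blast
  show "\<exists>u\<in>V. g u v > 0" "\<exists>u\<in>V. g v u > 0" using V k by auto
qed

text \<open>An in-neighbour of \<open>v\<close> acquires arrows to both \<open>k\<close> and
  \<open>k'\<close>, whatever it had before. Thus \<open>twins\<close> is assumed only among the
  out-neighbours of \<open>v\<close>, between which the mutation changes nothing.\<close>

lemma prefork_on_mut_out:
  assumes sk: "skew g" and V: "k \<in> V" "k' \<in> V" "k \<noteq> k'"
    and m: "mutable (V - {k}) g v" "mutable (V - {k'}) g v"
    and k: "g v k > 0" "g v k' > 0" and ne: "\<exists>u\<in>V. g u v > 0"
    and tw: "twins {w\<in>V. g v w > 0} g k k'"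
  shows "prefork_on V (mut v g) v k k'"
proof -
  have neg: "\<not> g k v > 0" "\<not> g k' v > 0" using k skewD[OF sk, of v k] skewD[OF sk, of v k'] by auto
  have v: "v \<in> V" "v \<noteq> k" "v \<noteq> k'" using mutableD(1)[OF m(1)] mutableD(1)[OF m(2)] by auto
  obtain u where u: "u \<in> V" "g u v > 0" using ne by blast
  then have "u \<noteq> k" "u \<noteq> k'" using neg by auto
  then have "\<exists>u\<in>V-{k}. g u v > 0" "\<exists>u\<in>V-{k'}. g u v > 0" using u by auto
  moreover have "\<exists>u\<in>V-{k}. g v u > 0" "\<exists>u\<in>V-{k'}. g v u > 0" using V k by auto
  ultimately have "fork_on (V - {k}) (mut v g) v" "fork_on (V - {k'}) (mut v g) v"
    using fork_on_mut[OF sk] m by auto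
  moreover have "mut v g k i > 0 \<and> mut v g k' i > 0 \<or> mut v g i k > 0 \<and> mut v g i k' > 0"
    if i: "i \<in> V - {k, k'}" for i
  proof (cases "i = v")
    case True then show ?thesis using k sk by auto
  next
    case False
    then consider "g i v > 0" | "g v i > 0"
      using mutableD(2)[OF m(1), of i] i skewD[OF sk, of i v] by force
    then show ?thesis
    proof cases
      case 1
      then have "mut v g i k > 0" "mut v g i k' > 0"
        using mut_cases(3)[OF sk m(2), of i k] mut_cases(3)[OF sk m(1), of i k'] i V k by auto
      then show ?thesis by simp
    next
      case 2
      then have "g k i > 0 \<and> g k' i > 0 \<or> g i k > 0 \<and> g i k' > 0"
        using tw i unfolding twins_def by auto
      moreover have "mut v g k i = g k i" "mut v g k' i = g k' i" "mut v g i k = g i k" "mut v g i k' = g i k'"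
        using mut_cases(2)[OF sk m(2), of k i] mut_cases(2)[OF sk m(1), of k' i]
          mut_cases(2)[OF sk m(2), of i k] mut_cases(2)[OF sk m(1), of i k'] i V k 2 by auto
      ultimately show ?thesis by simp
    qed
  qed
  ultimately show ?thesis using V unfolding prefork_on_def twins_def by blast
qed

lemma prefork_on_mut_in:
  assumes sk: "skew g" and V: "k \<in> V" "k' \<in> V" "k \<noteq> k'"
    and m: "mutable (V - {k}) g v" "mutable (V - {k'}) g v"
    and k: "g k v > 0" "g k' v > 0" and ne: "\<exists>u\<in>V. g v u > 0"
    and tw: "twins {w\<in>V. g w v > 0} g k k'"
  shows "prefork_on V (mut v g) v k k'"
  using prefork_on_mut_out[of "rev_arr g" k V k' v] assms
  by (simp add: rev_arr_apply mut_rev_arr)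

section \<open>Interchanging the vertices \<open>k\<close> and \<open>k'\<close>\<close>

definition swp :: "'a \<Rightarrow> 'a \<Rightarrow> 'a \<Rightarrow> 'a" where
  "swp k k' = id(k := k', k' := k)"

definition swap_arr :: "'a \<Rightarrow> 'a \<Rightarrow> ('a \<Rightarrow> 'a \<Rightarrow> int) \<Rightarrow> 'a \<Rightarrow> 'a \<Rightarrow> int" where
  "swap_arr k k' f = (\<lambda>a b. f (swp k k' a) (swp k k' b))"

lemma swp_simps [simp]:
  "swp k k' k = k'" "swp k k' k' = k" "a \<noteq> k \<Longrightarrow> a \<noteq> k' \<Longrightarrow> swp k k' a = a"
  "swp k k' (swp k k' a) = a"
  by (auto simp: swp_def)

lemma swp_eq_iff [simp]: "swp k k' a = swp k k' b \<longleftrightarrow> a = b"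
  by (metis swp_simps(4))

lemma mut_swap_arr: "mut (swp k k' v) (swap_arr k k' f) = swap_arr k k' (mut v f)"
proof (intro ext)
  fix a b
  have "(swp k k' v = a) = (v = swp k k' a)" for a by (metis swp_simps(4))
  then show "mut (swp k k' v) (swap_arr k k' f) a b = swap_arr k k' (mut v f) a b"
    by (simp add: mut_def swap_arr_def)
qed

text \<open>
  Pre-forks with at most one arrow between k and k' are blocks, and so is an abundant acyclic quiver
  in which the arrows between two consecutive vertices are replaced by at most one arrow.
\<close>

locale block =
  fixes V :: "'a set" and f :: "'a \<Rightarrow> 'a \<Rightarrow> int" and k k' :: 'a
  assumes sk: "skew f" and kV: "k \<in> V" "k' \<in> V" "k \<noteq> k'"
    and tw: "twins V f k k'"
    and mk: "mutable (V - {k'}) f k" and mk': "mutable (V - {k}) f k'"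
    and small: "f k k' = 0 \<or> f k k' = 1"
    and supp: "\<And>i j. f i j \<noteq> 0 \<Longrightarrow> i \<in> V \<and> j \<in> V"
begin

definition "A = {i\<in>V - {k, k'}. f i k > 0}"
definition "C = {i\<in>V - {k, k'}. f k i > 0}"

text \<open>Reversing all arrows and exchanging the names \<open>k\<close> and \<open>k'\<close>
  keeps the arrow from \<open>k\<close> to \<open>k'\<close>. So what is shown for mutating first at
  \<open>k\<close> carries over to mutating first at \<open>k'\<close>, with \<open>A\<close> and
  \<open>C\<close> exchanged.\<close>

lemma rev_block: "block V (rev_arr f) k' k"
proof -
  have "rev_arr f i j \<noteq> 0 \<Longrightarrow> i \<in> V \<and> j \<in> V" for i j using supp[of j i] rev_arr_apply[OF sk] by auto
  then show ?thesis
    using sk kV tw mk mk' small unfolding block_def by (simp add: rev_arr_apply twins_commute)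
qed

lemma swap_block: "f k k' = 0 \<Longrightarrow> block V f k' k"
  using sk kV tw mk mk' supp skewD[OF sk, of k k'] unfolding block_def by (simp add: twins_commute)

lemma inA:
  assumes "i \<in> A"
  shows "i \<in> V" "i \<noteq> k" "i \<noteq> k'" "f i k \<ge> 2" "f i k' \<ge> 2" "f k i = - f i k" "f k' i = - f i k'"
proof -
  have i: "i \<in> V - {k, k'}" "f i k > 0" using assms unfolding A_def by auto
  then have "f i k' > 0" using tw skewD[OF sk, of i k] unfolding twins_def by force
  then show "i \<in> V" "i \<noteq> k" "i \<noteq> k'" "f i k \<ge> 2" "f i k' \<ge> 2" "f k i = - f i k" "f k' i = - f i k'"
    using i mutableD(2)[OF mk, of i] mutableD(2)[OF mk', of i] skewD[OF sk, of i k] skewD[OF sk, of i k']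
    by auto
qed

lemma inC:
  assumes "i \<in> C"
  shows "i \<in> V" "i \<noteq> k" "i \<noteq> k'" "f k i \<ge> 2" "f k' i \<ge> 2" "f i k = - f k i" "f i k' = - f k' i"
proof -
  have i: "i \<in> V - {k, k'}" "f k i > 0" using assms unfolding C_def by auto
  then have *: "f k' i > 0" using tw skewD[OF sk, of i k] unfolding twins_def by force
  have "\<bar>f i k\<bar> \<ge> 2" "\<bar>f i k'\<bar> \<ge> 2" using i mutableD(2)[OF mk, of i] mutableD(2)[OF mk', of i] by auto
  then show "i \<in> V" "i \<noteq> k" "i \<noteq> k'" "f k i \<ge> 2" "f k' i \<ge> 2" "f i k = - f k i" "f i k' = - f k' i"
    using i * skewD[OF sk, of k i] skewD[OF sk, of k' i] by auto
qed

lemma vertices_eq: "V = insert k (insert k' (A \<union> C))" "A \<inter> C = {}" "V - {k, k'} = A \<union> C"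
proof -
  show *: "V - {k, k'} = A \<union> C" using tw unfolding twins_def A_def C_def by auto
  then show "V = insert k (insert k' (A \<union> C))" using kV by auto
  show "A \<inter> C = {}" using inA inC by force
qed

lemma A_or_C: "i \<in> V - {k, k'} \<Longrightarrow> i \<in> A \<or> i \<in> C"
  using vertices_eq(3) by auto

lemma order_A_C: "abundant_order A f" "abundant_order C f"
  by (rule abundant_order_subset[OF mutableD(4)[OF mk]] abundant_order_subset[OF mutableD(5)[OF mk]],
      auto simp: A_def C_def)+

lemma cross_products:
  assumes "a \<in> A" "b \<in> C"
  shows "f a b + f a k * f k b > f a k" "f a b + f a k * f k b > f k b"
    "f a b + f a k' * f k' b > f a k'" "f a b + f a k' * f k' b > f k' b"
proof -
  have "f a k > 0" "f k b > 0" "f a k' > 0" "f k' b > 0" using inA[OF assms(1)] inC[OF assms(2)] by auto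
  then show "f a b + f a k * f k b > f a k" "f a b + f a k * f k b > f k b"
    "f a b + f a k' * f k' b > f a k'" "f a b + f a k' * f k' b > f k' b"
    using mutableD(3)[OF mk, of a b] mutableD(3)[OF mk', of a b] inA(1-3)[OF assms(1)] inC(1-3)[OF assms(2)]
    by auto
qed

text \<open>Being ordered before (after) the block weakly also covers the vertices outside \<open>V\<close>.\<close>

definition "before a \<longleftrightarrow> a \<noteq> k \<and> a \<noteq> k' \<and> f a k \<ge> 0 \<and> f a k' \<ge> 0"
definition "after a \<longleftrightarrow> a \<noteq> k \<and> a \<noteq> k' \<and> f k a \<ge> 0 \<and> f k' a \<ge> 0"

lemma A_before: "a \<in> A \<Longrightarrow> before a"
  using inA[of a] unfolding before_def by auto

lemma C_after: "a \<in> C \<Longrightarrow> after a"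
  using inC[of a] unfolding after_def by auto

lemma before_or_after:
  assumes "a \<noteq> k" "a \<noteq> k'" shows "before a \<or> after a"
proof (cases "a \<in> V")
  case True
  then show ?thesis using A_or_C[of a] A_before[of a] C_after[of a] assms by auto
next
  case False
  then have "f a k = 0" "f a k' = 0" using supp[of a k] supp[of a k'] by auto
  then show ?thesis using assms unfolding before_def by auto
qed

abbreviation "s1 \<equiv> mut k f"
abbreviation "t1 \<equiv> mut k' f"

lemma s1:
  shows "before a \<Longrightarrow> before a' \<Longrightarrow> s1 a a' = f a a'"
    and "before a \<Longrightarrow> after b \<Longrightarrow> s1 a b = f a b + f a k * f k b"
    and "after b \<Longrightarrow> after b' \<Longrightarrow> s1 b b' = f b b'"
    and "s1 k i = f i k" "s1 i k = f k i"
    and "before a \<Longrightarrow> s1 a k' = f a k' + f a k * f k k'"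
    and "after b \<Longrightarrow> s1 k' b = f k' b"
    and "s1 k' k = f k k'"
proof -
  have p: "f k k' \<ge> 0" using small by auto
  show "before a \<Longrightarrow> before a' \<Longrightarrow> s1 a a' = f a a'"
    using mut_in[OF sk, of k a a'] unfolding before_def by auto
  show "before a \<Longrightarrow> after b \<Longrightarrow> s1 a b = f a b + f a k * f k b"
    using mut_through[OF sk, of k a b] unfolding before_def after_def by auto
  show "after b \<Longrightarrow> after b' \<Longrightarrow> s1 b b' = f b b'"
    using mut_out[OF sk, of k b b'] unfolding after_def by auto
  show "s1 k i = f i k" "s1 i k = f k i" "s1 k' k = f k k'" using sk by auto
  show "before a \<Longrightarrow> s1 a k' = f a k' + f a k * f k k'"
    using mut_through[OF sk, of k a k'] kV p unfolding before_def by auto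
  show "after b \<Longrightarrow> s1 k' b = f k' b"
    using mut_out[OF sk, of k k' b] kV p unfolding after_def by auto
qed

lemma s1_A:
  assumes "a \<in> A" shows "s1 a k' \<ge> 2" "s1 k a \<ge> 2"
  using small s1(6)[OF A_before[OF assms]] s1(4)[of a] inA[OF assms] by auto

lemma s1_C:
  assumes "b \<in> C" shows "s1 k' b \<ge> 2" "s1 b k \<ge> 2"
  using s1(7)[OF C_after[OF assms]] s1(5)[of b] inC[OF assms] by auto

lemma s1_AC: "a \<in> A \<Longrightarrow> b \<in> C \<Longrightarrow> s1 a b \<ge> 3"
  using s1(2)[OF A_before C_after, of a b] cross_products(1)[of a b] inA(4)[of a] by auto

text \<open>After the mutation \<open>k\<close> has arrows from \<open>C\<close> and to
  \<open>A\<close>; without it the order is \<open>A\<close>, \<open>k'\<close>,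
  \<open>C\<close>.\<close>

lemma s1_ord: "abundant_order (V - {k}) s1"
proof -
  have "abundant_order A s1" "abundant_order C s1"
    using order_A_C abundant_order_cong[of A s1 f] abundant_order_cong[of C s1 f] s1(1,3) A_before C_after
    by auto
  then have "abundant_order ((A \<union> {k'}) \<union> C) s1"
    using s1_A s1_C s1_AC sk by (intro abundant_order_Un) force+
  moreover have "V - {k} = (A \<union> {k'}) \<union> C" using vertices_eq(1,2) kV inA inC by blast
  ultimately show ?thesis by simp
qed

lemma s1_mutable:
  assumes "v \<in> V - {k, k'}" shows "mutable (V - {k}) s1 v" "mutable (V - {k'}) s1 v"
  using mutable_if_abundant_order[of s1 "V - {k}" v] mutable_mut[OF sk mk, of v] s1_ord sk assms by auto

lemma s1_fork_or_order: "fork_or_order (V - {k}) s1" "fork_or_order (V - {k'}) s1"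
  using s1_ord mut_mutable[OF sk mk] unfolding fork_or_order_def by auto

text \<open>In \<open>s1\<close> every other vertex lies between \<open>k\<close> and
  \<open>k'\<close>: a vertex of \<open>A\<close> on a path from \<open>k\<close> to
  \<open>k'\<close>, a vertex of \<open>C\<close> on a path from \<open>k'\<close> to
  \<open>k\<close>.\<close>

lemma s1_fork:
  assumes v: "v \<in> V - {k, k'}" shows "fork_on V (mut v s1) v"
  using A_or_C[OF v]
proof
  have p: "\<bar>s1 k k'\<bar> \<le> 1" "\<bar>s1 k' k\<bar> \<le> 1" using small s1(8) skewD[of s1 k k'] sk by auto
  { assume "v \<in> A" then show ?thesis
    using fork_on_mut_between[of s1 k V k' v] s1_mutable[OF v] s1_A[of v] kV p sk by auto }
  { assume "v \<in> C" then show ?thesis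
    using fork_on_mut_between[of s1 k' V k v] s1_mutable[OF v] s1_C[of v] kV p sk by auto }
qed

end

text \<open>Reverses the arrows between \<open>D\<close> and its complement. Mutation at a source or
  sink has this effect for a single vertex, so rotations of a linear order are flips of its initial
  segments.\<close>

definition flip :: "'a set \<Rightarrow> ('a \<Rightarrow> 'a \<Rightarrow> int) \<Rightarrow> 'a \<Rightarrow> 'a \<Rightarrow> int" where
  "flip D f = (\<lambda>a b. if (a \<in> D) = (b \<in> D) then f a b else - f a b)"

lemma rev_arr_flip [simp]: "rev_arr (flip D f) = flip D (rev_arr f)"
  by (intro ext) (simp add: rev_arr_def flip_def)

lemma twins_subset: "twins V f k k' \<Longrightarrow> W \<subseteq> V \<Longrightarrow> twins W f k k'"
  unfolding twins_def by blast

context block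
begin

abbreviation "s2 \<equiv> mut k' s1"
abbreviation "t2 \<equiv> mut k t1"

lemma s2:
  shows "before a \<Longrightarrow> before a' \<Longrightarrow> s2 a a' = f a a'"
    and "before a \<Longrightarrow> after b \<Longrightarrow> s2 a b = f a b + f a k * f k b + (f a k' + f a k * f k k') * f k' b"
    and "after b \<Longrightarrow> after b' \<Longrightarrow> s2 b b' = f b b'"
    and "before a \<Longrightarrow> s2 k' a = f a k' + f a k * f k k'"
    and "after b \<Longrightarrow> s2 b k' = f k' b"
    and "s2 k k' = f k k'"
    and "f k k' = 1 \<Longrightarrow> before a \<Longrightarrow> s2 a k = f a k'"
    and "f k k' = 0 \<Longrightarrow> before a \<Longrightarrow> s2 k a = f a k"
    and "after b \<Longrightarrow> s2 b k = f k b"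
proof -
  have p: "f k k' \<ge> 0" using small by auto
  have sk1: "skew s1" using sk by simp
  have bf: "s1 a k' \<ge> 0" "k' \<noteq> a" if "before a" for a
    using s1(6)[OF that] that p unfolding before_def by auto
  have af: "s1 k' b \<ge> 0" "k' \<noteq> b" "s1 b k = f k b" if "after b" for b
    using s1(7)[OF that] s1(5)[of b] that unfolding after_def by auto
  show "before a \<Longrightarrow> before a' \<Longrightarrow> s2 a a' = f a a'"
    using mut_in[OF sk1, of k' a a'] bf s1(1) by simp
  show "before a \<Longrightarrow> after b \<Longrightarrow> s2 a b = f a b + f a k * f k b + (f a k' + f a k * f k k') * f k' b"
    using mut_through[OF sk1, of k' a b] bf[of a] af[of b] s1(2)[of a b] s1(6)[of a] s1(7)[of b] by simp
  show "after b \<Longrightarrow> after b' \<Longrightarrow> s2 b b' = f b b'"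
    using mut_out[OF sk1, of k' b b'] af s1(3) by simp
  show "before a \<Longrightarrow> s2 k' a = f a k' + f a k * f k k'"
    using s1(6) sk1 by simp
  show "after b \<Longrightarrow> s2 b k' = f k' b"
    using s1(7) sk1 by simp
  show "s2 k k' = f k k'" using s1(8) sk1 by simp
  show "s2 a k = f a k'" if "f k k' = 1" "before a"
    using mut_through[OF sk1, of k' a k] bf[of a] s1(5)[of a] s1(6)[of a] s1(8) that kV skewD[OF sk, of a k]
    by simp
  show "s2 k a = f a k" if "f k k' = 0" "before a"
    using mut_in[OF sk1, of k' k a] bf[of a] s1(4)[of a] s1(8) skewD[OF sk1, of k' k] that kV by simp
  show "after b \<Longrightarrow> s2 b k = f k b"
    using mut_out[OF sk1, of k' b k] af[of b] s1(8) p kV by simp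
qed

lemma s2_mutable:
  assumes "v \<in> V - {k, k'}" shows "mutable (V - {k}) s2 v"
  using mutable_mut[OF _ mutable_if_abundant_order[OF _ s1_ord], of k' v] sk kV assms by auto

lemma s2_fork_or_order: "fork_or_order (V - {k}) s2"
  using mut_mutable[OF _ mutable_if_abundant_order[OF _ s1_ord], of k'] sk kV
  unfolding fork_or_order_def by auto

lemma s2_order_A: "abundant_order A s2" and s2_order_C: "abundant_order C s2"
  using order_A_C abundant_order_cong[of A s2 f] abundant_order_cong[of C s2 f] s2(1,3) A_before C_after
  by auto

lemma s2_AC: "a \<in> A \<Longrightarrow> b \<in> C \<Longrightarrow> s2 a b \<ge> 2"
proof -
  assume a: "a \<in> A" and b: "b \<in> C"
  have "f a k' + f a k * f k k' \<ge> 0" "f k' b \<ge> 0" using inA[OF a] inC(4,5)[OF b] small by auto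
  then have "(f a k' + f a k * f k k') * f k' b \<ge> 0" by simp
  then show ?thesis using s2(2)[OF A_before[OF a] C_after[OF b]] cross_products(1)[OF a b] inA(4)[OF a] by linarith
qed

text \<open>With nothing before the block, \<open>k\<close> and then \<open>k'\<close> is a source
  when its turn comes, so each mutation only reverses the arrows at that vertex; those between
  \<open>k\<close> and \<open>k'\<close> are reversed twice.\<close>

lemma s2_no_before:
  assumes "A = {}" shows "s2 = flip (V - {k, k'}) f"
proof (intro ext)
  fix a b
  have aft: "after x" if "x \<noteq> k" "x \<noteq> k'" for x
  proof (cases "x \<in> V")
    case True
    then show ?thesis using A_or_C[of x] C_after that assms by auto
  next
    case False
    then have "f k x = 0" "f k' x = 0" using supp[of k x] supp[of k' x] by auto
    then show ?thesis using that unfolding after_def by auto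
  qed
  have sk2: "skew s2" using sk by simp
  have out: "f x k = 0" "f k x = 0" "f x k' = 0" "f k' x = 0" if "x \<notin> V" for x
    using supp[of x k] supp[of k x] supp[of x k'] supp[of k' x] that by auto
  have kx: "s2 k x = flip (V - {k, k'}) f k x" "s2 k' x = flip (V - {k, k'}) f k' x"
    "s2 x k = flip (V - {k, k'}) f x k" "s2 x k' = flip (V - {k, k'}) f x k'" if "x \<noteq> k" "x \<noteq> k'" for x
    using s2(5,9)[OF aft[OF that]] skewD[OF sk, of x k] skewD[OF sk, of x k'] skewD[OF sk2, of x k]
      skewD[OF sk2, of x k'] out[of x] that by (auto simp: flip_def)
  show "s2 a b = flip (V - {k, k'}) f a b"
  proof (cases "a \<in> {k, k'}"; cases "b \<in> {k, k'}")
    assume "a \<in> {k, k'}" "b \<in> {k, k'}"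
    then show ?thesis
      using s2(6) skewD[OF sk, of k k'] skewD[OF sk2, of k k'] sk sk2 skew_diag[OF sk] skew_diag[OF sk2] kV
      by (auto simp: flip_def)
  next
    assume "a \<notin> {k, k'}" "b \<notin> {k, k'}"
    then show ?thesis using s2(3)[OF aft aft, of a b] supp[of a b] by (auto simp: flip_def)
  next
    assume "a \<in> {k, k'}" "b \<notin> {k, k'}"
    then show ?thesis using kx[of b] by auto
  next
    assume "a \<notin> {k, k'}" "b \<in> {k, k'}"
    then show ?thesis using kx[of a] by auto
  qed
qed

text \<open>With one arrow, \<open>s2\<close> without \<open>k'\<close> is ordered as
  \<open>A\<close>, \<open>C\<close>, \<open>k\<close>, while \<open>k'\<close> has arrows from
  \<open>C\<close> and to \<open>A\<close>. A vertex of \<open>A\<close> lies between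
  \<open>k'\<close> and \<open>k\<close>; a vertex of \<open>C\<close> has both as out-neighbours
  and yields a pre-fork unless it is a source. The last alternative is this exception.\<close>

lemma s2_exits:
  assumes p: "f k k' = 1" and v: "v \<in> V - {k, k'}"
  shows "fork_on V (mut v s2) v \<or> prefork_on V (mut v s2) v k k' \<or>
    A = {} \<and> (\<forall>u\<in>V - {k, k'}. \<not> f u v > 0)"
    and "fork_or_order (V - {k'}) s2"
proof -
  have sk2: "skew s2" using sk by simp
  have Ak: "s2 a k \<ge> 2" "s2 k' a \<ge> 2" if "a \<in> A" for a
    using s2(7)[OF p A_before[OF that]] s2(4)[OF A_before[OF that]] inA[OF that] p by auto
  have Ck: "s2 b k \<ge> 2" "s2 b k' \<ge> 2" if "b \<in> C" for b
    using s2(5,9)[OF C_after[OF that]] inC[OF that] by auto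
  have "abundant_order ((A \<union> C) \<union> {k}) s2"
    using Ak Ck s2_AC s2_order_A s2_order_C sk2 by (intro abundant_order_Un) auto
  moreover have "V - {k'} = (A \<union> C) \<union> {k}" using vertices_eq(1) kV inA(3) inC(3) by blast
  ultimately have o: "abundant_order (V - {k'}) s2" by simp
  then show "fork_or_order (V - {k'}) s2" unfolding fork_or_order_def by simp
  have m: "mutable (V - {k'}) s2 v" "mutable (V - {k}) s2 v"
    using mutable_if_abundant_order[OF sk2 o] s2_mutable v by auto
  have p2: "\<bar>s2 k' k\<bar> \<le> 1" using s2(6) skewD[OF sk2, of k k'] p by simp
  consider (A) "v \<in> A" | (C) "v \<in> C" using A_or_C[OF v] by blast
  then show "fork_on V (mut v s2) v \<or> prefork_on V (mut v s2) v k k' \<or>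
    A = {} \<and> (\<forall>u\<in>V - {k, k'}. \<not> f u v > 0)"
  proof cases
    case A
    then show ?thesis using fork_on_mut_between[OF sk2 kV(2,1) m p2] Ak[OF A] by auto
  next
    case C
    have "twins {w\<in>V. s2 v w > 0} s2 k k'" unfolding twins_def
    proof
      fix i assume i: "i \<in> {w\<in>V. s2 v w > 0} - {k, k'}"
      then have "i \<in> C" using A_or_C[of i] s2_AC[OF _ C, of i] skewD[OF sk2, of i v] by auto
      then show "s2 k i > 0 \<and> s2 k' i > 0 \<or> s2 i k > 0 \<and> s2 i k' > 0" using Ck[of i] by auto
    qed
    then have "prefork_on V (mut v s2) v k k'" if "\<exists>u\<in>V. s2 u v > 0"
      using prefork_on_mut_out[OF sk2 kV m(2,1)] Ck[OF C] that by auto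
    moreover have "\<exists>u\<in>V. s2 u v > 0" if "u \<in> V - {k, k'}" "f u v > 0" for u
      using A_or_C[OF that(1)] s2_AC[OF _ C, of u] s2(3)[OF C_after C_after[OF C], of u] that
      by force
    moreover have "\<exists>u\<in>V. s2 u v > 0" if "u \<in> A" for u
      using s2_AC[OF that C] inA(1)[OF that] by force
    ultimately show ?thesis by blast
  qed
qed

lemma commute_0: assumes p: "f k k' = 0" shows "s2 = t2"
proof (intro ext)
  fix a b
  have "f k' k = 0" using skewD[OF sk, of k k'] p by simp
  then show "s2 a b = t2 a b" using p kV sk by (auto simp: mut_def)
qed

text \<open>With no arrow, \<open>k\<close> and \<open>k'\<close> have both changed sides in
  \<open>s2\<close> and are twins again. As \<open>A\<close> is nonempty, no vertex of
  \<open>C\<close> is a source, and only a sink in \<open>A\<close> remains as an exception.\<close>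

lemma s2_exits_0:
  assumes p: "f k k' = 0" and v: "v \<in> V - {k, k'}" and "A \<noteq> {}"
  shows "prefork_on V (mut v s2) v k k' \<or> C = {} \<and> (\<forall>u\<in>V - {k, k'}. \<not> f v u > 0)"
    and "fork_or_order (V - {k'}) s2"
proof -
  interpret S: block V f k' k using swap_block[OF p] .
  have t: "S.s2 = s2" using commute_0[OF p] by simp
  show "fork_or_order (V - {k'}) s2" using S.s2_fork_or_order unfolding t .
  have m: "mutable (V - {k'}) s2 v" "mutable (V - {k}) s2 v"
    using S.s2_mutable[of v] s2_mutable[of v] v unfolding t by auto
  have sk2: "skew s2" using sk by simp
  have Ak: "s2 k a \<ge> 2" "s2 k' a \<ge> 2" if "a \<in> A" for a
    using s2(4)[OF A_before[OF that]] s2(8)[OF p A_before[OF that]] inA[OF that] p by auto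
  have Ck: "s2 b k \<ge> 2" "s2 b k' \<ge> 2" if "b \<in> C" for b
    using s2(5,9)[OF C_after[OF that]] inC[OF that] by auto
  have tw2: "twins V s2 k k'"
    unfolding twins_def using A_or_C Ak Ck by fastforce
  consider (A) "v \<in> A" | (C) "v \<in> C" using A_or_C[OF v] by blast
  then show "prefork_on V (mut v s2) v k k' \<or> C = {} \<and> (\<forall>u\<in>V - {k, k'}. \<not> f v u > 0)"
  proof cases
    case A
    have "prefork_on V (mut v s2) v k k'" if "\<exists>u\<in>V. s2 v u > 0"
      using prefork_on_mut_in[OF sk2 kV m(2,1)] Ak[OF A] that twins_subset[OF tw2] by auto
    moreover have "\<exists>u\<in>V. s2 v u > 0" if "u \<in> V - {k, k'}" "f v u > 0" for u
      using A_or_C[OF that(1)] s2_AC[OF A, of u] s2(1)[OF A_before[OF A] A_before, of u] that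
      by force
    moreover have "\<exists>u\<in>V. s2 v u > 0" if "u \<in> C" for u
      using s2_AC[OF A that] inC(1)[OF that] by force
    ultimately show ?thesis by blast
  next
    case C
    obtain u where "u \<in> A" using \<open>A \<noteq> {}\<close> by blast
    then have "\<exists>u\<in>V. s2 u v > 0" using s2_AC[OF _ C, of u] inA(1)[of u] by force
    then show ?thesis using prefork_on_mut_out[OF sk2 kV m(2,1)] Ck[OF C] twins_subset[OF tw2] by auto
  qed
qed

lemma rev_A: "block.A V (rev_arr f) k' k = C"
proof -
  interpret R: block V "rev_arr f" k' k by (rule rev_block)
  have "f k i > 0 \<longleftrightarrow> f k' i > 0" if "i \<in> V - {k, k'}" for i
    using A_or_C[OF that] inA(4-7)[of i] inC(4,5)[of i] by auto
  then show ?thesis unfolding R.A_def C_def rev_arr_apply[OF sk] by auto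
qed

lemma t2_no_after:
  assumes "C = {}" shows "t2 = flip (V - {k, k'}) f"
proof -
  interpret R: block V "rev_arr f" k' k by (rule rev_block)
  have "V - {k', k} = V - {k, k'}" "R.s2 = rev_arr t2" using sk by (auto simp: mut_rev_arr)
  then have "rev_arr t2 = flip (V - {k, k'}) (rev_arr f)"
    using R.s2_no_before assms unfolding rev_A by simp
  then show ?thesis by (metis rev_arr_flip rev_arr_rev_arr)
qed

text \<open>The claims on \<open>t1\<close> and \<open>t2\<close> come from the opposite quiver. In
  the exceptional case the block has moved from the last to the first position and \<open>v\<close>
  is a sink; there a rotation continues instead of entering a branch.\<close>

lemma exits:
  assumes "A \<noteq> {}" and v: "v \<in> V - {k, k'}" and g: "g \<in> {s1, s2, t1, t2}"
  shows "fork_on V (mut v g) v \<or> prefork_on V (mut v g) v k k' \<or>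
      C = {} \<and> g = flip (V - {k, k'}) f \<and> (\<forall>u\<in>V - {k, k'}. \<not> f v u > 0)"
    and "fork_or_order (V - {k}) g" "fork_or_order (V - {k'}) g"
proof -
  interpret R: block V "rev_arr f" k' k by (rule rev_block)
  have X: "V - {k', k} = V - {k, k'}" by auto
  have Rs: "R.s1 = rev_arr t1" "R.s2 = rev_arr t2" using sk by (simp_all add: mut_rev_arr)
  have sks: "skew t1" "skew t2" using sk by auto
  have m: "mut v (rev_arr t1) = rev_arr (mut v t1)" "mut v (rev_arr t2) = rev_arr (mut v t2)" for v
    using mut_rev_arr[OF sks(1)] mut_rev_arr[OF sks(2)] by (simp_all only:)
  have t1_: "fork_on V (mut v t1) v" "fork_or_order (V - {k}) t1" "fork_or_order (V - {k'}) t1"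
    using R.s1_fork[of v] v R.s1_fork_or_order sks unfolding Rs m X by auto
  have t2_: "(fork_on V (mut v t2) v \<or> prefork_on V (mut v t2) v k k' \<or>
      C = {} \<and> t2 = flip (V - {k, k'}) f \<and> (\<forall>u\<in>V - {k, k'}. \<not> f v u > 0)) \<and>
      fork_or_order (V - {k'}) t2 \<and> fork_or_order (V - {k}) t2" if p: "f k k' = 1"
    using R.s2_exits[of v] R.s2_fork_or_order v sks p t2_no_after
    unfolding Rs m X rev_A rev_arr_apply[OF sk] by (auto simp: prefork_on_commute)
  have s2_: "(fork_on V (mut v s2) v \<or> prefork_on V (mut v s2) v k k' \<or>
      C = {} \<and> s2 = flip (V - {k, k'}) f \<and> (\<forall>u\<in>V - {k, k'}. \<not> f v u > 0)) \<and>
      fork_or_order (V - {k'}) s2 \<and> fork_or_order (V - {k}) s2"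
  proof (cases "f k k' = 1")
    case True
    then show ?thesis using s2_exits[OF True v] s2_fork_or_order assms(1) by auto
  next
    case False
    then have p: "f k k' = 0" using small by auto
    show ?thesis using s2_exits_0[OF p v assms(1)] s2_fork_or_order t2_no_after commute_0[OF p] by auto
  qed
  have t2': "(fork_on V (mut v t2) v \<or> prefork_on V (mut v t2) v k k' \<or>
      C = {} \<and> t2 = flip (V - {k, k'}) f \<and> (\<forall>u\<in>V - {k, k'}. \<not> f v u > 0)) \<and>
      fork_or_order (V - {k'}) t2 \<and> fork_or_order (V - {k}) t2"
    using t2_ s2_ commute_0 small by auto
  show "fork_on V (mut v g) v \<or> prefork_on V (mut v g) v k k' \<or>
      C = {} \<and> g = flip (V - {k, k'}) f \<and> (\<forall>u\<in>V - {k, k'}. \<not> f v u > 0)"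
    "fork_or_order (V - {k}) g" "fork_or_order (V - {k'}) g"
    using g s1_fork[OF v] s1_fork_or_order s2_ t1_ t2' by auto
qed

end

section \<open>The pentagon relation and orbits\<close>

context block
begin

text \<open>Three alternating mutations beginning with \<open>k\<close> agree with two beginning
  with \<open>k'\<close> up to interchanging \<open>k\<close> and \<open>k'\<close>. Every vertex
  apart from these two, even outside \<open>V\<close>, is \<open>before\<close> or
  \<open>after\<close>, which makes the comparison of entries a finite case check.\<close>

lemma pentagon:
  assumes p: "f k k' = 1" shows "mut k s2 = swap_arr k k' t2"
proof (intro ext)
  fix x y
  have sk1: "skew s1" and sk2: "skew s2" and st1: "skew t1" and st2: "skew t2" using sk by simp_all
  have p': "f k' k = -1" using p skewD[OF sk, of k k'] by simp
  have bf: "a \<noteq> k" "a \<noteq> k'" "f a k \<ge> 0" "f a k' \<ge> 0" "f k a = - f a k" "f k' a = - f a k'"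
    if "before a" for a
    using that skewD[OF sk, of a k] skewD[OF sk, of a k'] unfolding before_def by auto
  have af: "b \<noteq> k" "b \<noteq> k'" "f k b \<ge> 0" "f k' b \<ge> 0" "f b k = - f k b" "f b k' = - f k' b"
    if "after b" for b
    using that skewD[OF sk, of k b] skewD[OF sk, of k' b] unfolding after_def by auto
  have s3_kk: "mut k s2 k' k = 1" "mut k s2 k k' = -1"
    using s2(6) p sk2 skewD[OF sk2, of k k'] by auto
  have s3_a: "mut k s2 a k' = - f a k" "mut k s2 k' a = f a k" "mut k s2 k a = f a k'" "mut k s2 a k = - f a k'"
    if a: "before a" for a
  proof -
    have "s2 a k' = - (f a k' + f a k)" using s2(4)[OF a] skewD[OF sk2, of a k'] p by simp
    then have "mut k s2 a k' = - f a k"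
      using mut_through[OF sk2, of k a k'] s2(6) s2(7)[OF p a] bf[OF a] kV p by simp
    then show "mut k s2 a k' = - f a k" "mut k s2 k' a = f a k"
      using skewD[of "mut k s2" a k'] sk2 by auto
    show "mut k s2 k a = f a k'" "mut k s2 a k = - f a k'"
      using s2(7)[OF p a] skewD[OF sk2, of a k] sk2 by auto
  qed
  have s3_b: "mut k s2 b k' = f k' b + f k b" "mut k s2 k' b = - (f k' b + f k b)"
    "mut k s2 k b = f k b" "mut k s2 b k = - f k b"
    if b: "after b" for b
  proof -
    have "mut k s2 b k' = f k' b + f k b"
      using mut_through[OF sk2, of k b k'] s2(6) s2(5,9)[OF b] af[OF b] kV p by simp
    then show "mut k s2 b k' = f k' b + f k b" "mut k s2 k' b = - (f k' b + f k b)"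
      using skewD[of "mut k s2" b k'] sk2 by auto
    show "mut k s2 k b = f k b" "mut k s2 b k = - f k b"
      using s2(9)[OF b] skewD[OF sk2, of b k] sk2 by auto
  qed
  have ge: "s2 a k \<ge> 0 \<and> a \<noteq> k" if "before a \<or> after a" for a
    using that
  proof
    assume a: "before a" then show ?thesis using s2(7)[OF p a] bf(1,4)[OF a] by simp_all
  next
    assume a: "after a" then show ?thesis using s2(9)[OF a] af(1,3)[OF a] by simp_all
  qed
  have s3_xy: "mut k s2 a b = s2 a b" if "before a \<or> after a" "before b \<or> after b" for a b
    using mut_in[OF sk2, of k a b] ge that by auto
  have t1v: "t1 k' k = 1" using p st1 sk by simp
  have t1_a: "t1 a k = f a k" "t1 a k' = - f a k'" "t1 k a = - f a k" "t1 k' a = f a k'"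
    if a: "before a" for a
    using mut_in[OF sk, of k' a k] bf[OF a] kV p skewD[OF st1, of a k] sk by auto
  have t1_b: "t1 k b = f k b + f k' b" "t1 k' b = - f k' b" "t1 b k' = f k' b" "t1 b k = - (f k b + f k' b)"
    if b: "after b" for b
    using mut_through[OF sk, of k' k b] af[OF b] kV p skewD[OF st1, of k b] sk by auto
  have t2_kk: "t2 k k' = 1" "t2 k' k = -1" using t1v skewD[OF st2, of k k'] st1 by auto
  have t2_a: "t2 a k' = - f a k'" "t2 k' a = f a k'" "t2 k a = f a k" "t2 a k = - f a k" if a: "before a" for a
    using mut_in[OF st1, of k a k'] bf[OF a] t1_a[OF a] t1v kV p skewD[OF st2, of a k'] st1 by auto
  have t2_b: "t2 k' b = f k b" "t2 b k' = - f k b" "t2 b k = f k b + f k' b" "t2 k b = - (f k b + f k' b)"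
    if b: "after b" for b
    using mut_through[OF st1, of k k' b] af[OF b] t1_b[OF b] t1v kV p skewD[OF st2, of k' b] st1 by auto
  have t2_aa: "t2 a a' = f a a'" if "before a" "before a'" for a a'
    using mut_in[OF st1, of k a a'] mut_in[OF sk, of k' a a'] bf[OF that(1)] bf[OF that(2)]
      t1_a[OF that(1)] t1_a[OF that(2)] by simp
  have t2_bb: "t2 a a' = f a a'" if "after a" "after a'" for a a'
    using mut_out[OF st1, of k a a'] mut_out[OF sk, of k' a a'] af[OF that(1)] af[OF that(2)]
      t1_b[OF that(1)] t1_b[OF that(2)] by simp
  have s2_ab: "s2 a b = t2 a b" if "before a" "after b" for a b
    using mut_through[OF st1, of k a b] mut_through[OF sk, of k' a b] bf[OF that(1)] af[OF that(2)]
      t1_a[OF that(1)] t1_b[OF that(2)] s2(2)[OF that] p by (simp add: algebra_simps)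
  have s2_ba: "s2 b a = t2 b a" if "before a" "after b" for a b
    using s2_ab[OF that] skewD[OF sk2, of a b] skewD[OF st2, of a b] by simp
  consider "x \<in> {k, k'}" "y \<in> {k, k'}" | "x \<in> {k, k'}" "y \<notin> {k, k'}" | "x \<notin> {k, k'}" "y \<in> {k, k'}"
    | "x \<notin> {k, k'}" "y \<notin> {k, k'}" by blast
  then show "mut k s2 x y = swap_arr k k' t2 x y"
  proof cases
    case 1
    then show ?thesis using s3_kk t2_kk skew_diag[OF st2] skew_diag[of "mut k s2"] sk2
      by (auto simp: swap_arr_def)
  next
    case 2
    then have "before y \<or> after y" using before_or_after by auto
    then show ?thesis using 2 s3_a[of y] s3_b[of y] t2_a[of y] t2_b[of y] by (auto simp: swap_arr_def)
  next
    case 3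
    then have "before x \<or> after x" using before_or_after by auto
    then show ?thesis using 3 s3_a[of x] s3_b[of x] t2_a[of x] t2_b[of x] by (auto simp: swap_arr_def)
  next
    case 4
    then have *: "before x \<or> after x" "before y \<or> after y" using before_or_after by auto
    then have "s2 x y = t2 x y"
      using s2(1,3)[of x y] t2_aa[of x y] t2_bb[of x y] s2_ab[of x y] s2_ba[of y x] by auto
    then show ?thesis using 4 s3_xy[OF *] by (simp add: swap_arr_def)
  qed
qed

end

lemma swap_arr_swap_arr [simp]: "swap_arr k k' (swap_arr k k' f) = f"
  by (simp add: swap_arr_def)

lemma swp_commute: "swp k' k = swp k k'"
  by (auto simp: swp_def)

lemma swap_arr_commute: "swap_arr k' k = swap_arr k k'"
  by (simp add: fun_eq_iff swap_arr_def swp_commute)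

lemma swap_arr_apply [simp]: "swap_arr k k' f (swp k k' a) (swp k k' b) = f a b"
  by (simp add: swap_arr_def)

lemma mut_swap_arrs:
  "mut k' (swap_arr k k' f) = swap_arr k k' (mut k f)"
  "mut k (swap_arr k k' f) = swap_arr k k' (mut k' f)"
  "v \<noteq> k \<Longrightarrow> v \<noteq> k' \<Longrightarrow> mut v (swap_arr k k' f) = swap_arr k k' (mut v f)"
  using mut_swap_arr[of k k' k f] mut_swap_arr[of k k' k' f] mut_swap_arr[of k k' v f] by auto

lemma abundant_order_swap_arr:
  "abundant_order (swp k k' ` S) (swap_arr k k' f) = abundant_order S f"
  unfolding abundant_order_def by simp

lemma fork_on_swap_arr:
  "fork_on (swp k k' ` V) (swap_arr k k' f) (swp k k' r) = fork_on V f r"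
proof -
  have "{i \<in> swp k k' ` V. swap_arr k k' f i (swp k k' r) > 0} = swp k k' ` {i\<in>V. f i r > 0}"
    "{i \<in> swp k k' ` V. swap_arr k k' f (swp k k' r) i > 0} = swp k k' ` {i\<in>V. f r i > 0}"
    by auto
  then show ?thesis unfolding fork_on_def by (simp add: abundant_order_swap_arr image_iff)
qed

lemma fork_or_order_swap_arr:
  "fork_or_order V f \<Longrightarrow> fork_or_order (swp k k' ` V) (swap_arr k k' f)"
  unfolding fork_or_order_def abundant_order_swap_arr
  using fork_on_swap_arr[where V = V and f = f and k = k and k' = k'] by fast

lemma swp_image:
  assumes "k \<in> V" "k' \<in> V"
  shows "swp k k' ` V = V" "swp k k' ` (V - {k}) = V - {k'}" "swp k k' ` (V - {k'}) = V - {k}"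
proof -
  have *: "x \<in> swp k k' ` W \<longleftrightarrow> swp k k' x \<in> W" for x W
    by (metis image_iff swp_simps(4))
  have s: "swp k k' x \<in> V \<longleftrightarrow> x \<in> V" "swp k k' x = k \<longleftrightarrow> x = k'" "swp k k' x = k' \<longleftrightarrow> x = k" for x
    using assms by (auto simp: swp_def)
  show "swp k k' ` V = V" "swp k k' ` (V - {k}) = V - {k'}" "swp k k' ` (V - {k'}) = V - {k}"
    by (auto simp: set_eq_iff * s)
qed

lemma fork_on_swap:
  assumes "k \<in> V" "k' \<in> V" "r \<noteq> k" "r \<noteq> k'"
  shows "fork_on V f r \<Longrightarrow> fork_on V (swap_arr k k' f) r"
    and "fork_on (V - {k}) f r \<Longrightarrow> fork_on (V - {k'}) (swap_arr k k' f) r"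
    and "fork_on (V - {k'}) f r \<Longrightarrow> fork_on (V - {k}) (swap_arr k k' f) r"
  using fork_on_swap_arr[of k k' V f r] fork_on_swap_arr[of k k' "V - {k}" f r]
    fork_on_swap_arr[of k k' "V - {k'}" f r] assms swp_image[OF assms(1,2)] by auto

lemma prefork_on_root: "prefork_on V f r k k' \<Longrightarrow> r \<noteq> k \<and> r \<noteq> k' \<and> r \<in> V"
  unfolding prefork_on_def fork_on_def by blast

lemma prefork_on_swap:
  assumes P: "prefork_on V f r k k'" shows "prefork_on V (swap_arr k k' f) r k k'"
proof -
  have r: "r \<noteq> k" "r \<noteq> k'" using prefork_on_root[OF P] by auto
  have "twins V (swap_arr k k' f) k k'" using P unfolding prefork_on_def twins_def
    by (auto simp: swap_arr_def)
  then show ?thesis using P fork_on_swap(2,3)[of k V k' r f] r unfolding prefork_on_def by auto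
qed

section \<open>Orbits under mutations at \<open>k\<close> and \<open>k'\<close>\<close>

definition orbit :: "'a \<Rightarrow> 'a \<Rightarrow> ('a \<Rightarrow> 'a \<Rightarrow> int) \<Rightarrow> ('a \<Rightarrow> 'a \<Rightarrow> int) set" where
  "orbit k k' f = {fold mut u f | u. set u \<subseteq> {k, k'}}"

lemma orbit_refl [simp]: "f \<in> orbit k k' f"
  unfolding orbit_def by (auto intro!: exI[of _ "[]"])

lemma orbit_mut:
  assumes "g \<in> orbit k k' f" shows "mut k g \<in> orbit k k' f" "mut k' g \<in> orbit k k' f"
proof -
  obtain u where u: "g = fold mut u f" "set u \<subseteq> {k, k'}" using assms unfolding orbit_def by auto
  have "mut w g = fold mut (u @ [w]) f" for w using u(1) by simp
  moreover have "set (u @ [k]) \<subseteq> {k, k'}" "set (u @ [k']) \<subseteq> {k, k'}" using u(2) by auto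
  ultimately show "mut k g \<in> orbit k k' f" "mut k' g \<in> orbit k k' f"
    unfolding orbit_def by blast+
qed

lemma orbit_least:
  assumes "f \<in> S" "\<And>g. g \<in> S \<Longrightarrow> mut k g \<in> S" "\<And>g. g \<in> S \<Longrightarrow> mut k' g \<in> S"
  shows "orbit k k' f \<subseteq> S"
proof
  fix g assume "g \<in> orbit k k' f"
  then obtain u where u: "g = fold mut u f" "set u \<subseteq> {k, k'}" unfolding orbit_def by auto
  have "fold mut u f \<in> S" using u(2) assms(1)
    by (induction u arbitrary: f) (use assms(2,3) in auto)
  then show "g \<in> S" using u by simp
qed

lemma orbit_commute: "orbit k' k f = orbit k k' f"
  unfolding orbit_def by (simp add: insert_commute)

lemma orbit_arrows:
  assumes sk: "skew f" and g: "g \<in> orbit k k' f" shows "\<bar>g k k'\<bar> = \<bar>f k k'\<bar>"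
proof -
  have "\<bar>h k' k\<bar> = \<bar>h k k'\<bar>" if "skew h" for h using skewD[OF that, of k k'] by simp
  then have "orbit k k' f \<subseteq> {h. skew h \<and> \<bar>h k k'\<bar> = \<bar>f k k'\<bar>}"
    using sk by (intro orbit_least) auto
  then show ?thesis using g by auto
qed

lemma orbit_swap:
  assumes "g \<in> orbit k k' f" shows "swap_arr k k' g \<in> orbit k k' (swap_arr k k' f)"
proof -
  have "orbit k k' f \<subseteq> {g. swap_arr k k' g \<in> orbit k k' (swap_arr k k' f)}"
    using orbit_mut by (intro orbit_least) (auto simp: mut_swap_arrs[symmetric])
  then show ?thesis using assms by auto
qed

lemma orbit_trans:
  assumes "g \<in> orbit k k' f" "h \<in> orbit k k' g" shows "h \<in> orbit k k' f"
proof -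
  have "orbit k k' g \<subseteq> orbit k k' f"
    using orbit_mut assms(1) by (intro orbit_least) auto
  then show ?thesis using assms(2) by auto
qed

lemma orbit_sym:
  assumes sk: "skew f" and g: "g \<in> orbit k k' f" shows "f \<in> orbit k k' g"
proof -
  have "orbit k k' f \<subseteq> {g. skew g \<and> f \<in> orbit k k' g}"
  proof (rule orbit_least)
    fix g assume g: "g \<in> {g. skew g \<and> f \<in> orbit k k' g}"
    then have "mut k (mut k g) = g" "mut k' (mut k' g) = g" by simp_all
    then have "g \<in> orbit k k' (mut k g)" "g \<in> orbit k k' (mut k' g)"
      using orbit_mut(1)[of "mut k g" k k' "mut k g"] orbit_mut(2)[of "mut k' g" k k' "mut k' g"]
      by simp_all
    then show "mut k g \<in> {g. skew g \<and> f \<in> orbit k k' g}" "mut k' g \<in> {g. skew g \<and> f \<in> orbit k k' g}"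
      using g orbit_trans[of g k k' "mut k g" f] orbit_trans[of g k k' "mut k' g" f] by simp_all
  qed (use sk in auto)
  then show ?thesis using g by auto
qed

context block
begin

definition "states = {f, s1, s2, t1, t2}"

lemma pentagon_swap:
  assumes p: "f k k' = 1"
  shows "fold mut [k, k', k, k', k] f = swap_arr k k' f"
  using pentagon[OF p] sk by (simp add: mut_swap_arrs)

text \<open>The stages form a chain \<open>s2\<close>, \<open>s1\<close>, \<open>f\<close>,
  \<open>t1\<close>, \<open>t2\<close>. By the pentagon relation each of its ends is joined to the
  opposite end of the interchanged copy of the chain, which closes a cycle.\<close>

lemma orbit_1:
  assumes p: "f k k' = 1"
  shows "orbit k k' f \<subseteq> states \<union> swap_arr k k' ` states" "swap_arr k k' f \<in> orbit k k' f"
proof -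
  have 1: "mut k s2 = swap_arr k k' t2" using pentagon[OF p] .
  then have "swap_arr k k' (mut k s2) = t2" by simp
  then have "mut k' (swap_arr k k' s2) = t2" by (simp add: mut_swap_arrs)
  then have 2: "mut k' t2 = swap_arr k k' s2"
    using sk by (metis mut_mut mut_swap_arrs(1) skew_mut swap_arr_swap_arr 1)
  have inv: "mut k s1 = f" "mut k' t1 = f" "mut k' s2 = s1" "mut k t2 = t1" using sk by simp_all
  show "orbit k k' f \<subseteq> states \<union> swap_arr k k' ` states"
    by (rule orbit_least) (auto simp: states_def mut_swap_arrs 1 2 inv)
  have "fold mut [k, k', k, k', k] f \<in> orbit k k' f" unfolding orbit_def
    by (intro CollectI exI[of _ "[k, k', k, k', k]"]) auto
  then show "swap_arr k k' f \<in> orbit k k' f" using pentagon_swap[OF p] by simp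
qed

lemma orbit_0:
  assumes p: "f k k' = 0" shows "orbit k k' f \<subseteq> states"
proof -
  have "mut k s1 = f" "mut k' t1 = f" "mut k' s2 = s1" "mut k t2 = t1" using sk by simp_all
  moreover from this have "mut k s2 = t1" "mut k' t2 = s1" using commute_0[OF p] by metis+
  ultimately show ?thesis by (intro orbit_least) (auto simp: states_def)
qed

lemma orbit_finite: "finite (orbit k k' f)" "card (orbit k k' f) \<le> 10"
proof -
  have "states = set [f, s1, s2, t1, t2]" unfolding states_def by simp
  moreover have "length [f, s1, s2, t1, t2] = 5" by simp
  ultimately have 1: "finite states" "card states \<le> 5"
    using card_length[of "[f, s1, s2, t1, t2]"] by (metis finite_set, metis)
  have sub: "orbit k k' f \<subseteq> states \<union> swap_arr k k' ` states" using orbit_1 orbit_0 small by auto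
  show "finite (orbit k k' f)" using finite_subset[OF sub] 1 by auto
  have "card (states \<union> swap_arr k k' ` states) \<le> card states + card (swap_arr k k' ` states)"
    by (rule card_Un_le)
  also have "\<dots> \<le> 10" using 1 card_image_le[OF 1(1), of "swap_arr k k'"] by linarith
  finally show "card (orbit k k' f) \<le> 10" using card_mono[OF _ sub] 1 by auto
qed

end

section \<open>The tree structure of branches\<close>

definition quiver_on :: "'a set \<Rightarrow> ('a \<Rightarrow> 'a \<Rightarrow> int) \<Rightarrow> bool" where
  "quiver_on V f \<longleftrightarrow> skew f \<and> (\<forall>i j. f i j \<noteq> 0 \<longrightarrow> i \<in> V \<and> j \<in> V)"

lemma quiver_on_mut:
  assumes "quiver_on V f" shows "quiver_on V (mut v f)"
  unfolding quiver_on_def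
proof (intro conjI allI impI)
  have sk: "skew f" and supp: "\<And>i j. f i j \<noteq> 0 \<Longrightarrow> i \<in> V \<and> j \<in> V"
    using assms unfolding quiver_on_def by auto
  show "skew (mut v f)" using sk by simp
  fix i j assume h: "mut v f i j \<noteq> 0"
  have "\<not> (i \<notin> V \<or> j \<notin> V)"
  proof
    assume "i \<notin> V \<or> j \<notin> V"
    then have "f i j = 0" "f i v = 0 \<and> f v i = 0 \<or> f v j = 0 \<and> f j v = 0" using supp by blast+
    then show False using h by (auto simp: mut_def split: if_splits)
  qed
  then show "i \<in> V" "j \<in> V" by auto
qed

lemma quiver_on_skew: "quiver_on V f \<Longrightarrow> skew f"
  by (simp add: quiver_on_def)

lemma quiver_on_orbit:
  assumes "quiver_on V f" "g \<in> orbit k k' f" shows "quiver_on V g"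
proof -
  have "orbit k k' f \<subseteq> Collect (quiver_on V)"
    using assms(1) by (intro orbit_least) (auto intro: quiver_on_mut)
  then show ?thesis using assms(2) by auto
qed

lemma prefork_on_mutable:
  assumes P: "prefork_on V f r k k'" and sk: "skew f" and v: "v \<in> V - {k, k'}" "v \<noteq> r"
  shows "mutable (V - {k}) f v" "mutable (V - {k'}) f v" "\<exists>u\<in>V. f u v > 0" "\<exists>u\<in>V. f v u > 0"
proof -
  have F: "fork_on (V - {k}) f r" "fork_on (V - {k'}) f r" using P unfolding prefork_on_def by auto
  show "mutable (V - {k}) f v" "mutable (V - {k'}) f v" "\<exists>u\<in>V. f u v > 0" "\<exists>u\<in>V. f v u > 0"
    using fork_on_mutable[OF sk F(1), of v] fork_on_mutable[OF sk F(2), of v] v by auto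
qed

lemma prefork_on_mut:
  assumes sk: "skew f" and V: "k \<in> V" "k' \<in> V" "k \<noteq> k'" and tw: "twins V f k k'"
    and m: "mutable (V - {k}) f v" "mutable (V - {k'}) f v"
    and ne: "\<exists>u\<in>V. f u v > 0" "\<exists>u\<in>V. f v u > 0"
  shows "prefork_on V (mut v f) v k k'"
proof -
  have "v \<in> V - {k, k'}" using mutableD(1)[OF m(1)] mutableD(1)[OF m(2)] by auto
  then have "f k v > 0 \<and> f k' v > 0 \<or> f v k > 0 \<and> f v k' > 0" using tw unfolding twins_def by blast
  moreover have "twins {w\<in>V. f w v > 0} f k k'" "twins {w\<in>V. f v w > 0} f k k'"
    using twins_subset[OF tw] by auto
  ultimately show ?thesis
    using prefork_on_mut_in[OF sk V m] prefork_on_mut_out[OF sk V m] ne by auto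
qed

text \<open>Since \<open>k\<close> is not the point of return of the fork left by deleting
  \<open>k'\<close>, it is mutable there and has neighbours on both sides. A nonempty
  \<open>C\<close> rules out the exceptional case of \<open>exits\<close>.\<close>

lemma prefork_block:
  assumes P: "prefork_on V f r k k'" and q: "quiver_on V f" and p: "f k k' = 0 \<or> f k k' = 1"
  shows "block V f k k'" "block.A V f k k' \<noteq> {}" "block.C V f k k' \<noteq> {}"
proof -
  have V: "k \<in> V" "k' \<in> V" "k \<noteq> k'" and tw: "twins V f k k'"
    and F: "fork_on (V - {k}) f r" "fork_on (V - {k'}) f r" using P unfolding prefork_on_def by auto
  have r: "r \<noteq> k" "r \<noteq> k'" using prefork_on_root[OF P] by auto
  have sk: "skew f" using q by (rule quiver_on_skew)
  have "mutable (V - {k'}) f k" "mutable (V - {k}) f k'"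
    using fork_on_mutable(1)[OF sk F(1), of k'] fork_on_mutable(1)[OF sk F(2), of k] V r by auto
  then show b: "block V f k k'"
    using V tw p q unfolding block_def quiver_on_def by auto
  show "block.A V f k k' \<noteq> {}" "block.C V f k k' \<noteq> {}"
    using fork_on_mutable(2,3)[OF sk F(2), of k] V r skew_diag[OF sk, of k]
    unfolding block.A_def[OF b] block.C_def[OF b] by force+
qed

text \<open>The interchanged pre-fork is the second quiver in the definition of the branch: five
  alternating mutations amount to interchanging \<open>k\<close> and \<open>k'\<close>
  (\<open>pentagon_prefork\<close>).\<close>

definition entries :: "('a \<Rightarrow> 'a \<Rightarrow> int) \<Rightarrow> 'a \<Rightarrow> 'a \<Rightarrow> 'a \<Rightarrow> (('a \<Rightarrow> 'a \<Rightarrow> int) \<times> 'a) set" where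
  "entries f r k k' = insert (f, r) (if \<bar>f k k'\<bar> = 1 then {(swap_arr k k' f, r)} else {})"

text \<open>It suffices to treat the five stages; the exits of their interchanged copies are the
  images under the interchange, which fixes \<open>v\<close>.\<close>

lemma prefork_orbit_oriented:
  assumes P: "prefork_on V f r k k'" and q: "quiver_on V f" and p: "f k k' = 0 \<or> f k k' = 1"
    and g: "g \<in> orbit k k' f"
  shows "v \<in> V - {k, k'} \<Longrightarrow> (g, v) \<notin> entries f r k k' \<Longrightarrow>
      fork_on V (mut v g) v \<or> prefork_on V (mut v g) v k k'"
    and "fork_or_order (V - {k}) g \<and> fork_or_order (V - {k'}) g"
    and "f k k' = 1 \<Longrightarrow> swap_arr k k' f \<in> orbit k k' f"
proof -
  interpret block V f k k' using prefork_block(1)[OF P q p] .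
  have AC: "A \<noteq> {}" "C \<noteq> {}" using prefork_block[OF P q p] by auto
  have r: "r \<noteq> k" "r \<noteq> k'" using prefork_on_root[OF P] by auto
  have F: "fork_on (V - {k}) f r" "fork_on (V - {k'}) f r" using P unfolding prefork_on_def by auto
  obtain v0 where v0: "v0 \<in> V - {k, k'}" using r prefork_on_root[OF P] by auto
  have 1: "fork_on V (mut v h) v \<or> prefork_on V (mut v h) v k k'"
    if "h \<in> states" "v \<in> V - {k, k'}" "\<not> (h = f \<and> v = r)" for h v
  proof (cases "h = f")
    case True
    then have vr: "v \<noteq> r" using that by auto
    show ?thesis using prefork_on_mut[OF sk kV tw prefork_on_mutable[OF P sk that(2) vr]] True by simp
  next
    case False
    then show ?thesis using exits(1)[OF AC(1) that(2), of h] AC(2) that(1) unfolding states_def by auto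
  qed
  have 2: "fork_or_order (V - {k}) h \<and> fork_or_order (V - {k'}) h" if "h \<in> states" for h
  proof (cases "h = f")
    case True
    then show ?thesis using F unfolding fork_or_order_def by auto
  next
    case False
    then show ?thesis using exits(2,3)[OF AC(1) v0, of h] that(1) unfolding states_def by auto
  qed
  consider (s) "g \<in> states" | (t) h where "g = swap_arr k k' h" "h \<in> states" "f k k' = 1"
    using g orbit_1(1) orbit_0 p by blast
  note cases_g = this
  show "fork_on V (mut v g) v \<or> prefork_on V (mut v g) v k k'"
    if v: "v \<in> V - {k, k'}" "(g, v) \<notin> entries f r k k'"
    using cases_g
  proof cases
    case s
    then show ?thesis using 1[OF s v(1)] v(2) unfolding entries_def by auto
  next
    case t
    then have "fork_on V (mut v h) v \<or> prefork_on V (mut v h) v k k'"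
      using 1[OF t(2) v(1)] v(2) unfolding entries_def by auto
    moreover have "mut v g = swap_arr k k' (mut v h)" using t(1) v(1) mut_swap_arrs(3)[of v k k' h] by simp
    ultimately show ?thesis
      using fork_on_swap(1)[OF kV(1,2), of v "mut v h"] prefork_on_swap[of V "mut v h" v k k'] v(1) by auto
  qed
  show "fork_or_order (V - {k}) g \<and> fork_or_order (V - {k'}) g"
    using cases_g
  proof cases
    case s then show ?thesis by (rule 2)
  next
    case t
    then show ?thesis using 2[OF t(2)] fork_or_order_swap_arr[of "V - {k}" h k k']
      fork_or_order_swap_arr[of "V - {k'}" h k k'] swp_image[OF kV(1,2)] by simp
  qed
  show "f k k' = 1 \<Longrightarrow> swap_arr k k' f \<in> orbit k k' f" by (rule orbit_1(2))
qed

lemma entries_commute: "skew f \<Longrightarrow> entries f r k' k = entries f r k k'"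
  using skewD[of f k k'] unfolding entries_def by (simp add: swap_arr_commute)

text \<open>An arrow from \<open>k'\<close> to \<open>k\<close> is handled by exchanging the two
  names, as pre-forks, orbits and entries are symmetric in them.\<close>

lemma prefork_orbit:
  assumes P: "prefork_on V f r k k'" and q: "quiver_on V f" and p: "\<bar>f k k'\<bar> \<le> 1"
    and g: "g \<in> orbit k k' f"
  shows "v \<in> V - {k, k'} \<Longrightarrow> (g, v) \<notin> entries f r k k' \<Longrightarrow>
      fork_on V (mut v g) v \<or> prefork_on V (mut v g) v k k'"
    and "fork_or_order (V - {k}) g" "fork_or_order (V - {k'}) g"
    and "\<bar>f k k'\<bar> = 1 \<Longrightarrow> swap_arr k k' g \<in> orbit k k' f"
proof -
  have sk: "skew f" using q by (rule quiver_on_skew)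
  have comm: "V - {k', k} = V - {k, k'}" by auto
  consider (pos) "f k k' = 0 \<or> f k k' = 1" | (neg) "f k' k = 0 \<or> f k' k = 1" "f k k' = -1"
    using p skewD[OF sk, of k k'] by force
  then have *: "(v \<in> V - {k, k'} \<longrightarrow> (g, v) \<notin> entries f r k k' \<longrightarrow>
      fork_on V (mut v g) v \<or> prefork_on V (mut v g) v k k') \<and>
    fork_or_order (V - {k}) g \<and> fork_or_order (V - {k'}) g \<and>
    (\<bar>f k k'\<bar> = 1 \<longrightarrow> swap_arr k k' f \<in> orbit k k' f)"
  proof cases
    case pos
    then have "\<bar>f k k'\<bar> = 1 \<Longrightarrow> f k k' = 1" by auto
    then show ?thesis using prefork_orbit_oriented[OF P q pos g] by blast
  next
    case neg
    have P': "prefork_on V f r k' k" and g': "g \<in> orbit k' k f"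
      using P g prefork_on_commute orbit_commute by metis+
    have "f k' k = 1" using neg(2) skewD[OF sk, of k k'] by simp
    then show ?thesis
      using prefork_orbit_oriented(1)[OF P' q neg(1) g', of v] prefork_orbit_oriented(2,3)[OF P' q neg(1) g']
        prefork_on_commute[of V "mut v g" v k k']
      unfolding comm entries_commute[OF sk, of r k' k] swap_arr_commute[of k' k] orbit_commute[of k' k f] by blast
  qed
  then show "v \<in> V - {k, k'} \<Longrightarrow> (g, v) \<notin> entries f r k k' \<Longrightarrow>
      fork_on V (mut v g) v \<or> prefork_on V (mut v g) v k k'"
    "fork_or_order (V - {k}) g" "fork_or_order (V - {k'}) g" by auto
  show "\<bar>f k k'\<bar> = 1 \<Longrightarrow> swap_arr k k' g \<in> orbit k k' f"
    using * orbit_trans[OF _ orbit_swap[OF g]] by blast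
qed

text \<open>Triples without \<open>k\<close> or without \<open>k'\<close> are covered by the two
  deletions. In the others the third vertex cannot lie between \<open>k\<close> and
  \<open>k'\<close>, and it compares with both of them in the same way.\<close>

lemma abundant_order_twins:
  assumes sk: "skew f" and o: "abundant_order (S - {k}) f" "abundant_order (S - {k'}) f"
    and tw: "twins S f k k'" and p: "2 \<le> \<bar>f k k'\<bar>"
  shows "abundant_order S f"
proof (rule abundant_orderI)
  have p': "2 \<le> \<bar>f k' k\<bar>" using p skewD[OF sk, of k k'] by simp
  have ne: "k \<noteq> k'" using p sk by auto
  fix a b assume "a \<in> S" "b \<in> S" "a \<noteq> b"
  then show "2 \<le> \<bar>f a b\<bar>"
    using abundant_orderD(1)[OF o(1), of a b] abundant_orderD(1)[OF o(2), of a b] p p' ne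
    by (cases "a = k"; cases "b = k"; cases "a = k'"; cases "b = k'") auto
next
  have ne: "k \<noteq> k'" using p sk by auto
  have asym: "\<not> f b a > 0" if "f a b > 0" for a b using that skewD[OF sk, of a b] by simp
  fix a b c assume h: "a \<in> S" "b \<in> S" "c \<in> S" "0 < f a b" "0 < f b c"
  have d: "a \<noteq> b" "b \<noteq> c" "a \<noteq> c" using h asym[OF h(4)] sk by auto
  have t: "f k i > 0 \<longleftrightarrow> f k' i > 0" "f i k > 0 \<longleftrightarrow> f i k' > 0" if "i \<in> S" "i \<noteq> k" "i \<noteq> k'" for i
    using tw that asym[of k i] asym[of k' i] asym[of i k] asym[of i k'] unfolding twins_def by auto
  consider "k \<notin> {a, b, c}" | "k' \<notin> {a, b, c}" | "{k, k'} \<subseteq> {a, b, c}" by blast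
  then show "f a c > 0"
  proof cases
    case 1 then show ?thesis using abundant_orderD(2)[OF o(1), of a b c] h by auto
  next
    case 2 then show ?thesis using abundant_orderD(2)[OF o(2), of a b c] h by auto
  next
    case 3
    then consider "{a, b} = {k, k'}" | "{b, c} = {k, k'}" | "{a, c} = {k, k'}" using ne by auto
    then show ?thesis
    proof cases
      case 1
      then show ?thesis using t[of c] h d by (auto simp: doubleton_eq_iff)
    next
      case 2
      then show ?thesis using t[of a] h d by (auto simp: doubleton_eq_iff)
    next
      case 3
      then have "f b a > 0 \<or> f c b > 0" using t[of b] h d by (auto simp: doubleton_eq_iff)
      then show ?thesis using asym h by blast
    qed
  qed
qed

text \<open>Consequently only pre-forks with at most one arrow between \<open>k\<close> and
  \<open>k'\<close> require orbits; the others are treated as forks.\<close>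

lemma fork_on_if_prefork_on:
  assumes P: "prefork_on V f r k k'" and sk: "skew f" and p: "2 \<le> \<bar>f k k'\<bar>"
  shows "fork_on V f r"
proof -
  have V: "k \<in> V" "k' \<in> V" "k \<noteq> k'" and tw: "twins V f k k'"
    and F: "fork_on (V - {k}) f r" "fork_on (V - {k'}) f r" using P unfolding prefork_on_def by auto
  have r: "r \<noteq> k" "r \<noteq> k'" "r \<in> V" using prefork_on_root[OF P] by auto
  have asym: "\<not> f b a > 0" if "f a b > 0" for a b using that skewD[OF sk, of a b] by simp
  have tr: "f k r > 0 \<and> f k' r > 0 \<or> f r k > 0 \<and> f r k' > 0" using tw r unfolding twins_def by blast
  have "abundant_order {i\<in>V. f i r > 0} f" "abundant_order {i\<in>V. f r i > 0} f"
    using F abundant_order_twins[OF sk _ _ _ p] twins_subset[OF tw]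
    unfolding fork_on_def by (auto simp: set_diff_eq conj_commute conj_left_commute)
  moreover have "\<bar>f u r\<bar> \<ge> 2" if "u \<in> V" "u \<noteq> r" for u
    using F that V unfolding fork_on_def by (cases "u = k") auto
  moreover have "f j i > f i r \<and> f j i > f r j" if "i \<in> V" "j \<in> V" "f i r > 0" "f r j > 0" for i j
  proof -
    have "i \<in> V - {k} \<and> j \<in> V - {k} \<or> i \<in> V - {k'} \<and> j \<in> V - {k'}"
      using that tr V(3) asym[of k r] asym[of k' r] asym[of r k] asym[of r k'] by auto
    then show ?thesis using F that unfolding fork_on_def by blast
  qed
  moreover have "\<exists>i\<in>V. f i r > 0" "\<exists>j\<in>V. f r j > 0"
    using F(1) unfolding fork_on_def by auto
  ultimately show ?thesis using r(3) unfolding fork_on_def by simp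
qed

text \<open>
  A node is a group of quivers of the mutation graph together with the edges through which it can be
  entered: a fork with the edge at its point of return, or the orbit of a pre-fork under mutations
  at k and k' with the edges removed in the definition of its branch. Every other edge at a member
  of a node leads to another node, through one of its entries; this tree structure is what confines
  the branches.
\<close>

definition node :: "'a set \<Rightarrow> ('a \<Rightarrow> 'a \<Rightarrow> int) set \<Rightarrow> (('a \<Rightarrow> 'a \<Rightarrow> int) \<times> 'a) set \<Rightarrow> bool" where
  "node V S E \<longleftrightarrow>
     (\<exists>f r. quiver_on V f \<and> fork_on V f r \<and> S = {f} \<and> E = {(f, r)}) \<or>
     (\<exists>f r k k'. quiver_on V f \<and> prefork_on V f r k k' \<and> \<bar>f k k'\<bar> \<le> 1 \<and>
        S = orbit k k' f \<and> E = entries f r k k')"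

text \<open>All entries of the new node, not only the one used, have to lead back to
  \<open>S\<close>; otherwise a walk could escape through the second entry of a pre-fork
  orbit.\<close>

definition child :: "'a set \<Rightarrow> ('a \<Rightarrow> 'a \<Rightarrow> int) set \<Rightarrow> ('a \<Rightarrow> 'a \<Rightarrow> int) \<Rightarrow> bool" where
  "child V S h \<longleftrightarrow> (\<exists>S' E'. node V S' E' \<and> h \<in> S' \<and> (\<forall>(g, v)\<in>E'. mut v g \<in> S))"

definition exits_to_nodes ::
  "'a set \<Rightarrow> ('a \<Rightarrow> 'a \<Rightarrow> int) set \<Rightarrow> (('a \<Rightarrow> 'a \<Rightarrow> int) \<times> 'a) set \<Rightarrow> bool" where
  "exits_to_nodes V S E \<longleftrightarrow>
     (\<forall>g\<in>S. \<forall>v\<in>V. (g, v) \<notin> E \<longrightarrow> mut v g \<in> S \<or> child V S (mut v g))"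

lemma child_fork:
  assumes "quiver_on V g" "g \<in> S" "fork_on V (mut v g) v"
  shows "child V S (mut v g)"
  unfolding child_def
proof (intro exI conjI)
  show "node V {mut v g} {(mut v g, v)}"
    unfolding node_def
    by (intro disjI1 exI[of _ "mut v g"] exI[of _ v] conjI)
      (use assms quiver_on_mut[of V g v] in simp_all)
  show "\<forall>(h, w)\<in>{(mut v g, v)}. mut w h \<in> S"
    using assms(2) quiver_on_skew[OF assms(1)] by simp
qed simp

text \<open>If one arrow joins \<open>k\<close> and \<open>k'\<close>, the second entry of the new
  orbit leads back to \<open>swap_arr k k' g\<close>; this is where the hypothesis on
  \<open>S\<close> comes from.\<close>

lemma child_prefork:
  assumes q: "quiver_on V g" and g: "g \<in> S" and P: "prefork_on V (mut v g) v k k'"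
    and sw: "\<bar>g k k'\<bar> = 1 \<Longrightarrow> swap_arr k k' g \<in> S"
  shows "child V S (mut v g)"
proof (cases "2 \<le> \<bar>mut v g k k'\<bar>")
  case True
  then show ?thesis
    using child_fork[OF q g] fork_on_if_prefork_on[OF P] quiver_on_skew[OF quiver_on_mut[OF q]] by blast
next
  case False
  have sk: "skew g" using q by (rule quiver_on_skew)
  have v: "v \<noteq> k" "v \<noteq> k'" "v \<in> V" using prefork_on_root[OF P] by auto
  then have "mut v g k v > 0 \<and> mut v g k' v > 0 \<or> mut v g v k > 0 \<and> mut v g v k' > 0"
    using P unfolding prefork_on_def twins_def by blast
  \<comment> \<open>Both \<open>k\<close> and \<open>k'\<close> lie on the same side of
    \<open>v\<close>, so no path through \<open>v\<close> joins them.\<close>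
  then have "mut v g k k' = g k k'"
    using mut_in[OF sk, of v k k'] mut_out[OF sk, of v k k'] v sk by auto
  show ?thesis
    unfolding child_def
  proof (intro exI conjI)
    show "node V (orbit k k' (mut v g)) (entries (mut v g) v k k')"
      unfolding node_def
      by (intro disjI2 exI[of _ "mut v g"] exI[of _ v] exI[of _ k] exI[of _ k'] conjI)
        (use quiver_on_mut[OF q] P False in simp_all)
    have "mut v (swap_arr k k' (mut v g)) = swap_arr k k' g"
      using mut_swap_arrs(3)[OF v(1,2), of "mut v g"] sk by simp
    then show "\<forall>(h, w)\<in>entries (mut v g) v k k'. mut w h \<in> S"
      using g sw \<open>mut v g k k' = g k k'\<close> sk unfolding entries_def by auto
  qed simp
qed

lemma node_exits:
  assumes "node V S E" shows "exits_to_nodes V S E"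
  using assms unfolding node_def
proof (elim disjE exE conjE)
  fix f r assume h: "quiver_on V f" "fork_on V f r" "S = {f}" "E = {(f, r)}"
  have sk: "skew f" using h(1) by (rule quiver_on_skew)
  show ?thesis unfolding exits_to_nodes_def
  proof (intro ballI impI disjI2)
    fix g v assume g: "g \<in> S" "v \<in> V" "(g, v) \<notin> E"
    then have "g = f" "v \<noteq> r" using h by auto
    then have "fork_on V (mut v g) v"
      using fork_on_mut[OF sk] fork_on_mutable[OF sk h(2) g(2)] by auto
    then show "child V S (mut v g)" using child_fork[OF _ g(1)] h(1) \<open>g = f\<close> by simp
  qed
next
  fix f r k k' assume h: "quiver_on V f" "prefork_on V f r k k'" "\<bar>f k k'\<bar> \<le> 1"
    "S = orbit k k' f" "E = entries f r k k'"
  show ?thesis unfolding exits_to_nodes_def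
  proof (intro ballI impI)
    fix g v assume g: "g \<in> S" "v \<in> V" "(g, v) \<notin> E"
    have qg: "quiver_on V g" using quiver_on_orbit[OF h(1)] g(1) h(4) by simp
    have go: "g \<in> orbit k k' f" using g h by simp
    have sw: "\<bar>g k k'\<bar> = 1 \<Longrightarrow> swap_arr k k' g \<in> S"
      using prefork_orbit(4)[OF h(2,1,3) go] orbit_arrows[OF quiver_on_skew[OF h(1)] go] h(4) by simp
    show "mut v g \<in> S \<or> child V S (mut v g)"
    proof (cases "v \<in> {k, k'}")
      case True
      then show ?thesis using orbit_mut[OF go] h(4) by auto
    next
      case False
      then have "fork_on V (mut v g) v \<or> prefork_on V (mut v g) v k k'"
        using prefork_orbit(1)[OF h(2,1,3) go, of v] g h(5) by auto
      then show ?thesis using child_fork[OF qg g(1)] child_prefork[OF qg g(1) _ sw] by blast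
    qed
  qed
qed

text \<open>The link from a new node back to its predecessor is part of the step, so a walk that
  uses an entry of the node returns to a group already reached.\<close>

inductive reach for V S0 E0 where
  root: "reach V S0 E0 S0 E0"
| step: "reach V S0 E0 S E \<Longrightarrow> node V S' E' \<Longrightarrow> (\<forall>(g, v)\<in>E'. mut v g \<in> S) \<Longrightarrow> reach V S0 E0 S' E'"

lemma reach_node: "reach V S0 E0 S E \<Longrightarrow> (S = S0 \<and> E = E0) \<or> node V S E"
  by (induction rule: reach.induct) auto

text \<open>An exit of a reached group stays in it, leads to a child, which is then reached too, or
  uses an entry. The last returns to the predecessor, except at the start, whose entries are
  excluded.\<close>

lemma exits_closure:
  assumes ex: "exits_to_nodes V S0 E0"
  obtains U where "S0 \<subseteq> U"
    and "\<And>g. g \<in> U \<Longrightarrow> g \<in> S0 \<or> (\<exists>S E. node V S E \<and> g \<in> S)"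
    and "\<And>g v. g \<in> U \<Longrightarrow> v \<in> V \<Longrightarrow> (g, v) \<notin> E0 \<Longrightarrow> mut v g \<in> U"
proof
  let ?U = "{g. \<exists>S E. reach V S0 E0 S E \<and> g \<in> S}"
  show "S0 \<subseteq> ?U" using reach.root by blast
  show "g \<in> S0 \<or> (\<exists>S E. node V S E \<and> g \<in> S)" if "g \<in> ?U" for g
    using that reach_node[of V S0 E0] by blast
  show "mut v g \<in> ?U" if g: "g \<in> ?U" "v \<in> V" "(g, v) \<notin> E0" for g v
  proof -
    obtain S E where r: "reach V S0 E0 S E" "g \<in> S" using g by blast
    have "exits_to_nodes V S E" using reach_node[OF r(1)] node_exits ex by auto
    moreover have "\<exists>S'. mut v g \<in> S' \<and> (\<exists>E'. reach V S0 E0 S' E')" if "(g, v) \<in> E"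
      using r(1)
    proof cases
      case root then show ?thesis using g(3) that by simp
    next
      case (step S1 E1)
      then show ?thesis using that by blast
    qed
    ultimately consider "mut v g \<in> S" | "child V S (mut v g)" | "\<exists>S'. mut v g \<in> S' \<and> (\<exists>E'. reach V S0 E0 S' E')"
      using r(2) g(2) unfolding exits_to_nodes_def by blast
    then show ?thesis
    proof cases
      case 1 then show ?thesis using r(1) by blast
    next
      case 2
      then obtain S' E' where "node V S' E'" "mut v g \<in> S'" "\<forall>(g, v)\<in>E'. mut v g \<in> S"
        unfolding child_def by blast
      then show ?thesis using reach.step[OF r(1)] by blast
    next
      case 3 then show ?thesis by blast
    qed
  qed
qed

section \<open>Abundant acyclic quivers and their rotations\<close>

text \<open>Initial segments of the order. The full set is left out because its flip gives nothing
  new: for \<open>X = V\<close> it is \<open>f\<close> itself, and for a block with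
  \<open>X = V - {k, k'}\<close> it lies in the orbit of \<open>f\<close>
  (\<open>flip_all_rotations\<close>).\<close>

definition down_sets :: "'a set \<Rightarrow> ('a \<Rightarrow> 'a \<Rightarrow> int) \<Rightarrow> 'a set set" where
  "down_sets X f = {D. D \<subset> X \<and> (\<forall>u\<in>D. \<forall>w\<in>X. f w u > 0 \<longrightarrow> w \<in> D)}"

lemma down_setsI:
  "D \<subset> X \<Longrightarrow> (\<And>u w. u \<in> D \<Longrightarrow> w \<in> X \<Longrightarrow> f w u > 0 \<Longrightarrow> w \<in> D) \<Longrightarrow> D \<in> down_sets X f"
  unfolding down_sets_def by blast

lemma abundant_order_total:
  assumes "skew f" "abundant_order S f" "a \<in> S" "b \<in> S" "a \<noteq> b" "\<not> f a b > 0"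
  shows "f b a \<ge> 2"
  using abundant_orderD(1)[OF assms(2-4)] assms(5,6) skewD[OF assms(1), of a b] by auto

text \<open>Initial segments of a linear order form a chain, so they are told apart by their
  cardinalities, all of which are below \<open>card X\<close>.\<close>

lemma card_down_sets:
  assumes fin: "finite X" and sk: "skew f" and o: "abundant_order X f"
  shows "finite (down_sets X f)" "card (down_sets X f) \<le> card X"
proof -
  have fin': "finite D" if "D \<in> down_sets X f" for D
    using that finite_subset[OF _ fin, of D] unfolding down_sets_def by auto
  have chain: "D \<subseteq> D' \<or> D' \<subseteq> D" if DD: "D \<in> down_sets X f" "D' \<in> down_sets X f" for D D'
  proof (rule ccontr)
    assume "\<not> (D \<subseteq> D' \<or> D' \<subseteq> D)"
    then obtain d d' where d: "d \<in> D" "d \<notin> D'" "d' \<in> D'" "d' \<notin> D" by blast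
    then have X: "d \<in> X" "d' \<in> X" using DD unfolding down_sets_def by auto
    have "\<not> f d d' > 0" using DD(2) d X unfolding down_sets_def by blast
    moreover have "\<not> f d' d > 0" using DD(1) d X unfolding down_sets_def by blast
    ultimately show False using abundant_order_total[OF sk o X] d by auto
  qed
  have "inj_on card (down_sets X f)"
  proof (rule inj_onI)
    fix D D' assume DD: "D \<in> down_sets X f" "D' \<in> down_sets X f" and c: "card D = card D'"
    show "D = D'"
      using chain[OF DD] card_subset_eq[OF fin'[OF DD(2)] _ c] card_subset_eq[OF fin'[OF DD(1)] _ c[symmetric]]
      by auto
  qed
  moreover have "card ` down_sets X f \<subseteq> {..<card X}"
    using psubset_card_mono[OF fin] unfolding down_sets_def by auto
  ultimately show "finite (down_sets X f)" "card (down_sets X f) \<le> card X"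
    using card_inj_on_le[of card "down_sets X f" "{..<card X}"] inj_on_finite by (fastforce, fastforce)
qed

lemma skew_flip [simp]:
  assumes "skew f" shows "skew (flip D f)"
  unfolding skew_def
proof (intro allI)
  fix i j
  show "flip D f j i = - flip D f i j" using skewD[OF assms, of i j] by (simp add: flip_def)
qed

lemma quiver_on_flip: "quiver_on V f \<Longrightarrow> quiver_on V (flip D f)"
  unfolding quiver_on_def using skew_flip[of f D] by (auto simp: flip_def split: if_splits)

lemma flip_empty [simp]: "flip {} f = f"
  by (simp add: flip_def)

lemma flip_flip [simp]: "flip D (flip D f) = f"
  by (intro ext) (simp add: flip_def)

lemma flip_singleton:
  "v \<notin> D \<Longrightarrow> flip {v} (flip D f) = flip (insert v D) f"
  "v \<in> D \<Longrightarrow> flip {v} (flip D f) = flip (D - {v}) f"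
  by (intro ext, auto simp: flip_def)+

lemma flip_complement:
  assumes "quiver_on V f" shows "flip (V - D) f = flip D f"
proof (intro ext)
  fix a b
  have "f a b = 0 \<or> a \<in> V \<and> b \<in> V" using assms unfolding quiver_on_def by blast
  then show "flip (V - D) f a b = flip D f a b" unfolding flip_def by auto
qed

lemma mut_source:
  assumes q: "quiver_on V g" and "(\<forall>u\<in>V. \<not> g u v > 0) \<or> (\<forall>u\<in>V. \<not> g v u > 0)"
  shows "mut v g = flip {v} g"
proof (intro ext)
  fix a b
  have sk: "skew g" using q by (rule quiver_on_skew)
  have z: "g u v = 0" "g v u = 0" if "u \<notin> V" for u using q that unfolding quiver_on_def by blast+
  have s: "g u v = - g v u" for u by (rule skewD[OF sk])
  have "(\<forall>u. g v u \<ge> 0) \<or> (\<forall>u. g u v \<ge> 0)"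
    using assms(2)
  proof (rule disj_forward)
    show "\<forall>u. g v u \<ge> 0" if "\<forall>u\<in>V. \<not> g u v > 0"
    proof
      fix u show "g v u \<ge> 0" using that z[of u] s[of u] by (cases "u \<in> V") auto
    qed
    show "\<forall>u. g u v \<ge> 0" if "\<forall>u\<in>V. \<not> g v u > 0"
    proof
      fix u show "g u v \<ge> 0" using that z[of u] s[of u] by (cases "u \<in> V") auto
    qed
  qed
  then have "mut v g a b = g a b" if "v \<noteq> a" "v \<noteq> b"
    using mut_in[OF sk that] mut_out[OF sk that] by blast
  then show "mut v g a b = flip {v} g a b"
    using s[of a] s[of b] sk by (cases "v = a \<or> v = b") (auto simp: flip_def)
qed

text \<open>The initial segment \<open>D\<close> is moved behind the rest, and nothing changes
  inside the two parts.\<close>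

lemma abundant_order_flip:
  assumes sk: "skew f" and o: "abundant_order S f"
    and D: "\<And>u w. u \<in> S \<Longrightarrow> u \<in> D \<Longrightarrow> w \<in> S \<Longrightarrow> f w u > 0 \<Longrightarrow> w \<in> D"
  shows "abundant_order S (flip D f)"
proof -
  have "abundant_order (S - D) f" "abundant_order (S \<inter> D) f"
    by (rule abundant_order_subset[OF o], blast)+
  then have "abundant_order (S - D) (flip D f)" "abundant_order (S \<inter> D) (flip D f)"
    using abundant_order_cong[of "S - D" "flip D f" f] abundant_order_cong[of "S \<inter> D" "flip D f" f]
    by (auto simp: flip_def)
  moreover have "flip D f a b \<ge> 2" if "a \<in> S - D" "b \<in> S \<inter> D" for a b
    using abundant_order_total[OF sk o, of a b] D[of b a] that skewD[OF sk, of a b]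
    by (auto simp: flip_def)
  ultimately have "abundant_order ((S - D) \<union> (S \<inter> D)) (flip D f)"
    using sk by (intro abundant_order_Un) auto
  moreover have "(S - D) \<union> (S \<inter> D) = S" by blast
  ultimately show ?thesis by simp
qed

text \<open>The flips are the rotations of the order. A source or sink of a rotation moves to the
  other end, which gives another rotation; at any other vertex the mutation gives a fork.\<close>

lemma order_exits:
  assumes q: "quiver_on V f" and fin: "finite V" "V \<noteq> {}" and o: "abundant_order V f"
  shows "exits_to_nodes V ((\<lambda>D. flip D f) ` down_sets V f) {}" (is "exits_to_nodes V ?Z {}")
    and "f \<in> (\<lambda>D. flip D f) ` down_sets V f"
    and "finite ((\<lambda>D. flip D f) ` down_sets V f)"
    and "card ((\<lambda>D. flip D f) ` down_sets V f) \<le> card V"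
proof -
  have sk: "skew f" using q by (rule quiver_on_skew)
  have empty: "{} \<in> down_sets V f" using fin unfolding down_sets_def by auto
  then show fZ: "f \<in> ?Z" using image_iff[of f "\<lambda>D. flip D f" "down_sets V f"] by force
  show "finite ?Z" "card ?Z \<le> card V"
    using card_down_sets[OF fin(1) sk o] card_image_le[of "down_sets V f" "\<lambda>D. flip D f"] by auto
  show "exits_to_nodes V ?Z {}" unfolding exits_to_nodes_def
  proof (intro ballI impI)
    fix g v assume g: "g \<in> ?Z" and v: "v \<in> V"
    then obtain D where D: "g = flip D f" "D \<subset> V" "\<And>u w. u \<in> D \<Longrightarrow> w \<in> V \<Longrightarrow> f w u > 0 \<Longrightarrow> w \<in> D"
      unfolding down_sets_def by auto
    have qg: "quiver_on V g" and skg: "skew g" using quiver_on_flip[OF q] quiver_on_skew D(1) by auto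
    have og: "abundant_order V g" unfolding D(1) using abundant_order_flip[OF sk o] D(3) by blast
    have DV: "g w u > 0" if "w \<in> V - D" "u \<in> D" for w u
    proof -
      have "u \<in> V" "w \<in> V" "w \<noteq> u" "\<not> f w u > 0" using that D(2) D(3)[of u w] by auto
      then have "f u w \<ge> 2" by (intro abundant_order_total[OF sk o])
      then show ?thesis using that skewD[OF sk, of w u] unfolding D(1) by (simp add: flip_def)
    qed
    consider (mid) "\<exists>u\<in>V. g u v > 0" "\<exists>u\<in>V. g v u > 0" | (src) "\<forall>u\<in>V. \<not> g u v > 0"
      | (snk) "\<forall>u\<in>V. \<not> g v u > 0" by blast
    then show "mut v g \<in> ?Z \<or> child V ?Z (mut v g)"
    proof cases
      case mid
      then have "fork_on V (mut v g) v"
        using fork_on_mut[OF skg mutable_if_abundant_order[OF skg og v]] by blast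
      then show ?thesis using child_fork[OF qg g] by blast
    next
      case src
      obtain w where w: "w \<in> V - D" using D(2) by blast
      have "v \<notin> D" using DV[OF w, of v] src w by blast
      then have m: "mut v g = flip (insert v D) f"
        using mut_source[OF qg] src flip_singleton(1) D(1) by metis
      have closed: "w \<in> insert v D" if "u \<in> insert v D" "w \<in> V" "f w u > 0" for u w
      proof (cases "u = v")
        case True
        then show ?thesis using src that \<open>v \<notin> D\<close> unfolding D(1) by (force simp: flip_def)
      next
        case False
        then show ?thesis using D(3) that by auto
      qed
      show ?thesis
      proof (cases "insert v D = V")
        case True
        \<comment> \<open>The full turn is complete: flipping all of \<open>V\<close> is the
          identity.\<close>
        then show ?thesis using m flip_complement[OF q, of "{}"] fZ by simp
      next
        case False
        then have "insert v D \<subset> V" using D(2) v by blast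
        then have "insert v D \<in> down_sets V f" using closed by (rule down_setsI)
        then show ?thesis using m by auto
      qed
    next
      case snk
      show ?thesis
      proof (cases "v \<in> D")
        case True
        then have m: "mut v g = flip (D - {v}) f"
          using mut_source[OF qg] snk flip_singleton(2) D(1) by metis
        have "w \<in> D - {v}" if "u \<in> D - {v}" "w \<in> V" "f w u > 0" for u w
        proof -
          have "w \<noteq> v" using snk that True D(2) unfolding D(1) by (force simp: flip_def)
          then show ?thesis using D(3) that by auto
        qed
        moreover have "D - {v} \<subset> V" using D(2) by blast
        ultimately have "D - {v} \<in> down_sets V f" by (intro down_setsI)
        then show ?thesis using m by auto
      next
        case False
        \<comment> \<open>In \<open>g\<close> a vertex outside \<open>D\<close> has arrows to every
          vertex of \<open>D\<close>, so it can be a sink only if \<open>D\<close> is empty.\<close>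
        then have "D = {}" using DV[of v] snk v D(2) by blast
        then have gf: "g = f" using D(1) by simp
        then have m: "mut v g = flip (V - {v}) f"
          using mut_source[OF qg] snk flip_complement[OF q] by metis
        have "V - {v} \<subset> V" using v by blast
        then have "V - {v} \<in> down_sets V f" by (rule down_setsI) (use snk gf in auto)
        then show ?thesis using m by auto
      qed
    qed
  qed
qed

section \<open>Rotations of an order that contains a block\<close>

lemma order_block:
  assumes q: "quiver_on V f" and V: "k \<in> V" "k' \<in> V" "k \<noteq> k'" and tw: "twins V f k k'"
    and o: "abundant_order (V - {k}) f" "abundant_order (V - {k'}) f" and p: "f k k' = 0 \<or> f k k' = 1"
  shows "block V f k k'"
  using assms mutable_if_abundant_order[OF _ o(1), of k'] mutable_if_abundant_order[OF _ o(2), of k]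
  unfolding block_def quiver_on_def by auto

lemma twins_flip:
  assumes "skew f" "twins V f k k'" "k \<notin> D" "k' \<notin> D" shows "twins V (flip D f) k k'"
  unfolding twins_def
proof
  fix i assume i: "i \<in> V - {k, k'}"
  then have "f k i > 0 \<and> f k' i > 0 \<or> f i k > 0 \<and> f i k' > 0" using assms(2) unfolding twins_def by blast
  then show "flip D f k i > 0 \<and> flip D f k' i > 0 \<or> flip D f i k > 0 \<and> flip D f i k' > 0"
    using assms skewD[OF assms(1), of k i] skewD[OF assms(1), of k' i] by (auto simp: flip_def)
qed

text \<open>A normal form with the block in the last position. Flipping initial segments of the
  remaining vertices then moves the block to the other positions.\<close>

locale last_block = block +
  assumes fin: "finite V" and ne: "V - {k, k'} \<noteq> {}"
    and ords: "abundant_order (V - {k}) f" "abundant_order (V - {k'}) f"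
    and last: "C = {}"
begin

definition "rotations = (\<Union>D\<in>down_sets (V - {k, k'}) f. orbit k k' (flip D f))"

lemma quiver: "quiver_on V f"
  using sk supp unfolding quiver_on_def by blast

lemma X_A: "V - {k, k'} = A"
  using vertices_eq(3) last by simp

text \<open>The flipped order begins with the vertices outside \<open>D\<close>, continues with the
  block and ends with \<open>D\<close>.\<close>

lemma flip_block:
  assumes D: "D \<in> down_sets (V - {k, k'}) f"
  shows "block V (flip D f) k k'"
    and "block.A V (flip D f) k k' = V - {k, k'} - D" "block.C V (flip D f) k k' = D"
    and "abundant_order (V - {k}) (flip D f)" "abundant_order (V - {k'}) (flip D f)"
proof -
  have DX: "D \<subset> V - {k, k'}" and cl: "\<And>u w. u \<in> D \<Longrightarrow> w \<in> V - {k, k'} \<Longrightarrow> f w u > 0 \<Longrightarrow> w \<in> D"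
    using D unfolding down_sets_def by auto
  have kD: "k \<notin> D" "k' \<notin> D" using DX by auto
  have A: "f u k > 0" "f u k' > 0" "f k u < 0" "f k' u < 0" if "u \<in> V - {k, k'}" for u
    using inA(4-7)[of u] that X_A by auto
  show o: "abundant_order (V - {k}) (flip D f)"
  proof (rule abundant_order_flip[OF sk ords(1)])
    fix u w assume "u \<in> D" "w \<in> V - {k}" "f w u > 0"
    then show "w \<in> D" using cl[of u w] A(4)[of u] DX by (cases "w = k'") auto
  qed
  show o': "abundant_order (V - {k'}) (flip D f)"
  proof (rule abundant_order_flip[OF sk ords(2)])
    fix u w assume "u \<in> D" "w \<in> V - {k'}" "f w u > 0"
    then show "w \<in> D" using cl[of u w] A(3)[of u] DX by (cases "w = k") auto
  qed
  show b: "block V (flip D f) k k'"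
    using order_block[OF quiver_on_flip[OF quiver] kV twins_flip[OF sk tw kD] o o'] small kD
    by (simp add: flip_def)
  show "block.A V (flip D f) k k' = V - {k, k'} - D"
    unfolding block.A_def[OF b] using A kD by (force simp: flip_def)
  show "block.C V (flip D f) k k' = D"
  proof -
    have "flip D f k i > 0 \<longleftrightarrow> i \<in> D" if "i \<in> V - {k, k'}" for i
      using A(3)[OF that] kD by (simp add: flip_def)
    then show ?thesis unfolding block.C_def[OF b] using DX by blast
  qed
qed

lemma rotations_orbit:
  assumes "g \<in> rotations" shows "mut k g \<in> rotations" "mut k' g \<in> rotations" "quiver_on V g"
    and "\<bar>g k k'\<bar> = \<bar>f k k'\<bar>"
    and "\<bar>g k k'\<bar> = 1 \<Longrightarrow> swap_arr k k' g \<in> rotations"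
proof -
  obtain D where D: "D \<in> down_sets (V - {k, k'}) f" "g \<in> orbit k k' (flip D f)"
    using assms unfolding rotations_def by auto
  interpret D: block V "flip D f" k k' using flip_block(1)[OF D(1)] .
  show "mut k g \<in> rotations" "mut k' g \<in> rotations"
    using D(1) orbit_mut[OF D(2)] unfolding rotations_def by blast+
  show "quiver_on V g" using quiver_on_orbit[OF quiver_on_flip[OF quiver] D(2)] .
  have "k \<notin> D" "k' \<notin> D" using D(1) unfolding down_sets_def by auto
  then show arrows: "\<bar>g k k'\<bar> = \<bar>f k k'\<bar>" using orbit_arrows[OF D.sk D(2)] by (simp add: flip_def)
  assume "\<bar>g k k'\<bar> = 1"
  then have "flip D f k k' = 1" using orbit_arrows[OF D.sk D(2)] D.small by auto
  then have "swap_arr k k' g \<in> orbit k k' (flip D f)"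
    using orbit_trans[OF D.orbit_1(2) orbit_swap[OF D(2)]] by blast
  then show "swap_arr k k' g \<in> rotations" using D(1) unfolding rotations_def by blast
qed

lemma flip_rotations:
  assumes "D \<in> down_sets (V - {k, k'}) f" shows "flip D f \<in> rotations"
proof -
  have "flip D f \<in> orbit k k' (flip D f)" by (rule orbit_refl)
  then show ?thesis using assms unfolding rotations_def by blast
qed

lemma empty_down: "{} \<in> down_sets (V - {k, k'}) f"
  using ne unfolding down_sets_def by auto

text \<open>First \<open>k'\<close> and then \<open>k\<close> is a sink when it is mutated, so two
  mutations inside the orbit of \<open>f\<close> carry the block from the last to the first
  position.\<close>

lemma flip_all_rotations: "flip (V - {k, k'}) f \<in> rotations"
proof -
  have "t2 \<in> orbit k k' (flip {} f)"
    using orbit_mut(1)[OF orbit_mut(2)[OF orbit_refl]] by simp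
  then have "t2 \<in> rotations" unfolding rotations_def by (rule UN_I[OF empty_down])
  then show ?thesis using t2_no_after[OF last] by simp
qed

text \<open>At \<open>flip D f\<close> itself the block acts like a single vertex of a rotating
  order. At the other stages only the exception of \<open>exits\<close> avoids forks and pre-forks:
  there \<open>D\<close> is empty, the block stands first and \<open>v\<close> last, and moving
  \<open>v\<close> to the front is the flip by all vertices of \<open>V - {k, k'}\<close> except
  \<open>v\<close>.\<close>

lemma states_exit:
  assumes D: "D \<in> down_sets (V - {k, k'}) f" and g: "g \<in> block.states (flip D f) k k'"
    and v: "v \<in> V - {k, k'}"
  shows "fork_on V (mut v g) v \<or> prefork_on V (mut v g) v k k' \<or> mut v g \<in> rotations"
proof -
  interpret D: block V "flip D f" k k' using flip_block(1)[OF D] .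
  have DX: "D \<subset> V - {k, k'}" and cl: "\<And>u w. u \<in> D \<Longrightarrow> w \<in> V - {k, k'} \<Longrightarrow> f w u > 0 \<Longrightarrow> w \<in> D"
    using D unfolding down_sets_def by auto
  have kD: "k \<notin> D" "k' \<notin> D" using DX by auto
  have A: "f u k > 0" "f k u < 0" "f u k' > 0" if "u \<in> V - {k, k'}" for u
    using inA(4-6)[of u] that X_A by auto
  have qD: "quiver_on V (flip D f)" using quiver_on_flip[OF quiver] .
  show ?thesis
  proof (cases "g = flip D f")
    case True
    consider (mid) "\<exists>u\<in>V. g u v > 0" "\<exists>u\<in>V. g v u > 0" | (src) "\<forall>u\<in>V. \<not> g u v > 0"
      | (snk) "\<forall>u\<in>V. \<not> g v u > 0" by blast
    then show ?thesis
    proof cases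
      case mid
      have "mutable (V - {k}) (flip D f) v" "mutable (V - {k'}) (flip D f) v"
        using mutable_if_abundant_order[OF D.sk] flip_block(4,5)[OF D] v by auto
      then show ?thesis using prefork_on_mut[OF D.sk kV D.tw] mid True by blast
    next
      case src
      have "v \<in> D \<Longrightarrow> flip D f k v > 0" using A(2)[OF v] kD by (simp add: flip_def)
      then have "v \<notin> D" using src kV(1) unfolding True by blast
      then have m: "mut v g = flip (insert v D) f"
        using mut_source[OF qD] src flip_singleton(1) True by metis
      have "w \<in> insert v D" if "u \<in> insert v D" "w \<in> V - {k, k'}" "f w u > 0" for u w
      proof (cases "u = v")
        case True
        then show ?thesis using src that \<open>v \<notin> D\<close> unfolding \<open>g = flip D f\<close> by (force simp: flip_def)
      next
        case False
        then show ?thesis using cl that by auto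
      qed
      moreover have "insert v D = V - {k, k'} \<or> insert v D \<subset> V - {k, k'}" using DX v by blast
      ultimately have "insert v D = V - {k, k'} \<or> insert v D \<in> down_sets (V - {k, k'}) f"
        using down_setsI[of "insert v D" "V - {k, k'}" f] by blast
      then show ?thesis using m flip_rotations flip_all_rotations by auto
    next
      case snk
      have "v \<notin> D \<Longrightarrow> flip D f v k > 0" using A(1)[OF v] kD by (simp add: flip_def)
      then have "v \<in> D" using snk kV(1) unfolding True by blast
      then have m: "mut v g = flip (D - {v}) f"
        using mut_source[OF qD] snk flip_singleton(2) True by metis
      have "w \<in> D - {v}" if "u \<in> D - {v}" "w \<in> V - {k, k'}" "f w u > 0" for u w
      proof -
        have "w \<noteq> v" using snk that \<open>v \<in> D\<close> DX unfolding True by (force simp: flip_def)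
        then show ?thesis using cl that by auto
      qed
      moreover have "D - {v} \<subset> V - {k, k'}" using DX by blast
      ultimately have "D - {v} \<in> down_sets (V - {k, k'}) f" by (intro down_setsI)
      then show ?thesis using m flip_rotations by auto
    qed
  next
    case False
    have ne': "D.A \<noteq> {}" using flip_block(2)[OF D] DX by auto
    have "g \<in> {D.s1, D.s2, D.t1, D.t2}" using g False unfolding D.states_def by auto
    then consider "fork_on V (mut v g) v" | "prefork_on V (mut v g) v k k'"
      | (rot) "D.C = {}" "g = flip (V - {k, k'}) (flip D f)" "\<forall>u\<in>V - {k, k'}. \<not> flip D f v u > 0"
      using D.exits(1)[OF ne' v] by blast
    then show ?thesis
    proof cases
      case rot
      then have "D = {}" using flip_block(3)[OF D] by simp
      then have g: "g = flip (V - {k, k'}) f" and snk: "\<And>u. u \<in> V - {k, k'} \<Longrightarrow> \<not> f v u > 0"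
        using rot by auto
      have "\<not> g v u > 0" if "u \<in> V" for u
      proof (cases "u \<in> V - {k, k'}")
        case True
        then show ?thesis using snk[OF True] v unfolding g by (simp add: flip_def)
      next
        case False
        then have "u = k \<or> u = k'" using that by blast
        then have "g v u = - f v u" using v unfolding g by (auto simp: flip_def)
        then show ?thesis using A(1,3)[OF v] \<open>u = k \<or> u = k'\<close> by auto
      qed
      then have "mut v g = flip (V - {k, k'} - {v}) f"
        using mut_source[of V g v] flip_singleton(2)[OF v] quiver_on_flip[OF quiver] unfolding g by metis
      moreover have "V - {k, k'} - {v} \<in> down_sets (V - {k, k'}) f"
        by (rule down_setsI) (use snk v in auto)
      ultimately show ?thesis using flip_rotations by metis
    qed auto
  qed
qed

lemma rotations_exits: "exits_to_nodes V rotations {}"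
  unfolding exits_to_nodes_def
proof (intro ballI impI)
  fix g v assume g: "g \<in> rotations" and v: "v \<in> V"
  obtain D where D: "D \<in> down_sets (V - {k, k'}) f" "g \<in> orbit k k' (flip D f)"
    using g unfolding rotations_def by auto
  interpret D: block V "flip D f" k k' using flip_block(1)[OF D(1)] .
  have goal: "mut v g \<in> rotations \<or> child V rotations (mut v g)"
    if "fork_on V (mut v g) v \<or> prefork_on V (mut v g) v k k' \<or> mut v g \<in> rotations"
    using that child_fork[OF rotations_orbit(3)[OF g] g] child_prefork[OF rotations_orbit(3)[OF g] g]
      rotations_orbit(5)[OF g] by blast
  show "mut v g \<in> rotations \<or> child V rotations (mut v g)"
  proof (cases "v \<in> {k, k'}")
    case True
    then show ?thesis using rotations_orbit(1,2)[OF g] by auto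
  next
    case False
    then have vX: "v \<in> V - {k, k'}" using v by auto
    consider (s) "g \<in> D.states" | (t) h where "g = swap_arr k k' h" "h \<in> D.states" "flip D f k k' = 1"
      using D(2) D.orbit_1(1) D.orbit_0 D.small by blast
    then have "fork_on V (mut v g) v \<or> prefork_on V (mut v g) v k k' \<or> mut v g \<in> rotations"
    proof cases
      case s
      then show ?thesis using states_exit[OF D(1) _ vX] by blast
    next
      case t
      have m: "mut v g = swap_arr k k' (mut v h)" using t(1) vX mut_swap_arrs(3)[of v k k' h] by simp
      have "\<bar>f k k'\<bar> = 1" using orbit_arrows[OF D.sk D(2)] rotations_orbit(4)[OF g] t(3) by simp
      then have "mut v h \<in> rotations \<Longrightarrow> mut v g \<in> rotations"
        using rotations_orbit(4,5)[of "mut v h"] m by simp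
      then show ?thesis
        using states_exit[OF D(1) t(2) vX] fork_on_swap(1)[OF kV(1,2), of v "mut v h"]
          prefork_on_swap[of V "mut v h" v k k'] vX unfolding m by auto
    qed
    then show ?thesis by (rule goal)
  qed
qed

lemma rotations_card: "finite rotations" "card rotations \<le> 10 * (card V - 2)"
proof -
  have oX: "abundant_order (V - {k, k'}) f" by (rule abundant_order_subset[OF ords(1)]) blast
  have fX: "finite (V - {k, k'})" using fin by simp
  note d = card_down_sets[OF fX sk oX]
  have orb: "finite (orbit k k' (flip D f))" "card (orbit k k' (flip D f)) \<le> 10"
    if "D \<in> down_sets (V - {k, k'}) f" for D
    using block.orbit_finite[OF flip_block(1)[OF that]] by auto
  show "finite rotations" unfolding rotations_def using d(1) orb(1) by blast
  have "card rotations \<le> (\<Sum>D\<in>down_sets (V - {k, k'}) f. card (orbit k k' (flip D f)))"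
    unfolding rotations_def by (rule card_UN_le[OF d(1)])
  also have "\<dots> \<le> (\<Sum>D\<in>down_sets (V - {k, k'}) f. 10)" using orb(2) by (rule sum_mono)
  also have "\<dots> \<le> 10 * card (V - {k, k'})" using d(2) by simp
  also have "card (V - {k, k'}) = card V - 2"
    using kV fin by (simp add: card_Diff_subset)
  finally show "card rotations \<le> 10 * (card V - 2)" .
qed

end

text \<open>This is what remains of a pre-fork in a full subquiver that contains \<open>k\<close>
  and \<open>k'\<close> but loses \<open>r\<close> or one side of \<open>r\<close>. Two or more
  arrows between \<open>k\<close> and \<open>k'\<close> lead back to the first disjunct.\<close>

definition almost_order :: "'a set \<Rightarrow> ('a \<Rightarrow> 'a \<Rightarrow> int) \<Rightarrow> bool" where
  "almost_order V f \<longleftrightarrow> abundant_order V f \<or>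
     (\<exists>k\<in>V. \<exists>k'\<in>V. k \<noteq> k' \<and> twins V f k k' \<and>
        abundant_order (V - {k}) f \<and> abundant_order (V - {k'}) f)"

text \<open>Flipping \<open>C\<close> brings the vertices behind the block to the front. The result
  \<open>g\<close> has its block in the last position, and \<open>f\<close> is one of its
  rotations.\<close>

lemma block_rotations:
  assumes q: "quiver_on V f" and V: "k \<in> V" "k' \<in> V" "k \<noteq> k'" and tw: "twins V f k k'"
    and o: "abundant_order (V - {k}) f" "abundant_order (V - {k'}) f" and p: "f k k' = 0 \<or> f k k' = 1"
    and fin: "finite V" "3 \<le> card V"
  shows "\<exists>Z. exits_to_nodes V Z {} \<and> f \<in> Z \<and> finite Z \<and> card Z \<le> 10 * (card V - 2)"
proof -
  interpret block V f k k' using order_block[OF q V tw o p] .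
  define g where "g = flip C f"
  have CV: "C \<subseteq> V - {k, k'}" "k \<notin> C" "k' \<notin> C" unfolding C_def by auto
  \<comment> \<open>\<open>C\<close> is a final segment of \<open>f\<close>; its complement is an
    initial segment, as \<open>abundant_order_flip\<close> demands.\<close>
  have gc: "g = flip (V - C) f" unfolding g_def using flip_complement[OF q] by simp
  have AC: "f w u > 0" if "w \<in> A" "u \<in> C" for w u
    using abundant_orderD(2)[OF o(2), of w k u] inA(1-4)[OF that(1)] inC(1-4)[OF that(2)] V by auto
  have up: "u \<in> C" if "w \<in> C" "u \<in> V" "u \<notin> {k, k'}" "f w u > 0" for u w
    using A_or_C[of u] AC[OF _ that(1), of u] skewD[OF sk, of u w] that by auto
  have og: "abundant_order (V - {k}) g" unfolding gc
  proof (rule abundant_order_flip[OF sk o(1)])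
    fix u w assume h: "u \<in> V - {k}" "u \<in> V - C" "w \<in> V - {k}" "f w u > 0"
    then show "w \<in> V - C" using up[of w u] inC(5,7)[of w] by (cases "u = k'") auto
  qed
  have og': "abundant_order (V - {k'}) g" unfolding gc
  proof (rule abundant_order_flip[OF sk o(2)])
    fix u w assume h: "u \<in> V - {k'}" "u \<in> V - C" "w \<in> V - {k'}" "f w u > 0"
    then show "w \<in> V - C" using up[of w u] inC(4,6)[of w] by (cases "u = k") auto
  qed
  have qg: "quiver_on V g" and skg: "skew g" unfolding g_def using quiver_on_flip[OF q] sk by auto
  have twg: "twins V g k k'" unfolding g_def using twins_flip[OF sk tw CV(2,3)] .
  have pg: "g k k' = 0 \<or> g k k' = 1" using p CV unfolding g_def by (simp add: flip_def)
  have bg: "block V g k k'" using order_block[OF qg V twg og og' pg] .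
  have X: "V - {k, k'} \<noteq> {}"
  proof
    assume "V - {k, k'} = {}"
    then have "card V \<le> card {k, k'}" by (intro card_mono) auto
    then show False using fin(2) V(3) by simp
  qed
  have kg: "\<not> g k u > 0" if "u \<in> V - {k, k'}" for u
    using A_or_C[OF that] inA(6,4)[of u] inC(4)[of u] CV vertices_eq(2) unfolding g_def by (auto simp: flip_def)
  have last: "block.C V g k k' = {}" unfolding block.C_def[OF bg] using kg by auto
  interpret L: last_block V g k k'
    unfolding last_block_def last_block_axioms_def using bg fin(1) X og og' last by auto
  have fg: "f = flip C g" unfolding g_def by simp
  have "f \<in> L.rotations"
  proof (cases "C = V - {k, k'}")
    case True
    then show ?thesis using L.flip_all_rotations fg by simp
  next
    case False
    have "w \<in> C" if "u \<in> C" "w \<in> V - {k, k'}" "g w u > 0" for u w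
      using A_or_C[OF that(2)] AC[of w u] that vertices_eq(2) unfolding g_def by (auto simp: flip_def)
    moreover have "C \<subset> V - {k, k'}" using CV False by blast
    ultimately have "C \<in> down_sets (V - {k, k'}) g" by (intro down_setsI)
    then show ?thesis using L.flip_rotations fg by metis
  qed
  then show ?thesis using L.rotations_exits L.rotations_card by blast
qed

lemma almost_order_exits:
  assumes q: "quiver_on V f" and f: "almost_order V f" and fin: "finite V" "3 \<le> card V"
  shows "\<exists>Z. exits_to_nodes V Z {} \<and> f \<in> Z \<and> finite Z \<and> card Z \<le> 10 * (card V - 2)"
proof -
  have sk: "skew f" using q by (rule quiver_on_skew)
  have 1: ?thesis if o: "abundant_order V f"
  proof -
    have "V \<noteq> {}" using fin by auto
    note oe = order_exits[OF q fin(1) this o]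
    \<comment> \<open>Three is the least number m of vertices for which the m rotations of an order
      fit into the bound 10m - 20.\<close>
    have "card V \<le> 10 * (card V - 2)" using fin(2) by simp
    then show ?thesis using oe le_trans by blast
  qed
  show ?thesis
  proof (cases "abundant_order V f")
    case False
    then obtain k k' where V: "k \<in> V" "k' \<in> V" "k \<noteq> k'" and tw: "twins V f k k'"
      and o: "abundant_order (V - {k}) f" "abundant_order (V - {k'}) f"
      using f unfolding almost_order_def by blast
    consider "2 \<le> \<bar>f k k'\<bar>" | "f k k' = 0 \<or> f k k' = 1" | "f k' k = 0 \<or> f k' k = 1"
      using skewD[OF sk, of k k'] by force
    then show ?thesis
    proof cases
      case 1
      then show ?thesis using abundant_order_twins[OF sk o tw] False by blast
    next
      case 2
      then show ?thesis using block_rotations[OF q V tw o _ fin] by blast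
    next
      case 3
      then show ?thesis
        using block_rotations[OF q V(2,1) V(3)[symmetric] _ o(2,1) _ fin] tw twins_commute[of V f k k'] by blast
    qed
  qed (rule 1)
qed

section \<open>Quivers and their mutation classes\<close>

text \<open>By abundance a failure of transitivity closes a cycle of length three. Conversely a
  transitive irreflexive relation is its own transitive closure.\<close>

lemma acyclic_iff_abundant_order:
  assumes sk: "skew f" and ab: "\<And>a b. a \<in> S \<Longrightarrow> b \<in> S \<Longrightarrow> a \<noteq> b \<Longrightarrow> \<bar>f a b\<bar> \<ge> 2"
  shows "acyclic {(i, j). i \<in> S \<and> j \<in> S \<and> f i j > 0} \<longleftrightarrow> abundant_order S f" (is "acyclic ?r \<longleftrightarrow> _")
proof
  assume ac: "acyclic ?r"
  show "abundant_order S f"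
  proof (rule abundant_orderI)
    show "\<bar>f a b\<bar> \<ge> 2" if "a \<in> S" "b \<in> S" "a \<noteq> b" for a b using ab that .
    fix a b c assume h: "a \<in> S" "b \<in> S" "c \<in> S" "f a b > 0" "f b c > 0"
    then have "(a, b) \<in> ?r" "(b, c) \<in> ?r" by auto
    then have abc: "(a, c) \<in> ?r\<^sup>+" by (meson r_into_trancl' trancl.trancl_into_trancl)
    show "f a c > 0"
    proof (rule ccontr)
      assume n: "\<not> f a c > 0"
      have "a \<noteq> c" using abc ac unfolding acyclic_def by blast
      then have "f c a > 0" using ab[OF h(1,3)] n skewD[OF sk, of a c] by auto
      then have "(a, a) \<in> ?r\<^sup>+" using abc h by (intro trancl_into_trancl[OF abc]) auto
      then show False using ac unfolding acyclic_def by blast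
    qed
  qed
next
  assume o: "abundant_order S f"
  have "trans ?r"
  proof (rule transI)
    fix a b c assume "(a, b) \<in> ?r" "(b, c) \<in> ?r"
    then show "(a, c) \<in> ?r" using abundant_orderD(2)[OF o, of a b c] by simp
  qed
  moreover have "(a, a) \<notin> ?r" for a using sk by simp
  ultimately show "acyclic ?r" unfolding acyclic_def by (simp add: trancl_id)
qed

lemma quiver_collapse [simp]: "\<lparr>verts = verts Q, arr = arr Q\<rparr> = (Q :: 'a quiver)"
  by simp

lemma mutate_eq: "mutate v Q = \<lparr>verts = verts Q, arr = mut v (arr Q)\<rparr>"
  by (simp add: mutate_def mut_def)

lemma mutate_simps [simp]: "verts (mutate v Q) = verts Q" "arr (mutate v Q) = mut v (arr Q)"
  by (simp_all add: mutate_eq)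

lemma is_quiver_iff: "is_quiver Q \<longleftrightarrow> finite (verts Q) \<and> quiver_on (verts Q) (arr Q)"
  unfolding is_quiver_def quiver_on_def skew_def by blast

lemma is_quiver_skew: "is_quiver Q \<Longrightarrow> skew (arr Q)"
  unfolding is_quiver_iff quiver_on_def by blast

lemma is_quiver_mutate: "is_quiver Q \<Longrightarrow> is_quiver (mutate v Q)"
  unfolding is_quiver_iff by (simp add: quiver_on_mut)

lemma mutate_mutate: "is_quiver Q \<Longrightarrow> mutate v (mutate v Q) = Q"
  using is_quiver_skew[of Q] by (simp add: mutate_eq)

section \<open>Full subquivers, and agreement with the defined forks and pre-forks\<close>

definition restrict_arr :: "'a set \<Rightarrow> ('a \<Rightarrow> 'a \<Rightarrow> int) \<Rightarrow> 'a \<Rightarrow> 'a \<Rightarrow> int" where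
  "restrict_arr W f = (\<lambda>i j. if i \<in> W \<and> j \<in> W then f i j else 0)"

lemma induced_eq: "induced Q W = \<lparr>verts = verts Q \<inter> W, arr = restrict_arr (verts Q \<inter> W) (arr Q)\<rparr>"
  by (simp add: induced_def restrict_arr_def)

lemma induced_simps [simp]:
  "verts (induced Q W) = verts Q \<inter> W" "arr (induced Q W) = restrict_arr (verts Q \<inter> W) (arr Q)"
  by (simp_all add: induced_eq)

lemma quiver_on_restrict:
  assumes "quiver_on V f" shows "quiver_on W (restrict_arr W f)"
proof -
  have "skew (restrict_arr W f)" unfolding skew_def
  proof (intro allI)
    fix i j show "restrict_arr W f j i = - restrict_arr W f i j"
      using skewD[OF quiver_on_skew[OF assms], of i j] by (simp add: restrict_arr_def)
  qed
  then show ?thesis unfolding quiver_on_def by (auto simp: restrict_arr_def)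
qed

lemma is_quiver_induced: "is_quiver Q \<Longrightarrow> is_quiver (induced Q W)"
  unfolding is_quiver_iff by (auto intro: quiver_on_restrict)

lemma mut_restrict: "v \<in> W \<Longrightarrow> mut v (restrict_arr W f) = restrict_arr W (mut v f)"
  by (intro ext) (auto simp: mut_def restrict_arr_def)

lemma acyclic_induced:
  assumes "is_quiver F" and "\<And>a b. a \<in> S \<Longrightarrow> b \<in> S \<Longrightarrow> a \<noteq> b \<Longrightarrow> \<bar>arr F a b\<bar> \<ge> 2" and "S \<subseteq> verts F"
  shows "acyclic_quiver (induced F S) \<longleftrightarrow> abundant_order S (arr F)"
proof -
  have "{(i, j). i \<in> verts (induced F S) \<and> j \<in> verts (induced F S) \<and> arr (induced F S) i j > 0}
    = {(i, j). i \<in> S \<and> j \<in> S \<and> arr F i j > 0}"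
    using assms(3) by (auto simp: restrict_arr_def)
  then show ?thesis
    unfolding acyclic_quiver_def using acyclic_iff_abundant_order[OF is_quiver_skew[OF assms(1)]] assms(2)
    by simp
qed

lemma acyclic_quiver_iff:
  assumes "is_quiver F" "abundant F" shows "acyclic_quiver F \<longleftrightarrow> abundant_order (verts F) (arr F)"
  unfolding acyclic_quiver_def using acyclic_iff_abundant_order[OF is_quiver_skew[OF assms(1)]] assms(2)
  unfolding abundant_def by blast

text \<open>With \<open>I\<close> and \<open>J\<close> the in- and out-neighbours of
  \<open>r\<close>, the unions \<open>J \<union> I\<close>, \<open>{r} \<union> J\<close> and
  \<open>I \<union> {r}\<close> are ordered. If the fork shape is lost, \<open>U\<close> misses
  \<open>r\<close>, \<open>I\<close> or \<open>J\<close> and lies in one of them.\<close>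

lemma fork_on_subset:
  assumes sk: "skew f" and F: "fork_on V f r" and U: "U \<subseteq> V"
  shows "if r \<in> U \<and> (\<exists>i\<in>U. f i r > 0) \<and> (\<exists>j\<in>U. f r j > 0) then fork_on U f r else abundant_order U f"
proof -
  define I where "I = {i\<in>V. f i r > 0}"
  define J where "J = {j\<in>V. f r j > 0}"
  have near: "\<And>u. u \<in> V \<Longrightarrow> u \<noteq> r \<Longrightarrow> \<bar>f u r\<bar> \<ge> 2"
    and I: "abundant_order I f" and J: "abundant_order J f"
    and big: "\<And>i j. i \<in> I \<Longrightarrow> j \<in> J \<Longrightarrow> f j i > f i r \<and> f j i > f r j"
    using F unfolding fork_on_def I_def J_def by auto
  have nearI: "2 \<le> f i r" if "i \<in> I" for i
    using near[of i] that skew_diag[OF sk, of r] unfolding I_def by fastforce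
  have nearJ: "2 \<le> f r j" if "j \<in> J" for j
  proof -
    have "j \<noteq> r" using that skew_diag[OF sk, of r] unfolding J_def by auto
    then show ?thesis using near[of j] that skewD[OF sk, of j r] unfolding J_def by auto
  qed
  have V: "u = r \<or> u \<in> I \<or> u \<in> J" if "u \<in> V" for u
    using near[OF that] that skewD[OF sk, of u r] unfolding I_def J_def by force
  have JI: "abundant_order (J \<union> I) f"
  proof (rule abundant_order_Un[OF sk J I])
    fix a b assume "a \<in> J" "b \<in> I"
    then show "f a b \<ge> 2" using big[of b a] nearI[of b] by auto
  qed
  have rJ: "abundant_order ({r} \<union> J) f" and Ir: "abundant_order (I \<union> {r}) f"
    using abundant_order_Un[OF sk _ J, of "{r}"] abundant_order_Un[OF sk I, of "{r}"] nearI nearJ by auto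
  show ?thesis
  proof (cases "r \<in> U \<and> (\<exists>i\<in>U. f i r > 0) \<and> (\<exists>j\<in>U. f r j > 0)")
    case True
    have "abundant_order {i\<in>U. f i r > 0} f" "abundant_order {j\<in>U. f r j > 0} f"
      by (rule abundant_order_subset[OF I] abundant_order_subset[OF J], use U in \<open>auto simp: I_def J_def\<close>)+
    moreover have "f j i > f i r \<and> f j i > f r j" if "i \<in> U" "j \<in> U" "f i r > 0" "f r j > 0" for i j
      using big[of i j] that U unfolding I_def J_def by auto
    ultimately have "fork_on U f r" using True near U unfolding fork_on_def by blast
    then show ?thesis using True by simp
  next
    case False
    then consider "r \<notin> U" | "U \<inter> I = {}" | "U \<inter> J = {}" unfolding I_def J_def by blast
    then have "U \<subseteq> J \<union> I \<or> U \<subseteq> {r} \<union> J \<or> U \<subseteq> I \<union> {r}"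
      using V U by cases blast+
    then show ?thesis using False JI rJ Ir abundant_order_subset by auto
  qed
qed

lemma fork_or_order_subset:
  assumes "skew f" "fork_or_order V f" "U \<subseteq> V" shows "fork_or_order U f"
  using assms(2) unfolding fork_or_order_def
proof
  assume "abundant_order V f"
  then show "abundant_order U f \<or> (\<exists>r. fork_on U f r)" using abundant_order_subset assms(3) by blast
next
  assume "\<exists>r. fork_on V f r"
  then obtain r where "fork_on V f r" by blast
  then show "abundant_order U f \<or> (\<exists>r. fork_on U f r)"
    using fork_on_subset[OF assms(1) _ assms(3)] by (metis (full_types))
qed

lemma fork_on_not_order:
  assumes sk: "skew f" and F: "fork_on V f r" shows "\<not> abundant_order V f"
proof
  assume o: "abundant_order V f"
  obtain i j where ij: "i \<in> V" "j \<in> V" "f i r > 0" "f r j > 0" "f j i > f i r"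
    using F unfolding fork_on_def by blast
  then have "f i j > 0" using abundant_orderD(2)[OF o, of i r j] F unfolding fork_on_def by blast
  then show False using ij skewD[OF sk, of i j] by simp
qed

lemma fork_on_abundant:
  assumes sk: "skew f" and F: "fork_on V f r" and ab: "a \<in> V" "b \<in> V" "a \<noteq> b"
  shows "\<bar>f a b\<bar> \<ge> 2"
proof -
  have m: "mutable V f v" if "v \<in> V" "v \<noteq> r" for v using fork_on_mutable(1)[OF sk F that] .
  show ?thesis
  proof (cases "b = r")
    case True
    then show ?thesis using F ab unfolding fork_on_def by blast
  next
    case False
    show ?thesis using mutableD(2)[OF m[OF ab(2) False] ab(1,3)] .
  qed
qed

text \<open>If one side of \<open>r\<close> were empty, \<open>r\<close> would be a source or sink
  added to an acyclic quiver, and the whole would be acyclic. Conversely vertices on the two sides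
  of \<open>r\<close> form a cycle of length three with it.\<close>

lemma fork_iff: "fork F r \<longleftrightarrow> is_quiver F \<and> fork_on (verts F) (arr F) r"
proof
  assume F: "fork F r"
  let ?V = "verts F" and ?f = "arr F"
  have q: "is_quiver F" and ab: "abundant F" and nac: "\<not> acyclic_quiver F" and r: "r \<in> verts F"
    and big: "\<And>i j. i \<in> in_nbrs F r \<Longrightarrow> j \<in> out_nbrs F r \<Longrightarrow> ?f j i > ?f i r \<and> ?f j i > ?f r j"
    and ac: "acyclic_quiver (induced F (in_nbrs F r))" "acyclic_quiver (induced F (out_nbrs F r))"
    using F unfolding fork_def by auto
  have sk: "skew ?f" using is_quiver_skew[OF q] .
  have near: "\<bar>?f a b\<bar> \<ge> 2" if "a \<in> ?V" "b \<in> ?V" "a \<noteq> b" for a b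
    using ab that unfolding abundant_def by blast
  have sub: "in_nbrs F r \<subseteq> ?V" "out_nbrs F r \<subseteq> ?V" unfolding in_nbrs_def out_nbrs_def by auto
  have I: "abundant_order (in_nbrs F r) ?f"
    using acyclic_induced[OF q _ sub(1)] ac(1) near sub(1) by blast
  have J: "abundant_order (out_nbrs F r) ?f"
    using acyclic_induced[OF q _ sub(2)] ac(2) near sub(2) by blast
  have no: "\<not> abundant_order ?V ?f" using acyclic_quiver_iff[OF q ab] nac by simp
  have V: "u = r \<or> u \<in> in_nbrs F r \<or> u \<in> out_nbrs F r" if "u \<in> ?V" for u
    using near[OF that r] that skewD[OF sk, of u r] unfolding in_nbrs_def out_nbrs_def by force
  have "in_nbrs F r \<noteq> {}"
  proof
    assume e: "in_nbrs F r = {}"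
    have "?f r j \<ge> 2" if "j \<in> out_nbrs F r" for j
      using near[OF r, of j] that sk unfolding out_nbrs_def by (cases "j = r") auto
    then have "abundant_order ({r} \<union> out_nbrs F r) ?f"
      by (intro abundant_order_Un[OF sk _ J]) auto
    moreover have "?V \<subseteq> {r} \<union> out_nbrs F r" using V e by auto
    ultimately show False using no abundant_order_subset by blast
  qed
  moreover have "out_nbrs F r \<noteq> {}"
  proof
    assume e: "out_nbrs F r = {}"
    have "?f j r \<ge> 2" if "j \<in> in_nbrs F r" for j
      using near[OF _ r, of j] that sk unfolding in_nbrs_def by (cases "j = r") auto
    then have "abundant_order (in_nbrs F r \<union> {r}) ?f"
      by (intro abundant_order_Un[OF sk I]) auto
    moreover have "?V \<subseteq> in_nbrs F r \<union> {r}" using V e by auto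
    ultimately show False using no abundant_order_subset by blast
  qed
  moreover have "\<And>u. u \<in> ?V \<Longrightarrow> u \<noteq> r \<Longrightarrow> \<bar>?f u r\<bar> \<ge> 2" using near r by blast
  ultimately have "fork_on ?V ?f r"
    using r I J big unfolding fork_on_def in_nbrs_def out_nbrs_def by auto
  then show "is_quiver F \<and> fork_on ?V ?f r" using q by simp
next
  let ?V = "verts F" and ?f = "arr F"
  assume "is_quiver F \<and> fork_on ?V ?f r"
  then have q: "is_quiver F" and F: "fork_on ?V ?f r" by auto
  have sk: "skew ?f" using is_quiver_skew[OF q] .
  have near: "\<bar>?f a b\<bar> \<ge> 2" if "a \<in> ?V" "b \<in> ?V" "a \<noteq> b" for a b
    using fork_on_abundant[OF sk F that] .
  then have ab: "abundant F" unfolding abundant_def by blast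
  have "\<not> acyclic_quiver F" using acyclic_quiver_iff[OF q ab] fork_on_not_order[OF sk F] by simp
  moreover have sub: "in_nbrs F r \<subseteq> ?V" "out_nbrs F r \<subseteq> ?V" unfolding in_nbrs_def out_nbrs_def by auto
  have "abundant_order (in_nbrs F r) ?f" "abundant_order (out_nbrs F r) ?f"
    using F unfolding fork_on_def in_nbrs_def out_nbrs_def by auto
  then have "acyclic_quiver (induced F (in_nbrs F r))" "acyclic_quiver (induced F (out_nbrs F r))"
    using acyclic_induced[OF q _ sub(1)] acyclic_induced[OF q _ sub(2)] near sub by blast+
  moreover have "\<forall>i\<in>in_nbrs F r. \<forall>j\<in>out_nbrs F r. ?f j i > ?f i r \<and> ?f j i > ?f r j" "r \<in> ?V"
    using F unfolding fork_on_def in_nbrs_def out_nbrs_def by auto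
  ultimately show "fork F r" using q ab unfolding fork_def by blast
qed

lemma fork_on_cong:
  assumes "\<And>a b. a \<in> V \<Longrightarrow> b \<in> V \<Longrightarrow> f a b = g a b" and "fork_on V f r"
  shows "fork_on V g r"
proof -
  have r: "r \<in> V" using assms(2) unfolding fork_on_def by blast
  have e: "f i r = g i r" "f r i = g r i" if "i \<in> V" for i using assms(1) r that by auto
  have s: "{i\<in>V. g i r > 0} = {i\<in>V. f i r > 0}" "{i\<in>V. g r i > 0} = {i\<in>V. f r i > 0}"
    using e by auto
  have "abundant_order {i\<in>V. f i r > 0} g = abundant_order {i\<in>V. f i r > 0} f"
    "abundant_order {i\<in>V. f r i > 0} g = abundant_order {i\<in>V. f r i > 0} f"
    by (rule abundant_order_cong, simp add: assms(1))+
  then show ?thesis using assms e unfolding fork_on_def s by auto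
qed

lemma fork_on_restrict:
  assumes "V \<subseteq> W" shows "fork_on V (restrict_arr W f) r \<longleftrightarrow> fork_on V f r"
  using fork_on_cong[of V f "restrict_arr W f" r] fork_on_cong[of V "restrict_arr W f" f r] assms
  by (auto simp: restrict_arr_def subset_iff)

lemma abundant_order_restrict:
  assumes "V \<subseteq> W" shows "abundant_order V (restrict_arr W f) \<longleftrightarrow> abundant_order V f"
  using assms by (intro abundant_order_cong) (auto simp: restrict_arr_def)

lemma twins_restrict:
  assumes "k \<in> W" "k' \<in> W" shows "twins W (restrict_arr W f) k k' \<longleftrightarrow> twins W f k k'"
  using assms unfolding twins_def by (simp add: restrict_arr_def)

lemma prefork_on_restrict:
  "prefork_on W (restrict_arr W f) r k k' \<longleftrightarrow> prefork_on W f r k k'"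
  unfolding prefork_on_def using fork_on_restrict[of "W - {k}" W] fork_on_restrict[of "W - {k'}" W]
    twins_restrict[of k W k' f] by auto

lemma prefork_iff: "prefork P r k k' \<longleftrightarrow> is_quiver P \<and> prefork_on (verts P) (arr P) r k k'"
proof -
  have "fork (delete_verts P {x}) r \<longleftrightarrow> fork_on (verts P - {x}) (arr P) r" if "is_quiver P" for x
  proof -
    have v: "verts P \<inter> (verts P - {x}) = verts P - {x}" by auto
    show ?thesis
      unfolding delete_verts_def fork_iff induced_simps v
      using is_quiver_induced[OF that] fork_on_restrict[of "verts P - {x}" "verts P - {x}"] by auto
  qed
  then show ?thesis unfolding prefork_def prefork_on_def twins_def by blast
qed

section \<open>Mutation classes\<close>

lemma mutate_seq_eq: "mutate_seq u Q = \<lparr>verts = verts Q, arr = fold mut u (arr Q)\<rparr>"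
  unfolding mutate_seq_def by (induction u arbitrary: Q) (simp_all add: mutate_eq)

lemma mutation_class_self: "Q \<in> mutation_class Q"
  unfolding mutation_class_def mutate_seq_def by (auto intro!: exI[of _ "[]"])

lemma mutation_class_mutate:
  assumes "R \<in> mutation_class Q" "v \<in> verts Q" shows "mutate v R \<in> mutation_class Q"
proof -
  obtain u where u: "R = mutate_seq u Q" "set u \<subseteq> verts Q" using assms(1) unfolding mutation_class_def by auto
  then have "mutate v R = mutate_seq (u @ [v]) Q" "set (u @ [v]) \<subseteq> verts Q"
    using assms(2) by (simp_all add: mutate_seq_def)
  then show ?thesis unfolding mutation_class_def by blast
qed

lemma mutation_class_least:
  assumes R: "R \<in> mutation_class Q" and Q: "T Q"
    and step: "\<And>R v. T R \<Longrightarrow> R \<in> mutation_class Q \<Longrightarrow> v \<in> verts Q \<Longrightarrow> T (mutate v R)"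
  shows "T R"
proof -
  obtain u where u: "R = mutate_seq u Q" "set u \<subseteq> verts Q" using R unfolding mutation_class_def by auto
  have "T (mutate_seq u Q) \<and> mutate_seq u Q \<in> mutation_class Q" if "set u \<subseteq> verts Q" for u
    using that
  proof (induction u rule: rev_induct)
    case Nil
    then show ?case using Q mutation_class_self by (simp add: mutate_seq_def)
  next
    case (snoc v u)
    then show ?case using step mutation_class_mutate[of _ Q v] by (simp add: mutate_seq_def)
  qed
  then show ?thesis using u by blast
qed

lemma mutation_class_quiver:
  assumes "is_quiver Q" "R \<in> mutation_class Q" shows "is_quiver R" "verts R = verts Q"
proof -
  have "is_quiver R \<and> verts R = verts Q"
    by (rule mutation_class_least[OF assms(2)]) (use assms(1) is_quiver_mutate in auto)
  then show "is_quiver R" "verts R = verts Q" by auto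
qed

lemma mutation_class_trans:
  assumes "is_quiver Q" "R \<in> mutation_class Q" "S \<in> mutation_class R" shows "S \<in> mutation_class Q"
  by (rule mutation_class_least[OF assms(3)])
    (use assms mutation_class_mutate mutation_class_quiver(2)[OF assms(1,2)] in auto)

lemma mutation_class_sym:
  assumes q: "is_quiver Q" and R: "R \<in> mutation_class Q" shows "Q \<in> mutation_class R"
proof (rule mutation_class_least[OF R, of "\<lambda>R. Q \<in> mutation_class R"])
  show "Q \<in> mutation_class Q" by (rule mutation_class_self)
  fix S v assume S: "Q \<in> mutation_class S" "S \<in> mutation_class Q" "v \<in> verts Q"
  note qS = mutation_class_quiver[OF q S(2)]
  have "mutate v (mutate v S) \<in> mutation_class (mutate v S)"
    using mutation_class_mutate[OF mutation_class_self, of v "mutate v S"] qS S(3) by simp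
  then have "S \<in> mutation_class (mutate v S)" using mutate_mutate[OF qS(1)] by simp
  then show "Q \<in> mutation_class (mutate v S)"
    using mutation_class_trans[OF is_quiver_mutate[OF qS(1)] _ S(1)] by blast
qed

lemma mutation_class_orbit:
  assumes "is_quiver Q" "R \<in> mutation_class Q" "k \<in> verts Q" "k' \<in> verts Q" "g \<in> orbit k k' (arr R)"
  shows "\<lparr>verts = verts Q, arr = g\<rparr> \<in> mutation_class Q"
proof -
  have R: "\<lparr>verts = verts Q, arr = arr R\<rparr> = R" using mutation_class_quiver(2)[OF assms(1,2)] by simp
  have "orbit k k' (arr R) \<subseteq> {g. \<lparr>verts = verts Q, arr = g\<rparr> \<in> mutation_class Q}"
  proof (rule orbit_least)
    show "arr R \<in> {g. \<lparr>verts = verts Q, arr = g\<rparr> \<in> mutation_class Q}" using R assms(2) by simp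
  next
    fix g assume "g \<in> {g. \<lparr>verts = verts Q, arr = g\<rparr> \<in> mutation_class Q}"
    then show "mut k g \<in> {g. \<lparr>verts = verts Q, arr = g\<rparr> \<in> mutation_class Q}"
      "mut k' g \<in> {g. \<lparr>verts = verts Q, arr = g\<rparr> \<in> mutation_class Q}"
      using mutation_class_mutate[of "\<lparr>verts = verts Q, arr = g\<rparr>" Q] assms(3,4)
      by (simp_all add: mutate_eq)
  qed
  then show ?thesis using assms(5) by blast
qed

section \<open>Branches compared with nodes\<close>

definition in_node :: "'a set \<Rightarrow> ('a \<Rightarrow> 'a \<Rightarrow> int) \<Rightarrow> bool" where
  "in_node V g \<longleftrightarrow> (\<exists>S E. node V S E \<and> g \<in> S)"

text \<open>A walk that avoids the edges in \<open>X\<close> stays inside the set from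
  \<open>exits_closure\<close>, because the edges of all entries belong to \<open>X\<close>.\<close>

lemma component_exits:
  assumes q: "is_quiver P" and ex: "exits_to_nodes (verts P) S E" and P: "arr P \<in> S"
    and removed: "\<And>g v. (g, v) \<in> E \<Longrightarrow> mutation_edge \<lparr>verts = verts P, arr = g\<rparr> v \<in> X"
    and R: "R \<in> component (mutation_edges P - X) P"
  shows "verts R = verts P \<and> (arr R \<in> S \<or> in_node (verts P) (arr R))"
proof -
  obtain U where U: "S \<subseteq> U" "\<And>g. g \<in> U \<Longrightarrow> g \<in> S \<or> (\<exists>S E. node (verts P) S E \<and> g \<in> S)"
    "\<And>g v. g \<in> U \<Longrightarrow> v \<in> verts P \<Longrightarrow> (g, v) \<notin> E \<Longrightarrow> mut v g \<in> U"
    using exits_closure[OF ex] by blast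
  have "(P, R) \<in> {(A, B). \<exists>v. ({A, B}, v) \<in> mutation_edges P - X}\<^sup>*" using R unfolding component_def by simp
  then have "verts R = verts P \<and> arr R \<in> U"
  proof (induction rule: rtrancl_induct)
    case base
    then show ?case using P U(1) by auto
  next
    case (step A B)
    then obtain v where v: "({A, B}, v) \<in> mutation_edges P" "({A, B}, v) \<notin> X" by auto
    then obtain C where C: "{A, B} = {C, mutate v C}" "C \<in> mutation_class P" "v \<in> verts P"
      unfolding mutation_edges_def mutation_edge_def by auto
    have "mutate v (mutate v C) = C" by (rule mutate_mutate[OF mutation_class_quiver(1)[OF q C(2)]])
    \<comment> \<open>Edges are unordered, but as mutations are involutions either end is the
      mutation of the other at \<open>v\<close>.\<close>
    then have B: "B = mutate v A" using C(1) by (auto simp: doubleton_eq_iff)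
    have A: "A = \<lparr>verts = verts P, arr = arr A\<rparr>" using step.IH by simp
    then have "(arr A, v) \<notin> E" using removed[of "arr A" v] v(2) B unfolding mutation_edge_def by auto
    then show ?case using U(3) step.IH C(3) B by simp
  qed
  then show ?thesis using U(2) unfolding in_node_def by blast
qed

lemma fork_branch_in_node:
  assumes "fork F r" "R \<in> fork_branch F r"
  shows "in_node (verts F) (arr R)"
proof -
  have q: "is_quiver F" "fork_on (verts F) (arr F) r" using assms(1) unfolding fork_iff by blast+
  have n: "node (verts F) {arr F} {(arr F, r)}"
    using q unfolding node_def is_quiver_iff by blast
  have "verts R = verts F \<and> (arr R \<in> {arr F} \<or> in_node (verts F) (arr R))"
    using assms(2) unfolding fork_branch_def
    by (intro component_exits[OF q(1) node_exits[OF n], where X = "{mutation_edge F r}"]) auto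
  then show ?thesis using n unfolding in_node_def by blast
qed

text \<open>If the arrow goes from \<open>k'\<close> to \<open>k\<close>, the relation is available
  for the word beginning with \<open>k'\<close>. This word is a palindrome of involutions and hence
  its own inverse; conjugating with the interchange yields the word beginning with
  \<open>k\<close>.\<close>

lemma pentagon_prefork:
  assumes P: "prefork_on V f r k k'" and q: "quiver_on V f" and p: "\<bar>f k k'\<bar> = 1"
  shows "fold mut [k, k', k, k', k] f = swap_arr k k' f"
proof -
  have sk: "skew f" using q by (rule quiver_on_skew)
  consider "f k k' = 1" | "f k' k = 1" using p skewD[OF sk, of k k'] by force
  then show ?thesis
  proof cases
    case 1
    then show ?thesis using block.pentagon_swap[OF prefork_block(1)[OF P q]] by auto
  next
    case 2
    have P': "prefork_on V f r k' k" using P prefork_on_commute[of V f r k k'] by simp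
    have e: "fold mut [k', k, k', k, k'] f = swap_arr k k' f"
      using block.pentagon_swap[OF prefork_block(1)[OF P' q]] 2 swap_arr_commute[of k' k] by auto
    have "fold mut [k', k, k', k, k'] (fold mut [k', k, k', k, k'] f) = f" using sk by simp
    then have "fold mut [k', k, k', k, k'] (swap_arr k k' f) = f" unfolding e .
    then have "swap_arr k k' (fold mut [k, k', k, k', k] f) = f" by (simp add: mut_swap_arrs)
    then show ?thesis by (metis swap_arr_swap_arr)
  qed
qed

lemma prefork_branch_in_node:
  assumes "prefork P r k k'" "R \<in> prefork_branch P r k k'"
  shows "in_node (verts P) (arr R)"
proof -
  let ?V = "verts P" and ?f = "arr P"
  have q: "is_quiver P" "quiver_on ?V ?f" and P: "prefork_on ?V ?f r k k'"
    using assms(1) unfolding prefork_iff is_quiver_iff by auto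
  show ?thesis
  proof (cases "\<bar>?f k k'\<bar> \<le> 1")
    case False
    then have "fork P r" unfolding fork_iff using fork_on_if_prefork_on[OF P quiver_on_skew[OF q(2)]] q(1) by simp
    moreover have "R \<in> fork_branch P r"
      using assms(2) False unfolding prefork_branch_def fork_branch_def by auto
    ultimately show ?thesis by (rule fork_branch_in_node)
  next
    case True
    define X where "X = (if \<bar>?f k k'\<bar> = 1
      then {mutation_edge P r, mutation_edge (mutate_seq [k, k', k, k', k] P) r} else {mutation_edge P r})"
    have n: "node ?V (orbit k k' ?f) (entries ?f r k k')"
      unfolding node_def using q(2) P True by blast
    have "R \<in> component (mutation_edges P - X) P"
      using assms(2) unfolding prefork_branch_def X_def by (auto split: if_splits)
    moreover have "mutation_edge \<lparr>verts = ?V, arr = g\<rparr> v \<in> X" if "(g, v) \<in> entries ?f r k k'" for g v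
      using that pentagon_prefork[OF P q(2)] unfolding entries_def X_def mutate_seq_eq
      by (auto split: if_splits)
    ultimately have "verts R = ?V \<and> (arr R \<in> orbit k k' ?f \<or> in_node ?V (arr R))"
      by (intro component_exits[OF q(1) node_exits[OF n] orbit_refl]) auto
    then show ?thesis using n unfolding in_node_def by blast
  qed
qed

text \<open>A fork lies in its own branch. The orbit of a pre-fork lies in its branch because the
  removed edges carry the label \<open>r\<close>, which differs from \<open>k\<close> and
  \<open>k'\<close>.\<close>

lemma not_in_node_if_preforkless:
  assumes q: "is_quiver Q" and R: "R \<in> preforkless_part Q"
  shows "\<not> in_node (verts Q) (arr R)"
proof
  have RQ: "R \<in> mutation_class Q" using R unfolding preforkless_part_def by auto
  note qR = mutation_class_quiver[OF q RQ]
  have R_eq: "\<lparr>verts = verts Q, arr = arr R\<rparr> = R" using qR(2) by simp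
  assume "in_node (verts Q) (arr R)"
  then obtain S E where "node (verts Q) S E" "arr R \<in> S" unfolding in_node_def by blast
  then consider (fork) r where "fork_on (verts Q) (arr R) r"
    | (prefork) f r k k' where "quiver_on (verts Q) f" "prefork_on (verts Q) f r k k'" "arr R \<in> orbit k k' f"
    unfolding node_def by blast
  then show False
  proof cases
    case fork
    then have "fork R r" unfolding fork_iff using qR by simp
    moreover have "R \<in> fork_branch R r" unfolding fork_branch_def component_def by simp
    ultimately show False using R RQ unfolding preforkless_part_def by blast
  next
    case prefork
    define P where "P = \<lparr>verts = verts Q, arr = f\<rparr>"
    have V: "k \<in> verts Q" "k' \<in> verts Q" and rk: "r \<noteq> k" "r \<noteq> k'"
      using prefork(2) prefork_on_root[OF prefork(2)] unfolding prefork_on_def by auto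
    have "f \<in> orbit k k' (arr R)" using orbit_sym[OF quiver_on_skew[OF prefork(1)] prefork(3)] .
    then have PQ: "P \<in> mutation_class Q" unfolding P_def by (rule mutation_class_orbit[OF q RQ V])
    have pf: "prefork P r k k'"
      unfolding prefork_iff using mutation_class_quiver[OF q PQ] prefork(2) by (simp add: P_def)
    have qP: "is_quiver P" "verts P = verts Q" using mutation_class_quiver[OF q PQ] by auto
    define E where "E = (if \<bar>arr P k k'\<bar> = 1
      then mutation_edges P - {mutation_edge P r, mutation_edge (mutate_seq [k, k', k, k', k] P) r}
      else mutation_edges P - {mutation_edge P r})"
    have E: "mutation_edge S v \<in> E" if "S \<in> mutation_class P" "v \<in> {k, k'}" for S v
      using that V qP(2) rk unfolding E_def mutation_edges_def mutation_edge_def by auto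
    let ?S = "{g. \<lparr>verts = verts Q, arr = g\<rparr> \<in> mutation_class P \<inter> component E P}"
    have step: "mut v g \<in> ?S" if g: "g \<in> ?S" and v: "v \<in> {k, k'}" for v g
    proof -
      let ?G = "\<lparr>verts = verts Q, arr = g\<rparr>"
      have "mutate v ?G \<in> mutation_class P" using mutation_class_mutate[of ?G P v] g v V qP(2) by auto
      moreover have "({?G, mutate v ?G}, v) \<in> E" using E[of ?G v] g v unfolding mutation_edge_def by auto
      then have "mutate v ?G \<in> component E P"
        using g unfolding component_def by (auto intro: rtrancl_into_rtrancl)
      ultimately show ?thesis by (simp add: mutate_eq)
    qed
    have "orbit k k' f \<subseteq> ?S"
    proof (rule orbit_least)
      show "f \<in> ?S" using mutation_class_self[of P] unfolding P_def component_def by auto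
    qed (use step in blast)+
    then have "R \<in> component E P" using prefork(3) R_eq by auto
    then have "R \<in> prefork_branch P r k k'" unfolding prefork_branch_def E_def by (auto split: if_splits)
    then show False using R PQ pf unfolding preforkless_part_def by blast
  qed
qed

lemma in_node_if_not_preforkless:
  assumes q: "is_quiver Q" and R: "R \<in> mutation_class Q" "R \<notin> preforkless_part Q"
  shows "in_node (verts Q) (arr R)"
  using R fork_branch_in_node prefork_branch_in_node mutation_class_quiver(2)[OF q]
  unfolding preforkless_part_def by fastforce

section \<open>Restriction to full subquivers and the count\<close>

lemma orbit_restrict:
  assumes "g \<in> orbit k k' f" "k \<in> W" "k' \<in> W"
  shows "restrict_arr W g \<in> orbit k k' (restrict_arr W f)"
proof -
  have "orbit k k' f \<subseteq> {g. restrict_arr W g \<in> orbit k k' (restrict_arr W f)}"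
    by (rule orbit_least) (use orbit_mut assms(2,3) in \<open>auto simp: mut_restrict[symmetric]\<close>)
  then show ?thesis using assms(1) by blast
qed

lemma in_node_if_fork_on:
  assumes "quiver_on V g" "fork_on V g r" shows "in_node V g"
proof -
  have "node V {g} {(g, r)}" using assms unfolding node_def by blast
  then show ?thesis unfolding in_node_def by blast
qed

lemma in_node_if_prefork_on:
  assumes "quiver_on V f" "prefork_on V f r k k'" "\<bar>f k k'\<bar> \<le> 1" "g \<in> orbit k k' f" shows "in_node V g"
proof -
  have "node V (orbit k k' f) (entries f r k k')" using assms(1-3) unfolding node_def by blast
  then show ?thesis using assms(4) unfolding in_node_def by blast
qed

lemma in_node_cases:
  assumes "in_node V g"
  obtains r where "quiver_on V g" "fork_on V g r"
  | f r k k' where "quiver_on V f" "prefork_on V f r k k'" "\<bar>f k k'\<bar> \<le> 1" "g \<in> orbit k k' f"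
proof -
  obtain S E where S: "node V S E" "g \<in> S" using assms unfolding in_node_def by blast
  show thesis
    using S(1) unfolding node_def
  proof (elim disjE exE conjE)
    fix f r assume "quiver_on V f" "fork_on V f r" "S = {f}"
    then show thesis using S(2) that(1) by auto
  next
    fix f r k k' assume "quiver_on V f" "prefork_on V f r k k'" "\<bar>f k k'\<bar> \<le> 1" "S = orbit k k' f"
    then show thesis using S(2) that(2) by auto
  qed
qed

text \<open>If \<open>W\<close> misses \<open>k\<close> or \<open>k'\<close>, every stage of the
  orbit leaves a fork or an order (\<open>prefork_orbit\<close>). Otherwise restriction commutes
  with the mutations of the orbit, and the pre-fork at its origin restricts to a pre-fork or an
  almost order. In the latter case only some member of the orbit of \<open>g\<close> is known to be
  almost ordered, whence the third alternative.\<close>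

lemma in_node_restrict:
  assumes n: "in_node V g" and W: "W \<subseteq> V"
  shows "in_node W (restrict_arr W g) \<or> almost_order W (restrict_arr W g) \<or>
    (\<exists>k\<in>W. \<exists>k'\<in>W. \<exists>h\<in>orbit k k' (restrict_arr W g). almost_order W h)"
proof -
  have fo: "in_node W (restrict_arr W g) \<or> almost_order W (restrict_arr W g)"
    if "quiver_on V g" "fork_or_order U g" "W \<subseteq> U" for U
  proof -
    have q: "quiver_on W (restrict_arr W g)" using quiver_on_restrict that(1) by blast
    have "fork_or_order W g"
      using fork_or_order_subset[OF quiver_on_skew[OF that(1)] that(2,3)] .
    then consider "abundant_order W g" | r where "fork_on W g r" unfolding fork_or_order_def by blast
    then show ?thesis
    proof cases
      case 1
      then show ?thesis using abundant_order_restrict[of W W g] unfolding almost_order_def by simp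
    next
      case 2
      then show ?thesis using in_node_if_fork_on[OF q] fork_on_restrict[of W W g r] by simp
    qed
  qed
  from n show ?thesis
  proof (cases rule: in_node_cases)
    case (1 r)
    then show ?thesis using fo[of V] W unfolding fork_or_order_def by blast
  next
    case (2 f r k k')
    have qg: "quiver_on V g" using quiver_on_orbit[OF 2(1,4)] .
    have sk: "skew f" using quiver_on_skew[OF 2(1)] .
    have V: "k \<in> V" "k' \<in> V" "k \<noteq> k'" and tw: "twins V f k k'"
      and F: "fork_on (V - {k}) f r" "fork_on (V - {k'}) f r" using 2(2) unfolding prefork_on_def by auto
    have r: "r \<noteq> k" "r \<noteq> k'" "r \<in> V" using prefork_on_root[OF 2(2)] by auto
    show ?thesis
    proof (cases "k \<in> W \<and> k' \<in> W")
      case False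
      then have "W \<subseteq> V - {k} \<or> W \<subseteq> V - {k'}" using W by blast
      then show ?thesis
        using fo[OF qg] prefork_orbit(2,3)[OF 2(2,1,3,4)] by blast
    next
      case True
      have or: "restrict_arr W g \<in> orbit k k' (restrict_arr W f)"
        using orbit_restrict[OF 2(4)] True by blast
      have qW: "quiver_on W (restrict_arr W f)" using quiver_on_restrict[OF 2(1)] .
      have twW: "twins W f k k'" using twins_subset[OF tw W] .
      have sub: "W - {k} \<subseteq> V - {k}" "W - {k'} \<subseteq> V - {k'}" using W by auto
      note s = fork_on_subset[OF sk F(1) sub(1)] fork_on_subset[OF sk F(2) sub(2)]
      show ?thesis
      proof (cases "r \<in> W \<and> (\<exists>i\<in>W. f i r > 0) \<and> (\<exists>j\<in>W. f r j > 0)")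
        case T: True
        then have tr: "f k r > 0 \<and> f k' r > 0 \<or> f r k > 0 \<and> f r k' > 0"
          using tw r unfolding twins_def by blast
        have iff: "f k r > 0 \<longleftrightarrow> f k' r > 0" "f r k > 0 \<longleftrightarrow> f r k' > 0"
          using tr skewD[OF sk, of k r] skewD[OF sk, of k' r] by auto
        \<comment> \<open>If \<open>x\<close> itself is the surviving neighbour of \<open>r\<close>,
          its twin, which is on the same side of \<open>r\<close>, replaces it.\<close>
        have "\<exists>i\<in>W - {x}. f i r > 0" "\<exists>j\<in>W - {x}. f r j > 0" if "x \<in> {k, k'}" for x
          using T True iff V(3) that by (metis Diff_iff insertE singletonD)+
        then have "fork_on (W - {k}) f r" "fork_on (W - {k'}) f r"
          using s T r by (auto split: if_splits)
        then have "prefork_on W (restrict_arr W f) r k k'"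
          unfolding prefork_on_restrict using True V(3) twW unfolding prefork_on_def by blast
        moreover have "\<bar>restrict_arr W f k k'\<bar> \<le> 1" using 2(3) True by (simp add: restrict_arr_def)
        ultimately show ?thesis using in_node_if_prefork_on[OF qW _ _ or] by blast
      next
        case F: False
        have "abundant_order (W - {k}) f" "abundant_order (W - {k'}) f"
          using s F by (auto split: if_splits)
        then have "almost_order W (restrict_arr W f)"
          unfolding almost_order_def
          using abundant_order_restrict[of "W - {k}" W f] abundant_order_restrict[of "W - {k'}" W f]
            twins_restrict[of k W k' f] True V(3) twW by blast
        moreover have "restrict_arr W f \<in> orbit k k' (restrict_arr W g)"
          using orbit_sym[OF quiver_on_skew[OF qW] or] .
        ultimately show ?thesis using True by blast
      qed
    qed
  qed
qed

lemma mutate_induced: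
  assumes "v \<in> W" "W \<subseteq> verts R" shows "mutate v (induced R W) = induced (mutate v R) W"
proof -
  have "verts R \<inter> W = W" using assms(2) by auto
  then show ?thesis using mut_restrict[OF assms(1)] by (simp add: induced_eq mutate_eq)
qed

text \<open>Mutation at a vertex of \<open>W\<close> commutes with restriction to \<open>W\<close>,
  so the mutations leading to \<open>R'\<close> can be carried out in \<open>Q\<close>.\<close>

lemma mutation_class_induced:
  assumes q: "is_quiver Q" and W: "W \<subseteq> verts Q" and R: "R' \<in> mutation_class (induced Q W)"
  obtains R where "R \<in> mutation_class Q" "R' = induced R W"
proof -
  have "\<exists>R\<in>mutation_class Q. R' = induced R W"
    using R
  proof (rule mutation_class_least)
    show "\<exists>R\<in>mutation_class Q. induced Q W = induced R W" using mutation_class_self by blast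
    fix S v assume S: "\<exists>R\<in>mutation_class Q. S = induced R W" and v: "v \<in> verts (induced Q W)"
    obtain R where R: "R \<in> mutation_class Q" "S = induced R W" using S by blast
    have "v \<in> W" "v \<in> verts Q" "W \<subseteq> verts R" using v W mutation_class_quiver(2)[OF q R(1)] by auto
    then have "mutate v S = induced (mutate v R) W" "mutate v R \<in> mutation_class Q"
      using R mutate_induced mutation_class_mutate by auto
    then show "\<exists>R\<in>mutation_class Q. mutate v S = induced R W" by blast
  qed
  then show ?thesis using that by blast
qed

text \<open>With at most two vertices no path joins two vertices through a third, so every mutation
  just reverses all arrows.\<close>

lemma small_mutation_class:
  assumes q: "is_quiver Q" and c: "card (verts Q) \<le> 2"
  shows "finite (mutation_class Q)" "card (mutation_class Q) \<le> 2"
proof -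
  let ?V = "verts Q"
  have fin: "finite ?V" using q unfolding is_quiver_iff by auto
  have m: "mut v f = rev_arr f" if f: "quiver_on ?V f" and v: "v \<in> ?V" for v f
  proof (intro ext)
    fix i j
    have sk: "skew f" using quiver_on_skew[OF f] .
    have z: "f i j = 0" if "i \<notin> ?V \<or> j \<notin> ?V" for i j using f that unfolding quiver_on_def by blast
    show "mut v f i j = rev_arr f i j"
    proof (cases "v = i \<or> v = j \<or> i = j")
      case True
      then show ?thesis using sk by (auto simp: mut_def rev_arr_def)
    next
      case False
      have "\<not> {v, i, j} \<subseteq> ?V"
      proof
        assume "{v, i, j} \<subseteq> ?V"
        then have "card {v, i, j} \<le> card ?V" by (rule card_mono[OF fin])
        then show False using False c by auto
      qed
      then have "i \<notin> ?V \<or> j \<notin> ?V" using v by auto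
      then have "f i j = 0" "f i v = 0 \<and> f v i = 0 \<or> f j v = 0 \<and> f v j = 0" using z by blast+
      then show ?thesis by (auto simp: mut_def rev_arr_def)
    qed
  qed
  let ?Q' = "\<lparr>verts = ?V, arr = rev_arr (arr Q)\<rparr>"
  have "mutation_class Q \<subseteq> {Q, ?Q'}"
  proof
    fix R assume R: "R \<in> mutation_class Q"
    show "R \<in> {Q, ?Q'}"
    proof (rule mutation_class_least[OF R])
      fix S v assume S: "S \<in> {Q, ?Q'}" "S \<in> mutation_class Q" "v \<in> ?V"
      have "quiver_on ?V (arr S)"
        using mutation_class_quiver[OF q S(2)] unfolding is_quiver_iff by auto
      then have "mut v (arr S) = rev_arr (arr S)" using m S(3) by blast
      then show "mutate v S \<in> {Q, ?Q'}" using S(1) by (auto simp: mutate_eq)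
    qed simp
  qed
  then show "finite (mutation_class Q)" "card (mutation_class Q) \<le> 2"
    using finite_subset[of _ "{Q, ?Q'}"] card_mono[of "{Q, ?Q'}" "mutation_class Q"]
      card_insert_le_m1[of 2 "{?Q'}" Q] by auto
qed

text \<open>The set \<open>Z\<close> has no entries, so its closure \<open>U\<close> is closed under
  all mutations and covers the whole class; every quiver of the class outside \<open>Z\<close> lies
  in a node.\<close>

lemma preforkless_almost_order:
  assumes q: "is_quiver Q" and c: "3 \<le> card (verts Q)"
    and S: "S \<in> mutation_class Q" "almost_order (verts Q) (arr S)"
  shows "finite (preforkless_part Q)" "card (preforkless_part Q) \<le> 10 * (card (verts Q) - 2)"
proof -
  let ?V = "verts Q"
  have qS: "is_quiver S" "verts S = ?V" using mutation_class_quiver[OF q S(1)] by auto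
  then have fin: "finite ?V" "quiver_on ?V (arr S)" unfolding is_quiver_iff by auto
  obtain Z where Z: "exits_to_nodes ?V Z {}" "arr S \<in> Z" "finite Z" "card Z \<le> 10 * (card ?V - 2)"
    using almost_order_exits[OF fin(2) S(2) fin(1) c] by blast
  obtain U where U: "Z \<subseteq> U" "\<And>g. g \<in> U \<Longrightarrow> g \<in> Z \<or> (\<exists>S E. node ?V S E \<and> g \<in> S)"
    "\<And>g v. g \<in> U \<Longrightarrow> v \<in> ?V \<Longrightarrow> (g, v) \<notin> {} \<Longrightarrow> mut v g \<in> U"
    using exits_closure[OF Z(1)] by blast
  have sub: "preforkless_part Q \<subseteq> (\<lambda>g. \<lparr>verts = ?V, arr = g\<rparr>) ` Z"
  proof
    fix R assume R: "R \<in> preforkless_part Q"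
    then have RQ: "R \<in> mutation_class Q" unfolding preforkless_part_def by auto
    have "R \<in> mutation_class S"
      using mutation_class_trans[OF qS(1) mutation_class_sym[OF q S(1)] RQ] .
    then have "arr R \<in> U"
      by (rule mutation_class_least) (use U(1,3) Z(2) qS(2) in auto)
    then have "arr R \<in> Z"
      using U(2) not_in_node_if_preforkless[OF q R] unfolding in_node_def by blast
    moreover have "R = \<lparr>verts = ?V, arr = arr R\<rparr>" using mutation_class_quiver(2)[OF q RQ] by simp
    ultimately show "R \<in> (\<lambda>g. \<lparr>verts = ?V, arr = g\<rparr>) ` Z" by blast
  qed
  show "finite (preforkless_part Q)" using finite_subset[OF sub] Z(3) by blast
  have "card (preforkless_part Q) \<le> card Z"
    using card_mono[OF _ sub] card_image_le[OF Z(3)] Z(3) by (meson finite_imageI le_trans)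
  then show "card (preforkless_part Q) \<le> 10 * (card ?V - 2)" using Z(4) by simp
qed

text \<open>Any lift \<open>R\<close> of \<open>R'\<close> serves: were it in a branch, restriction
  would put \<open>R'\<close> into a node or an almost order into its class. An inclusion in an
  image already bounds the count.\<close>

lemma preforkless_induced:
  assumes q: "is_quiver Q" and W: "W \<subseteq> verts Q"
    and no: "\<And>S. S \<in> mutation_class (induced Q W) \<Longrightarrow> \<not> almost_order W (arr S)"
  shows "preforkless_part (induced Q W) \<subseteq> (\<lambda>R. induced R W) ` preforkless_part Q"
proof
  fix R' assume R': "R' \<in> preforkless_part (induced Q W)"
  have qW: "is_quiver (induced Q W)" "verts (induced Q W) = W" using is_quiver_induced[OF q] W by auto
  have R'Q: "R' \<in> mutation_class (induced Q W)" using R' unfolding preforkless_part_def by auto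
  obtain R where R: "R \<in> mutation_class Q" "R' = induced R W"
    using mutation_class_induced[OF q W R'Q] by blast
  have arr: "arr R' = restrict_arr W (arr R)"
    using R(2) mutation_class_quiver(2)[OF q R(1)] W by (simp add: Int_absorb1)
  have "R \<in> preforkless_part Q"
  proof (rule ccontr)
    assume "R \<notin> preforkless_part Q"
    then have "in_node (verts Q) (arr R)" using in_node_if_not_preforkless[OF q R(1)] by blast
    then consider "in_node W (arr R')" | "almost_order W (arr R')"
      | k k' h where "k \<in> W" "k' \<in> W" "h \<in> orbit k k' (arr R')" "almost_order W h"
      using in_node_restrict[OF _ W] unfolding arr by blast
    then show False
    proof cases
      case 1
      then show False using not_in_node_if_preforkless[OF qW(1) R'] qW(2) by simp
    next
      case 2
      then show False using no[OF R'Q] by simp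
    next
      case 3
      then show False using no[OF mutation_class_orbit[OF qW(1) R'Q]] qW(2) by auto
    qed
  qed
  then show "R' \<in> (\<lambda>R. induced R W) ` preforkless_part Q" using R(2) by blast
qed

text \<open>If \<open>m = 2\<close> and there is an arrow, both quivers of the class of
  \<open>Q'\<close> are in the preforkless part, since a fork has at least three vertices, while 10m
  - 20 is 0. Hence for \<open>m\<close> below 3 the inequality is asserted under
  \<open>M \<ge> 2\<close>; finiteness is asserted throughout.\<close>

theorem theorem1p2:
  fixes Q Q' :: "'a quiver" and M m :: nat
  assumes "is_quiver Q"
    and "has_finite_preforkless_part Q"
    and "M = card (preforkless_part Q)"
    and "full_subquiver Q' Q"
    and "m = card (verts Q')"
  shows "has_finite_preforkless_part Q' \<and>
    (m \<ge> 3 \<or> M \<ge> 2 \<longrightarrow>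
       int (card (preforkless_part Q')) \<le> max (int M) (10 * int m - 20))"
proof -
  obtain W where W: "W \<subseteq> verts Q" "Q' = induced Q W" using assms(4) unfolding full_subquiver_def by blast
  have q': "is_quiver Q'" "verts Q' = W" using is_quiver_induced[OF assms(1)] W by auto
  have fin: "finite (preforkless_part Q)" using assms(2) unfolding has_finite_preforkless_part_def .
  consider "\<And>S. S \<in> mutation_class Q' \<Longrightarrow> \<not> almost_order W (arr S)"
    | S where "3 \<le> m" "S \<in> mutation_class Q'" "almost_order W (arr S)" | "m \<le> 2"
    by (metis not_less_eq_eq numeral_2_eq_2 numeral_3_eq_3)
  then show ?thesis
  proof cases
    case 1
    then have sub: "preforkless_part Q' \<subseteq> (\<lambda>R. induced R W) ` preforkless_part Q"
      using preforkless_induced[OF assms(1) W(1)] W(2) by blast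
    have "card (preforkless_part Q') \<le> M"
      using card_mono[OF _ sub] card_image_le[OF fin] fin assms(3) by (metis finite_imageI le_trans)
    then show ?thesis
      using finite_subset[OF sub] fin unfolding has_finite_preforkless_part_def by auto
  next
    case (2 S)
    then have "finite (preforkless_part Q')" "card (preforkless_part Q') \<le> 10 * (m - 2)"
      using preforkless_almost_order[OF q'(1) _ 2(2)] q'(2) assms(5) by auto
    then show ?thesis using 2(1) unfolding has_finite_preforkless_part_def by auto
  next
    case 3
    have sub: "preforkless_part Q' \<subseteq> mutation_class Q'" unfolding preforkless_part_def by auto
    have "finite (mutation_class Q')" "card (mutation_class Q') \<le> 2"
      using small_mutation_class[OF q'(1)] 3 assms(5) by auto
    then have "finite (preforkless_part Q')" "card (preforkless_part Q') \<le> 2"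
      using finite_subset[OF sub] card_mono[OF _ sub] by auto
    then show ?thesis using 3 unfolding has_finite_preforkless_part_def by auto
  qed
qed

end
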